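(* Let $n\ge 2$, let $\Omega\subset\mathbb{R}^n$ be open and bounded, let $0<s\le t<1$, $1<p\le q<\infty$, $\Lambda\ge 1$, and let the kernels $K_{sp},K_{tq}$ and the coefficient $a$ be as in the context. Assume moreover that there are $\alpha\in(0,1]$ and $[a]_\alpha\ge 0$ with $$|a(x_1,y_1)-a(x_2,y_2)|\le [a]_\alpha(|x_1-x_2|+|y_1-y_2|)^\alpha\quad\text{for all }(x_1,y_1),(x_2,y_2)\in\mathbb{R}^n\times\mathbb{R}^n,$$ and that $\alpha<tq\le sp+\alpha$. Let $u\in\mathcal{A}(\Omega)\cap L^{p-1}_{sp}(\mathbb{R}^n)\cap L^{q-1}_{a,tq}(\Omega,\mathbb{R}^n)$ be a locally bounded minimizer of $\mathcal{F}(\cdot;\Omega)$ that is nonnegative in a ball $B_{4R}(x_0)\subset\Omega$ with $R\le 1$. Then there is a constant $\gamma\in(0,1)$, depending only on $\mathbf{data}(B_{4R}(x_0))$, such that $$\inf_{B_R(x_0)}u+h_{4R}^{-1}\big(\mathrm{Tail}(u_-;x_0,4R)+\mathrm{Tail}_a(u_-;x_0,4R)\big)\ge\gamma\min\left\{(u^{p-1})_{B_{2R}}^{\frac1{p-1}},(u^{q-1})_{B_{2R}}^{\frac1{q-1}}\right\},$$ where $(v)_{B_{2R}}:=\frac{1}{|B_{2R}(x_0)|}\int_{B_{2R}(x_0)}v\,dx$.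
   Context: Setting. $B_r(x_0)=\{x\in\mathbb{R}^n:|x-x_0|<r\}$. The kernels $K_{sp},K_{tq}:\mathbb{R}^n\times\mathbb{R}^n\to[0,\infty)$ are measurable and satisfy $$\frac{\Lambda^{-1}}{|x-y|^{n+sp}}\le K_{sp}(x,y)\le\frac{\Lambda}{|x-y|^{n+sp}},\qquad \frac{\Lambda^{-1}}{|x-y|^{n+tq}}\le K_{tq}(x,y)\le\frac{\Lambda}{|x-y|^{n+tq}}.$$ The coefficient $a:\mathbb{R}^n\times\mathbb{R}^n\to\mathbb{R}$ is measurable with $0\le a(x,y)=a(y,x)$. Put $\mathcal{C}_\Omega=(\mathbb{R}^n\times\mathbb{R}^n)\setminus((\mathbb{R}^n\setminus\Omega)\times(\mathbb{R}^n\setminus\Omega))$ and $$\mathcal{F}(u;\Omega)=\iint_{\mathcal{C}_\Omega}\big[|u(x)-u(y)|^pK_{sp}(x,y)+a(x,y)|u(x)-u(y)|^qK_{tq}(x,y)\big]\,dx\,dy.$$ Function spaces and minimizers (all functions measurable). $\mathcal{A}(\Omega)$ is the set of $u:\mathbb{R}^n\to\mathbb{R}$ with $u|_\Omega\in L^p(\Omega)$ and $$\iint_{\mathcal{C}_\Omega}\frac{|u(x)-u(y)|^p}{|x-y|^{n+sp}}+a(x,y)\frac{|u(x)-u(y)|^q}{|x-y|^{n+tq}}\,dx\,dy<\infty.$$ $L^{p-1}_{sp}(\mathbb{R}^n)$ is the set of $u$ with $\int_{\mathbb{R}^n}\frac{|u(x)|^{p-1}}{(1+|x|)^{n+sp}}\,dx<\infty$;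 $L^{q-1}_{a,tq}(\Omega,\mathbb{R}^n)$ is the set of $u$ with $\sup_{x\in\Omega}\int_{\mathbb{R}^n}a(x,y)\frac{|u(y)|^{q-1}}{(1+|y|)^{n+tq}}\,dy<\infty$. A function $u\in\mathcal{A}(\Omega)$ is a minimizer of $\mathcal{F}(\cdot;\Omega)$ if $\mathcal{F}(u;\Omega)\le\mathcal{F}(v;\Omega)$ for every $v\in\mathcal{A}(\Omega)$ with $v=u$ a.e. in $\mathbb{R}^n\setminus\Omega$. Locally bounded means locally bounded in $\Omega$. Pointwise inequalities, suprema and infima of $u$ are understood in the a.e./essential sense; $u_\pm=\max\{\pm u,0\}$. Further notation. $a_r^-=\inf_{B_r(x_0)\times B_r(x_0)}a(x,y)$; for $k\ge 0$, $h_r(k)=\frac{k^{p-1}}{r^{sp}}+a_r^-\frac{k^{q-1}}{r^{tq}}$, and $h_r^{-1}$ is the inverse of $h_r$ on $[0,\infty)$. $$\mathrm{Tail}(u_-;x_0,r)=\int_{\mathbb{R}^n\setminus B_r(x_0)}\frac{u_-^{p-1}(x)}{|x-x_0|^{n+sp}}\,dx,\qquad \mathrm{Tail}_a(u_-;x_0,r)=\sup_{y\in B_r(x_0)}\int_{\mathbb{R}^n\setminus B_r(x_0)}a(x,y)\frac{u_-^{q-1}(x)}{|x-x_0|^{n+tq}}\,dx.$$ For $D\subset\Omega$, $\mathbf{data}(D)$ is the list $n,p,q,s,t,\Lambda,\alpha,[a]_\alpha,\|u\|_{L^\infty(D)}$ if $sp\le n$, and $n,p,q,s,t,\Lambda,\alpha,[a]_\alpha,[u]_{W^{s,p}(D)}$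 if $sp>n$, where $[u]_{W^{s,p}(D)}=\big(\int_D\int_D\frac{|u(x)-u(y)|^p}{|x-y|^{n+sp}}dxdy\big)^{1/p}$. Dependence on $\mathbf{data}(D)$ presupposes that the listed quantities are finite (in particular $u$ is bounded in $D$). *)

theory Defs
  imports "HOL-Probability.Essential_Supremum"
begin

text \<open>
  ``Measurable'' means Lebesgue measurable; a function of two points is measurable if it is
  so on the product space.  Integrals of nonnegative functions are taken in \<open>ennreal\<close>.
  Real powers are written with \<open>powr\<close>, where \<open>0 powr b = 0\<close>; together with \<open>x / 0 = 0\<close>
  this makes the integrands below vanish on the diagonal, which is a null set.
  The dimension \<open>n\<close> is \<open>DIM('a)\<close>.
\<close>

text \<open>The ellipticity bounds on a kernel of order \<open>\<beta>\<close> (\<open>\<beta> = s * p\<close> or \<open>\<beta> = t * q\<close>) are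
  imposed off the diagonal, where \<open>1 / \<bar>x - y\<bar> ^ (n + \<beta>)\<close> is meaningful.\<close>

definition kernel_cond :: "real \<Rightarrow> real \<Rightarrow> ('a::euclidean_space \<Rightarrow> 'a \<Rightarrow> real) \<Rightarrow> bool" where
  "kernel_cond \<Lambda> \<beta> K \<longleftrightarrow>
     (\<lambda>(x, y). K x y) \<in> borel_measurable lebesgue \<and>
     (\<forall>x y. 0 \<le> K x y) \<and>
     (\<forall>x y. x \<noteq> y \<longrightarrow>
        inverse \<Lambda> / norm (x - y) powr (real DIM('a) + \<beta>) \<le> K x y \<and>
        K x y \<le> \<Lambda> / norm (x - y) powr (real DIM('a) + \<beta>))"

definition coeff_cond :: "('a::euclidean_space \<Rightarrow> 'a \<Rightarrow> real) \<Rightarrow> bool" where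
  "coeff_cond a \<longleftrightarrow>
     (\<lambda>(x, y). a x y) \<in> borel_measurable lebesgue \<and>
     (\<forall>x y. 0 \<le> a x y \<and> a x y = a y x)"

definition holder_coeff :: "real \<Rightarrow> real \<Rightarrow> ('a::euclidean_space \<Rightarrow> 'a \<Rightarrow> real) \<Rightarrow> bool" where
  "holder_coeff \<alpha> A a \<longleftrightarrow>
     (\<forall>x1 y1 x2 y2. \<bar>a x1 y1 - a x2 y2\<bar> \<le> A * (norm (x1 - x2) + norm (y1 - y2)) powr \<alpha>)"

definition C_region :: "'a set \<Rightarrow> ('a \<times> 'a) set" where
  "C_region \<Omega> = UNIV - (UNIV - \<Omega>) \<times> (UNIV - \<Omega>)"

definition energy ::
  "real \<Rightarrow> real \<Rightarrow> ('a::euclidean_space \<Rightarrow> 'a \<Rightarrow> real) \<Rightarrow> ('a \<Rightarrow> 'a \<Rightarrow> real) \<Rightarrow> ('a \<Rightarrow> 'a \<Rightarrow> real)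
     \<Rightarrow> 'a set \<Rightarrow> ('a \<Rightarrow> real) \<Rightarrow> ennreal" where
  "energy p q Ksp Ktq a \<Omega> u =
     (\<integral>\<^sup>+ z \<in> C_region \<Omega>.
        (case z of (x, y) \<Rightarrow>
           ennreal (\<bar>u x - u y\<bar> powr p * Ksp x y + a x y * \<bar>u x - u y\<bar> powr q * Ktq x y))
      \<partial>lebesgue)"

definition admissible ::
  "real \<Rightarrow> real \<Rightarrow> real \<Rightarrow> real \<Rightarrow> ('a::euclidean_space \<Rightarrow> 'a \<Rightarrow> real) \<Rightarrow> 'a set \<Rightarrow> ('a \<Rightarrow> real) set" where
  "admissible s t p q a \<Omega> =
     {u \<in> borel_measurable lebesgue.
        (\<integral>\<^sup>+ x \<in> \<Omega>. ennreal (\<bar>u x\<bar> powr p) \<partial>lebesgue) < \<infinity> \<and>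
        (\<integral>\<^sup>+ z \<in> C_region \<Omega>.
           (case z of (x, y) \<Rightarrow>
              ennreal (\<bar>u x - u y\<bar> powr p / norm (x - y) powr (real DIM('a) + s * p)
                       + a x y * (\<bar>u x - u y\<bar> powr q / norm (x - y) powr (real DIM('a) + t * q))))
         \<partial>lebesgue) < \<infinity>}"

definition minimizer ::
  "real \<Rightarrow> real \<Rightarrow> real \<Rightarrow> real \<Rightarrow> ('a::euclidean_space \<Rightarrow> 'a \<Rightarrow> real) \<Rightarrow> ('a \<Rightarrow> 'a \<Rightarrow> real)
     \<Rightarrow> ('a \<Rightarrow> 'a \<Rightarrow> real) \<Rightarrow> 'a set \<Rightarrow> ('a \<Rightarrow> real) \<Rightarrow> bool" where
  "minimizer s t p q Ksp Ktq a \<Omega> u \<longleftrightarrow>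
     u \<in> admissible s t p q a \<Omega> \<and>
     (\<forall>v \<in> admissible s t p q a \<Omega>.
        (AE x in lebesgue. x \<notin> \<Omega> \<longrightarrow> v x = u x) \<longrightarrow>
        energy p q Ksp Ktq a \<Omega> u \<le> energy p q Ksp Ktq a \<Omega> v)"

definition tail_space :: "real \<Rightarrow> real \<Rightarrow> ('a::euclidean_space \<Rightarrow> real) set" where
  "tail_space s p =
     {u \<in> borel_measurable lebesgue.
        (\<integral>\<^sup>+ x. ennreal (\<bar>u x\<bar> powr (p - 1) / (1 + norm x) powr (real DIM('a) + s * p)) \<partial>lebesgue) < \<infinity>}"

definition weighted_tail_space ::
  "real \<Rightarrow> real \<Rightarrow> ('a::euclidean_space \<Rightarrow> 'a \<Rightarrow> real) \<Rightarrow> 'a set \<Rightarrow> ('a \<Rightarrow> real) set" where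
  "weighted_tail_space t q a \<Omega> =
     {u \<in> borel_measurable lebesgue.
        (SUP x\<in>\<Omega>. \<integral>\<^sup>+ y. ennreal (a x y * (\<bar>u y\<bar> powr (q - 1) / (1 + norm y) powr (real DIM('a) + t * q)))
                       \<partial>lebesgue) < \<infinity>}"

definition locally_bounded_in :: "'a::euclidean_space set \<Rightarrow> ('a \<Rightarrow> real) \<Rightarrow> bool" where
  "locally_bounded_in \<Omega> u \<longleftrightarrow>
     (\<forall>S. compact S \<and> S \<subseteq> \<Omega> \<longrightarrow> (\<exists>C. AE x in lebesgue. x \<in> S \<longrightarrow> \<bar>u x\<bar> \<le> C))"

definition essinf_on :: "'a::euclidean_space set \<Rightarrow> ('a \<Rightarrow> real) \<Rightarrow> ereal" where
  "essinf_on D u = - esssup (lebesgue_on D) (\<lambda>x. - ereal (u x))"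

definition Linf_norm :: "'a::euclidean_space set \<Rightarrow> ('a \<Rightarrow> real) \<Rightarrow> ennreal" where
  "Linf_norm D u = esssup (lebesgue_on D) (\<lambda>x. ennreal \<bar>u x\<bar>)"

definition gagliardo_seminorm ::
  "real \<Rightarrow> real \<Rightarrow> 'a::euclidean_space set \<Rightarrow> ('a \<Rightarrow> real) \<Rightarrow> ennreal" where
  "gagliardo_seminorm s p D u =
     (let I = (\<integral>\<^sup>+ z \<in> D \<times> D.
                 (case z of (x, y) \<Rightarrow>
                    ennreal (\<bar>u x - u y\<bar> powr p / norm (x - y) powr (real DIM('a) + s * p)))
               \<partial>lebesgue)
      in if I = \<infinity> then \<infinity> else ennreal (enn2real I powr (1 / p)))"

text \<open>The entry of \<open>data(D)\<close> that depends on \<open>u\<close>.\<close>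

definition data_norm ::
  "real \<Rightarrow> real \<Rightarrow> 'a::euclidean_space set \<Rightarrow> ('a \<Rightarrow> real) \<Rightarrow> ennreal" where
  "data_norm s p D u =
     (if s * p \<le> real DIM('a) then Linf_norm D u else gagliardo_seminorm s p D u)"

definition a_inf :: "('a::euclidean_space \<Rightarrow> 'a \<Rightarrow> real) \<Rightarrow> 'a \<Rightarrow> real \<Rightarrow> real" where
  "a_inf a x0 r = (INF (x, y) \<in> ball x0 r \<times> ball x0 r. a x y)"

definition h_fun ::
  "real \<Rightarrow> real \<Rightarrow> real \<Rightarrow> real \<Rightarrow> ('a::euclidean_space \<Rightarrow> 'a \<Rightarrow> real) \<Rightarrow> 'a \<Rightarrow> real \<Rightarrow> real \<Rightarrow> real" where
  "h_fun s t p q a x0 r k =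
     k powr (p - 1) / r powr (s * p) + a_inf a x0 r * (k powr (q - 1) / r powr (t * q))"

text \<open>For \<open>1 < p\<close>, \<open>1 < q\<close>, \<open>0 \<le> a\<close> and \<open>0 < r\<close>, \<open>h_fun\<close> is an increasing bijection of \<open>{0..}\<close>.\<close>

definition h_inv ::
  "real \<Rightarrow> real \<Rightarrow> real \<Rightarrow> real \<Rightarrow> ('a::euclidean_space \<Rightarrow> 'a \<Rightarrow> real) \<Rightarrow> 'a \<Rightarrow> real \<Rightarrow> real \<Rightarrow> real" where
  "h_inv s t p q a x0 r = inv_into {0..} (h_fun s t p q a x0 r)"

definition neg_part :: "('a \<Rightarrow> real) \<Rightarrow> 'a \<Rightarrow> real" where
  "neg_part u x = max (- u x) 0"

text \<open>The tails of \<open>u \<in> tail_space s p \<inter> weighted_tail_space t q a \<Omega>\<close> outside a ball contained in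
  \<open>\<Omega>\<close> are finite (use the symmetry of \<open>a\<close>), so applying \<open>enn2real\<close> to them loses nothing.\<close>

definition Tail :: "real \<Rightarrow> real \<Rightarrow> ('a::euclidean_space \<Rightarrow> real) \<Rightarrow> 'a \<Rightarrow> real \<Rightarrow> ennreal" where
  "Tail s p v x0 r =
     (\<integral>\<^sup>+ x \<in> UNIV - ball x0 r.
        ennreal (v x powr (p - 1) / norm (x - x0) powr (real DIM('a) + s * p)) \<partial>lebesgue)"

definition Tail_a ::
  "real \<Rightarrow> real \<Rightarrow> ('a::euclidean_space \<Rightarrow> 'a \<Rightarrow> real) \<Rightarrow> ('a \<Rightarrow> real) \<Rightarrow> 'a \<Rightarrow> real \<Rightarrow> ennreal" where
  "Tail_a t q a v x0 r =
     (SUP y \<in> ball x0 r. \<integral>\<^sup>+ x \<in> UNIV - ball x0 r.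
        ennreal (a x y * (v x powr (q - 1) / norm (x - x0) powr (real DIM('a) + t * q))) \<partial>lebesgue)"

definition average :: "'a::euclidean_space set \<Rightarrow> ('a \<Rightarrow> real) \<Rightarrow> real" where
  "average B v = (1 / measure lebesgue B) * (LINT x:B|lebesgue. v x)"

end

theory Submission
  imports Defs
begin

text \<open>The long-range interaction alone forces a nonnegative minimizer to be large everywhere in a ball
  once it is large on average, so neither a Sobolev inequality nor a covering argument is involved.

  Let \<open>\<phi> = k \<eta>\<close> with a Lipschitz cutoff \<open>\<eta>\<close> and compare the minimizer \<open>u\<close> with \<open>v = max u \<phi>\<close>, formed
  in the ball of radius \<open>4 R\<close>.  If \<open>u x < \<phi> x = k \<le> u y\<close>, then raising \<open>u x\<close> to \<open>k\<close> shortens the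
  difference \<open>u y - u x\<close>, and \<open>b powr r - (b - d) powr r \<ge> d * b powr (r - 1)\<close> measures what is gained.
  In all other cases the energy density grows at most by that of \<open>\<phi>\<close>, plus a term with the negative
  part of \<open>u\<close> far away, which is the tail.  Minimality turns this into gain \<open>\<le>\<close> loss
  (\<open>comparison_gain_le_loss\<close>).  Hoelder continuity of \<open>a\<close> and the relations
  \<open>\<alpha> < t * q \<le> s * p + \<alpha>\<close> allow \<open>a\<close> to be replaced by its infimum over the ball at the price of a
  \<open>p\<close>-term, as long as \<open>k\<close> stays below a fixed bound.  The result is \<open>sublevel_estimate\<close>: up to
  a constant, the gain at level \<open>k\<close> is at most \<open>k * h k\<close> times the measure of \<open>{u < k}\<close> in a
  slightly larger ball, provided that the tails do not exceed \<open>h k\<close>.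

  The gain is used twice.  First, integrated only over the points \<open>y\<close> with \<open>u y \<ge> k\<close> and with the
  kernels bounded below by powers of \<open>R\<close>, it dominates \<open>k\<close> times the \<open>(p - 1)\<close>- and \<open>(q - 1)\<close>-means
  of \<open>u\<close> times \<open>\<bar>{u < k / 2}\<bar>\<close>; if \<open>k\<close> is a small multiple of both means, \<open>\<bar>{u < k / 2}\<bar>\<close> is a
  small fraction of the ball (\<open>initial_smallness\<close>).  Second, if \<open>{u < k}\<close> has less than half the
  measure of a ball of radius \<open>d\<close>, then every point of a smaller ball sees, within distance \<open>d\<close>, many points with
  \<open>u \<ge> k\<close>, where the singular kernel contributes at least a multiple of \<open>d powr - (s * p)\<close>.  This yields
  the superlinear decay of the measures of sublevel sets (\<open>sublevel_step\<close>) that drives a De Giorgi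
  iteration (\<open>degiorgi_iteration\<close>) and shows that \<open>u \<ge> k / 4\<close> almost everywhere in the small ball.

  The levels must be bounded by the data.  If \<open>s * p \<le> n\<close>, the means are at most the supremum of
  \<open>u\<close>.  If \<open>s * p > n\<close>, the same iteration, applied to the Gagliardo energy in place of the gain,
  shows that \<open>u\<close> is bounded below by a multiple of its mean as soon as the mean is large compared
  with the seminorm (\<open>lower_bound_of_gagliardo\<close>); otherwise the mean is bounded by the seminorm.\<close>


section \<open>The model kernel\<close>

text \<open>The value on the diagonal is 0, so that kernel estimates multiplied by differences hold for all pairs.\<close>

definition riesz :: "real \<Rightarrow> 'a::euclidean_space \<Rightarrow> 'a \<Rightarrow> real" where
  "riesz \<beta> x y = 1 / norm (x - y) powr (real DIM('a) + \<beta>)"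

lemma riesz_nonneg [simp]: "0 \<le> riesz \<beta> x y"
  by (simp add: riesz_def)

lemma riesz_commute: "riesz \<beta> x y = riesz \<beta> y x"
  by (simp add: riesz_def norm_minus_commute)

lemma riesz_diag [simp]: "riesz \<beta> x x = 0"
  by (simp add: riesz_def)

lemma borel_measurable_riesz [measurable (raw)]:
  assumes "f \<in> borel_measurable M" "g \<in> borel_measurable M"
  shows "(\<lambda>z. riesz \<beta> (f z) (g z)) \<in> borel_measurable M"
  using assms unfolding riesz_def by measurable

lemma riesz_le:
  fixes x y :: "'a::euclidean_space"
  assumes "0 < d" "d \<le> norm (x - y)" "0 \<le> \<beta>"
  shows "riesz \<beta> x y \<le> 1 / d powr (real DIM('a) + \<beta>)"
  unfolding riesz_def using assms by (intro divide_left_mono powr_mono2 mult_pos_pos) auto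

lemma riesz_ge:
  fixes x y :: "'a::euclidean_space"
  assumes "x \<noteq> y" "norm (x - y) \<le> d" "0 \<le> \<beta>"
  shows "1 / d powr (real DIM('a) + \<beta>) \<le> riesz \<beta> x y"
proof -
  have "0 < norm (x - y)" using assms by simp
  then show ?thesis
    unfolding riesz_def using assms
    by (intro divide_left_mono powr_mono2 mult_pos_pos) (auto intro: order_less_le_trans)
qed

abbreviation ball_vol :: "'a::euclidean_space itself \<Rightarrow> real" where
  "ball_vol T \<equiv> unit_ball_vol (real DIM('a))"

lemma emeasure_lborel_ball_powr:
  fixes x :: "'a::euclidean_space"
  assumes "0 < r"
  shows "emeasure lborel (ball x r) = ennreal (ball_vol TYPE('a) * r powr real DIM('a))"
  using emeasure_ball[of r x] assms by (simp add: powr_realpow)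

lemma suminf_ennreal_geometric:
  fixes c b :: real
  assumes "0 \<le> c" "0 \<le> b" "b < 1"
  shows "(\<Sum>i. ennreal (c * b ^ i)) = ennreal (c / (1 - b))"
proof -
  have s: "(\<lambda>i. c * b ^ i) sums (c * (1 / (1 - b)))"
    using assms by (intro sums_mult geometric_sums) auto
  show ?thesis
    by (subst suminf_ennreal_eq[OF _ s]) (use assms in auto)
qed

lemma term_le_suminf_ennreal: "f i \<le> (\<Sum>i. f i)" for f :: "nat \<Rightarrow> ennreal"
  using sum_le_suminf[of f "{i}"] by simp

text \<open>Summation over dyadic shells around \<open>x\<close>.  Outside radius \<open>R\<close> the decay rate \<open>\<sigma>\<close> is positive and
  inside the truncation supplies \<open>r > \<sigma>\<close> powers of the distance, so both series are geometric.\<close>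

lemma truncated_riesz_integral:
  fixes \<sigma> r :: real
  assumes "0 < \<sigma>" "\<sigma> < r"
  shows "\<exists>C>0. \<forall>R>0. \<forall>x::'a::euclidean_space.
     (\<integral>\<^sup>+y. ennreal (min 1 (norm (x - y) / R) powr r * riesz \<sigma> x y) \<partial>lborel) \<le> ennreal (C / R powr \<sigma>)"
proof -
  define N V where "N = real DIM('a)" and "V = ball_vol TYPE('a)"
  have N: "0 < N" and V: "0 < V" by (auto simp: N_def V_def)
  define b1 b2 where "b1 = 2 powr (-\<sigma>)" and "b2 = 2 powr (\<sigma> - r)"
  have b: "0 < b1" "b1 < 1" "0 < b2" "b2 < 1"
    using assms powr_less_mono[of "-\<sigma>" 0 2] powr_less_mono[of "\<sigma>-r" 0 2] by (auto simp: b1_def b2_def)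
  define C where "C = V * 2 powr N / (1 - b1) + V * (2 powr N * 2 powr (N + \<sigma>)) / (1 - b2)"
  have C: "0 < C" using b V by (auto simp: C_def intro!: add_pos_pos divide_pos_pos mult_pos_pos)
  show ?thesis
  proof (intro exI[of _ C] conjI C allI impI)
    fix R :: real and x :: 'a
    assume R: "0 < R"
    \<comment> \<open>\<open>c i\<close> and \<open>d i\<close> bound the integrand on the shells at distance about \<open>R * 2 ^ i\<close> and
      \<open>R / 2 ^ i\<close>; the balls for the inner shells have twice the radius, to contain the outer boundary.\<close>
    define c d where "c i = 1 / (R * 2 ^ i) powr (N + \<sigma>)"
      and "d i = (1 / 2 ^ i) powr r / (R / 2 ^ Suc i) powr (N + \<sigma>)" for i :: nat
    have pt: "ennreal (min 1 (norm (x - y) / R) powr r * riesz \<sigma> x y)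
        \<le> (\<Sum>i. ennreal (c i) * indicator (ball x (R * 2 ^ Suc i)) y)
          + (\<Sum>i. ennreal (d i) * indicator (ball x (2 * R / 2 ^ i)) y)" for y
    proof (cases "y = x")
      case False
      define \<rho> where "\<rho> = norm (x - y) / R"
      have \<rho>: "0 < \<rho>" "norm (x - y) = R * \<rho>" using False R by (auto simp: \<rho>_def)
      show ?thesis
      proof (cases "1 \<le> \<rho>")
        case True
        define i where "i = nat \<lfloor>log 2 \<rho>\<rfloor>"
        have l: "0 \<le> log 2 \<rho>" using True by simp
        have i: "real i \<le> log 2 \<rho>" "log 2 \<rho> < real i + 1" unfolding i_def using l by linarith+
        have lo: "2 ^ i \<le> \<rho>" using i(1) \<rho> by (simp add: le_log_iff powr_realpow)
        have hi: "\<rho> < 2 ^ Suc i" using i(2) \<rho> by (simp add: log_less_iff powr_add powr_realpow mult.commute)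
        have "min 1 \<rho> powr r * riesz \<sigma> x y \<le> 1 * c i"
        proof (intro mult_mono)
          show "riesz \<sigma> x y \<le> c i"
            unfolding c_def N_def using R lo \<rho> assms by (intro riesz_le) auto
        qed (use True in \<open>auto simp: min_def\<close>)
        moreover have "y \<in> ball x (R * 2 ^ Suc i)"
          using hi R \<rho> by (simp add: dist_norm)
        ultimately have "ennreal (min 1 \<rho> powr r * riesz \<sigma> x y) \<le> ennreal (c i) * indicator (ball x (R * 2 ^ Suc i)) y"
          by (simp add: ennreal_leI)
        also have "\<dots> \<le> (\<Sum>i. ennreal (c i) * indicator (ball x (R * 2 ^ Suc i)) y)"
          by (rule term_le_suminf_ennreal)
        finally show ?thesis unfolding \<rho>_def by (simp add: add_increasing2)
      next
        case False
        define i where "i = nat \<lfloor>- log 2 \<rho>\<rfloor>"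
        have l: "0 < - log 2 \<rho>" using False \<rho> by simp
        have i: "real i \<le> - log 2 \<rho>" "- log 2 \<rho> < real i + 1" unfolding i_def using l by linarith+
        have hi: "\<rho> \<le> 1 / 2 ^ i"
        proof -
          have "log 2 \<rho> \<le> - real i" using i by linarith
          then have "\<rho> \<le> 2 powr (- real i)" using \<rho> by (simp add: log_le_iff)
          then show ?thesis by (simp add: powr_minus powr_realpow inverse_eq_divide)
        qed
        have lo: "1 / 2 ^ Suc i \<le> \<rho>"
        proof -
          have "- (real i + 1) \<le> log 2 \<rho>" using i by linarith
          then have "2 powr (- (real i + 1)) \<le> \<rho>" using \<rho> by (simp add: le_log_iff)
          moreover have "2 powr (- (real i + 1)) = 1 / 2 ^ Suc i"
            by (simp add: powr_diff powr_minus powr_realpow field_simps)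
          ultimately show ?thesis by simp
        qed
        have "min 1 \<rho> powr r * riesz \<sigma> x y \<le> d i"
          unfolding d_def divide_inverse[of "(1 / 2 ^ i) powr r"]
        proof (intro mult_mono)
          show "min 1 \<rho> powr r \<le> (1 / 2 ^ i) powr r"
            using hi \<rho> False assms by (intro powr_mono2) (auto simp: min_def)
          have "riesz \<sigma> x y \<le> 1 / (R / 2 ^ Suc i) powr (N + \<sigma>)"
            unfolding N_def using R lo \<rho> assms
            by (intro riesz_le) (auto simp: field_simps)
          then show "riesz \<sigma> x y \<le> inverse ((R / 2 ^ Suc i) powr (N + \<sigma>))"
            by (simp add: inverse_eq_divide)
        qed auto
        moreover have "y \<in> ball x (2 * R / 2 ^ i)"
        proof -
          have "R * \<rho> \<le> R * (1 / 2 ^ i)" using hi R by (intro mult_left_mono) auto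
          also have "\<dots> < 2 * R / 2 ^ i" using R by (simp add: field_simps)
          finally show ?thesis using \<rho> by (simp add: dist_norm)
        qed
        ultimately have "ennreal (min 1 \<rho> powr r * riesz \<sigma> x y) \<le> ennreal (d i) * indicator (ball x (2 * R / 2 ^ i)) y"
          by (simp add: ennreal_leI)
        also have "\<dots> \<le> (\<Sum>i. ennreal (d i) * indicator (ball x (2 * R / 2 ^ i)) y)"
          by (rule term_le_suminf_ennreal)
        finally show ?thesis unfolding \<rho>_def by (simp add: add_increasing)
      qed
    qed simp
    have m [measurable]: "(\<lambda>y. ennreal e * indicator (ball x \<rho>) y) \<in> borel_measurable borel" for e \<rho>
      by (intro borel_measurable_times_ennreal borel_measurable_indicator) auto
    have i1: "ennreal (c i) * emeasure lborel (ball x (R * 2 ^ Suc i)) = ennreal (V * 2 powr N / R powr \<sigma> * b1 ^ i)" for i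
    proof -
      have "c i * (V * (R * 2 ^ Suc i) powr N) = V * 2 powr N / R powr \<sigma> * b1 ^ i"
        using R unfolding c_def b1_def
        by (simp add: powr_mult powr_add powr_minus powr_realpow[symmetric] powr_powr powr_power field_simps)
      then show ?thesis
        using R V by (subst emeasure_lborel_ball_powr) (auto simp: N_def V_def c_def simp flip: ennreal_mult)
    qed
    have i2: "ennreal (d i) * emeasure lborel (ball x (2 * R / 2 ^ i)) = ennreal (V * (2 powr N * 2 powr (N + \<sigma>)) / R powr \<sigma> * b2 ^ i)" for i
    proof -
      have "d i * (V * (2 * R / 2 ^ i) powr N) = V * (2 powr N * 2 powr (N + \<sigma>)) / R powr \<sigma> * b2 ^ i"
        using R unfolding d_def b2_def
        by (simp add: powr_mult powr_divide powr_add powr_diff powr_minus powr_realpow[symmetric] powr_powr powr_power field_simps)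
      then show ?thesis
        using R V by (subst emeasure_lborel_ball_powr) (auto simp: N_def V_def d_def simp flip: ennreal_mult)
    qed
    have "(\<integral>\<^sup>+y. ennreal (min 1 (norm (x - y) / R) powr r * riesz \<sigma> x y) \<partial>lborel)
        \<le> (\<integral>\<^sup>+y. (\<Sum>i. ennreal (c i) * indicator (ball x (R * 2 ^ Suc i)) y)
          + (\<Sum>i. ennreal (d i) * indicator (ball x (2 * R / 2 ^ i)) y) \<partial>lborel)"
      by (intro nn_integral_mono pt)
    also have "\<dots> = (\<Sum>i. ennreal (c i) * emeasure lborel (ball x (R * 2 ^ Suc i)))
          + (\<Sum>i. ennreal (d i) * emeasure lborel (ball x (2 * R / 2 ^ i)))"
      by (subst nn_integral_add, measurable) (simp add: nn_integral_suminf nn_integral_cmult_indicator)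
    also have "\<dots> = ennreal (V * 2 powr N / R powr \<sigma> / (1 - b1)) + ennreal (V * (2 powr N * 2 powr (N + \<sigma>)) / R powr \<sigma> / (1 - b2))"
      unfolding i1 i2 using b V R by (subst (1 2) suminf_ennreal_geometric) auto
    also have "\<dots> = ennreal (C / R powr \<sigma>)"
      using b V R
      by (subst ennreal_plus[symmetric]) (auto simp: C_def add_divide_distrib mult.commute)
    finally show "(\<integral>\<^sup>+y. ennreal (min 1 (norm (x - y) / R) powr r * riesz \<sigma> x y) \<partial>lborel) \<le> ennreal (C / R powr \<sigma>)" .
  qed
qed

section \<open>Lebesgue measure on the product\<close>

lemma AE_lebesgue_pair:
  fixes P :: "'a::euclidean_space \<Rightarrow> bool"
  assumes "AE x in lebesgue. P x"
  shows "AE z in (lebesgue :: ('a \<times> 'a) measure). P (fst z) \<and> P (snd z)"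
proof -
  have P: "AE x in lborel. P x" using assms by (simp add: AE_completion_iff)
  then obtain S where S: "S \<in> null_sets lborel" "{x. \<not> P x} \<subseteq> S"
    by (auto elim!: AE_E simp: null_sets_def)
  have "S \<times> UNIV \<in> null_sets (lborel \<Otimes>\<^sub>M lborel :: ('a \<times> 'a) measure)"
    using S lborel.times_in_null_sets1[of S lborel "UNIV :: 'a set"] by simp
  moreover have "UNIV \<times> S \<in> null_sets (lborel \<Otimes>\<^sub>M lborel :: ('a \<times> 'a) measure)"
    using S lborel.times_in_null_sets2[of "UNIV :: 'a set" lborel S] by simp
  ultimately have "S \<times> UNIV \<union> UNIV \<times> S \<in> null_sets (lborel :: ('a \<times> 'a) measure)"
    by (auto simp: lborel_prod)
  then have "AE z in (lborel :: ('a \<times> 'a) measure). P (fst z) \<and> P (snd z)"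
    using S(2) by (intro AE_I') auto
  then show ?thesis by (simp add: AE_completion_iff)
qed

text \<open>On Borel functions the completed product measure satisfies Tonelli's theorem for the factors.\<close>

lemma nn_integral_lebesgue_pair:
  fixes f :: "'a::euclidean_space \<times> 'a \<Rightarrow> ennreal"
  assumes [measurable]: "f \<in> borel_measurable borel"
  shows "(\<integral>\<^sup>+z. f z \<partial>lebesgue) = (\<integral>\<^sup>+x. \<integral>\<^sup>+y. f (x, y) \<partial>lborel \<partial>lborel)"
    "(\<integral>\<^sup>+z. f z \<partial>lebesgue) = (\<integral>\<^sup>+y. \<integral>\<^sup>+x. f (x, y) \<partial>lborel \<partial>lborel)"
proof -
  have f: "f \<in> borel_measurable (lborel \<Otimes>\<^sub>M lborel)"
    using assms by (simp add: lborel_prod)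
  have "(\<integral>\<^sup>+z. f z \<partial>lebesgue) = (\<integral>\<^sup>+z. f z \<partial>(lborel \<Otimes>\<^sub>M lborel))"
    by (simp add: nn_integral_completion lborel_prod)
  then show "(\<integral>\<^sup>+z. f z \<partial>lebesgue) = (\<integral>\<^sup>+x. \<integral>\<^sup>+y. f (x, y) \<partial>lborel \<partial>lborel)"
    "(\<integral>\<^sup>+z. f z \<partial>lebesgue) = (\<integral>\<^sup>+y. \<integral>\<^sup>+x. f (x, y) \<partial>lborel \<partial>lborel)"
    using lborel.nn_integral_fst[OF f] lborel_pair.nn_integral_snd[OF f] by simp_all
qed

section \<open>Pointwise comparison with a barrier\<close>

text \<open>Factor out one power: \<open>(b - k) powr r \<le> (b - k) * (b - a) powr (r - 1)\<close>.\<close>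

lemma powr_gain:
  fixes a k b r :: real
  assumes "1 < r" "a < k" "k \<le> b"
  shows "\<bar>k - b\<bar> powr r + (k - a) * (b - a) powr (r - 1) \<le> \<bar>a - b\<bar> powr r"
proof -
  have split: "z powr r = z * z powr (r - 1)" if "0 \<le> z" for z :: real
    using that assms by (cases "z = 0") (auto simp: powr_mult_base)
  have "\<bar>k - b\<bar> powr r = (b - k) * (b - k) powr (r - 1)"
    using split[of "b - k"] assms by (simp add: abs_minus_commute)
  also have "\<dots> \<le> (b - k) * (b - a) powr (r - 1)"
    using assms by (intro mult_left_mono powr_mono2) auto
  also have "\<dots> + (k - a) * (b - a) powr (r - 1) = (b - a) * (b - a) powr (r - 1)"
    by (simp add: algebra_simps)
  also have "\<dots> = \<bar>a - b\<bar> powr r"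
    using split[of "b - a"] assms by (simp add: abs_minus_commute)
  finally show ?thesis by simp
qed

lemma powr_abs_max_diff_le:
  fixes a b f g r :: real
  assumes "0 \<le> r"
  shows "\<bar>max a f - max b g\<bar> powr r \<le> \<bar>a - b\<bar> powr r + \<bar>f - g\<bar> powr r"
proof -
  have "\<bar>max a f - max b g\<bar> \<le> \<bar>a - b\<bar> \<or> \<bar>max a f - max b g\<bar> \<le> \<bar>f - g\<bar>"
    by linarith
  then have "\<bar>max a f - max b g\<bar> powr r \<le> \<bar>a - b\<bar> powr r \<or> \<bar>max a f - max b g\<bar> powr r \<le> \<bar>f - g\<bar> powr r"
    using assms by (auto intro: powr_mono2)
  then show ?thesis by (auto intro: add_increasing add_increasing2)
qed

lemma powr_add_le:
  fixes a b e :: real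
  assumes "0 \<le> a" "0 \<le> b" "0 \<le> e"
  shows "(a + b) powr e \<le> 2 powr e * (a powr e + b powr e)"
proof -
  have "(a + b) powr e \<le> (2 * max a b) powr e"
    using assms by (intro powr_mono2) auto
  also have "\<dots> = 2 powr e * max a b powr e"
    using assms by (subst powr_mult) auto
  also have "\<dots> \<le> 2 powr e * (a powr e + b powr e)"
    by (intro mult_left_mono) (auto simp: max_def)
  finally show ?thesis .
qed

text \<open>This covers a point \<open>y\<close> far away where \<open>b = u y\<close> is negative: raising \<open>a\<close> to \<open>f\<close> lengthens the
  difference, and by the mean value theorem the increase is of first order in \<open>f \<le> k\<close>, with the factor
  \<open>(k - b) powr (r - 1)\<close> that the tail is made of.\<close>

lemma powr_tail_loss:
  fixes a b f k r :: real
  assumes "1 < r" "0 \<le> a" "a \<le> f" "f \<le> k" "b < 0"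
  shows "\<bar>f - b\<bar> powr r \<le> \<bar>a - b\<bar> powr r + r * 2 powr r * (k * (k powr (r - 1) + (- b) powr (r - 1)))"
proof -
  have "\<exists>z. - b \<le> z \<and> z \<le> f - b \<and> (f - b) powr r - (- b) powr r \<le> f * (r * z powr (r - 1))"
  proof (cases "f = 0")
    case False
    with assms have "0 < f" by simp
    have "\<exists>z. - b < z \<and> z < f - b \<and> (f - b) powr r - (- b) powr r = (f - b - (- b)) * (r * z powr (r - 1))"
      using \<open>0 < f\<close> assms
      by (intro MVT2[where f = "\<lambda>z. z powr r"]) (auto intro!: derivative_eq_intros)
    then obtain z where "- b < z" "z < f - b" "(f - b) powr r - (- b) powr r = (f - b - (- b)) * (r * z powr (r - 1))"
      by blast
    then show ?thesis by (intro exI[of _ z]) simp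
  next
    case True
    then show ?thesis by (intro exI[of _ "- b"]) (use assms in auto)
  qed
  then obtain z where z: "- b \<le> z" "z \<le> f - b" "(f - b) powr r - (- b) powr r \<le> f * (r * z powr (r - 1))"
    by blast
  have "f * (r * z powr (r - 1)) \<le> k * (r * (k + - b) powr (r - 1))"
    using z assms by (intro mult_mono powr_mono2) auto
  also have "\<dots> \<le> k * (r * (2 powr (r - 1) * (k powr (r - 1) + (- b) powr (r - 1))))"
    using assms by (intro mult_left_mono powr_add_le) auto
  also have "\<dots> \<le> k * (r * (2 powr r * (k powr (r - 1) + (- b) powr (r - 1))))"
    using assms by (intro mult_left_mono mult_right_mono powr_mono) auto
  finally have "(f - b) powr r \<le> (- b) powr r + r * 2 powr r * (k * (k powr (r - 1) + (- b) powr (r - 1)))"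
    using z by (simp add: mult_ac)
  moreover have "(- b) powr r \<le> (a - b) powr r"
    using assms by (intro powr_mono2) auto
  moreover have "\<bar>f - b\<bar> = f - b" "\<bar>a - b\<bar> = a - b" using assms by auto
  ultimately show ?thesis by simp
qed

text \<open>In the following definitions \<open>B\<close> is the ball where the minimizer \<open>w\<close> is nonnegative, and the barrier
  \<open>\<phi>\<close> with \<open>0 \<le> \<phi> \<le> k\<close> vanishes outside \<open>B\<close>.  Gain and loss are recorded for ordered pairs: the gain at
  points \<open>x\<close> that are lifted to the top level \<open>k\<close>, the loss at all points \<open>x\<close> that are lifted.\<close>

definition competitor :: "'a set \<Rightarrow> ('a \<Rightarrow> real) \<Rightarrow> ('a \<Rightarrow> real) \<Rightarrow> 'a \<Rightarrow> real" where
  "competitor B \<phi> w x = (if x \<in> B then max (w x) (\<phi> x) else w x)"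

definition barrier_gain ::
  "real \<Rightarrow> 'a set \<Rightarrow> ('a \<Rightarrow> real) \<Rightarrow> real \<Rightarrow> ('a \<Rightarrow> real) \<Rightarrow> 'a \<Rightarrow> 'a \<Rightarrow> real" where
  "barrier_gain r B \<phi> k w x y =
     (if x \<in> B \<and> y \<in> B \<and> \<phi> x = k \<and> w x < k \<and> k \<le> w y then (k - w x) * (w y - w x) powr (r - 1) else 0)"

definition barrier_loss ::
  "real \<Rightarrow> 'a set \<Rightarrow> ('a \<Rightarrow> real) \<Rightarrow> real \<Rightarrow> ('a \<Rightarrow> real) \<Rightarrow> 'a \<Rightarrow> 'a \<Rightarrow> real" where
  "barrier_loss r B \<phi> k w x y =
     (if x \<in> B \<and> w x < \<phi> x then
        \<bar>\<phi> x - \<phi> y\<bar> powr r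
        + (if y \<in> B then 0 else r * 2 powr r * (k * (k powr (r - 1) + neg_part w y powr (r - 1))))
      else 0)"

lemma barrier_gain_nonneg: "0 \<le> barrier_gain r B \<phi> k w x y"
  by (simp add: barrier_gain_def)

lemma barrier_loss_nonneg: "0 \<le> r \<Longrightarrow> 0 \<le> k \<Longrightarrow> 0 \<le> barrier_loss r B \<phi> k w x y"
  by (simp add: barrier_loss_def)

text \<open>The gain is present only when \<open>y\<close> lies above the top of the barrier, and then nothing is lost.  Otherwise
  a maximum is taken on both sides and the difference of the maxima is bounded by one of the two
  differences; outside \<open>B\<close> the function \<open>w\<close> counts as a maximum with \<open>\<phi> = 0\<close> unless it is negative, and
  then the tail term pays.\<close>

lemma competitor_inequality:
  fixes w \<phi> :: "'a \<Rightarrow> real"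
  assumes r: "1 < r" and w: "\<And>x. x \<in> B \<Longrightarrow> 0 \<le> w x"
    and \<phi>: "\<And>x. 0 \<le> \<phi> x" "\<And>x. \<phi> x \<le> k" "\<And>x. x \<notin> B \<Longrightarrow> \<phi> x = 0"
  shows "\<bar>competitor B \<phi> w x - competitor B \<phi> w y\<bar> powr r + barrier_gain r B \<phi> k w x y
      \<le> \<bar>w x - w y\<bar> powr r + (barrier_loss r B \<phi> k w x y + barrier_loss r B \<phi> k w y x)"
proof -
  have k: "0 \<le> k" using \<phi>(1,2)[of x] by linarith
  note nn = barrier_loss_nonneg[of r k B \<phi> w, OF _ k]
  have one: "\<bar>competitor B \<phi> w x - competitor B \<phi> w y\<bar> powr r
      \<le> \<bar>w x - w y\<bar> powr r + barrier_loss r B \<phi> k w x y" if xy: "x \<in> B" "y \<notin> B" for x y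
  proof (cases "w x < \<phi> x")
    case False
    then show ?thesis using xy nn r by (simp add: competitor_def max_absorb1)
  next
    case True
    have \<phi>y: "\<phi> y = 0" using \<phi>(3) xy by blast
    show ?thesis
    proof (cases "0 \<le> w y")
      case True
      have "\<bar>competitor B \<phi> w x - competitor B \<phi> w y\<bar> powr r = \<bar>max (w x) (\<phi> x) - max (w y) (\<phi> y)\<bar> powr r"
        using xy True \<phi>y by (simp add: competitor_def)
      also have "\<dots> \<le> \<bar>w x - w y\<bar> powr r + \<bar>\<phi> x - \<phi> y\<bar> powr r"
        using r by (intro powr_abs_max_diff_le) auto
      also have "\<dots> \<le> \<bar>w x - w y\<bar> powr r + barrier_loss r B \<phi> k w x y"
        using xy \<open>w x < \<phi> x\<close> r k by (simp add: barrier_loss_def)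
      finally show ?thesis .
    next
      case False
      have "\<bar>\<phi> x - w y\<bar> powr r \<le> \<bar>w x - w y\<bar> powr r + r * 2 powr r * (k * (k powr (r - 1) + (- w y) powr (r - 1)))"
        using r w xy \<phi> True False by (intro powr_tail_loss) auto
      then show ?thesis
        using xy True False
        by (simp add: competitor_def barrier_loss_def neg_part_def) (smt (verit) powr_ge_zero)
    qed
  qed
  show ?thesis
  proof (cases "x \<in> B \<and> y \<in> B \<and> \<phi> x = k \<and> w x < k \<and> k \<le> w y")
    case True
    then have "\<phi> y \<le> w y" using \<phi>(2)[of y] by linarith
    then have "competitor B \<phi> w x = k" "competitor B \<phi> w y = w y"
      using True by (auto simp: competitor_def)
    moreover have "\<bar>k - w y\<bar> powr r + (k - w x) * (w y - w x) powr (r - 1) \<le> \<bar>w x - w y\<bar> powr r"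
      using True r by (intro powr_gain) auto
    ultimately show ?thesis using True nn[of x y] nn[of y x] r by (simp add: barrier_gain_def)
  next
    case False
    then have g: "barrier_gain r B \<phi> k w x y = 0" by (simp add: barrier_gain_def)
    consider "x \<in> B" "y \<in> B" "w x < \<phi> x \<or> w y < \<phi> y" | "x \<in> B" "y \<in> B" "\<phi> x \<le> w x" "\<phi> y \<le> w y"
      | "x \<in> B" "y \<notin> B" | "x \<notin> B" "y \<in> B" | "x \<notin> B" "y \<notin> B" by fastforce
    then show ?thesis
    proof cases
      case 1
      have "\<bar>\<phi> x - \<phi> y\<bar> powr r \<le> barrier_loss r B \<phi> k w x y + barrier_loss r B \<phi> k w y x"
        using 1 by (auto simp: barrier_loss_def abs_minus_commute)
      with powr_abs_max_diff_le[of r "w x" "\<phi> x" "w y" "\<phi> y"] g 1 r show ?thesis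
        by (simp add: competitor_def)
    next
      case 3
      then show ?thesis using one[of x y] g nn[of y x] r by simp
    next
      case 4
      then show ?thesis using one[of y x] g nn[of x y] r by (simp add: abs_minus_commute)
    qed (use g nn[of x y] nn[of y x] r in \<open>auto simp: competitor_def max_absorb1\<close>)
  qed
qed

lemma competitor_inequality_kernel:
  fixes w \<phi> :: "'a::euclidean_space \<Rightarrow> real"
  assumes r: "1 < r" and w: "\<And>x. x \<in> B \<Longrightarrow> 0 \<le> w x"
    and \<phi>: "\<And>x. 0 \<le> \<phi> x" "\<And>x. \<phi> x \<le> k" "\<And>x. x \<notin> B \<Longrightarrow> \<phi> x = 0"
    and \<Lambda>: "1 \<le> \<Lambda>" and K: "kernel_cond \<Lambda> \<beta> K"
  shows "\<bar>competitor B \<phi> w x - competitor B \<phi> w y\<bar> powr r * K x y + barrier_gain r B \<phi> k w x y * riesz \<beta> x y / \<Lambda>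
      \<le> \<bar>w x - w y\<bar> powr r * K x y
        + \<Lambda> * (barrier_loss r B \<phi> k w x y * riesz \<beta> x y + barrier_loss r B \<phi> k w y x * riesz \<beta> x y)"
proof (cases "x = y")
  case False
  have k: "0 \<le> k" using \<phi>(1,2)[of x] by linarith
  have K': "0 \<le> K x y" "riesz \<beta> x y / \<Lambda> \<le> K x y" "K x y \<le> \<Lambda> * riesz \<beta> x y"
    using K False by (auto simp: kernel_cond_def riesz_def inverse_eq_divide mult.commute)
  let ?g = "barrier_gain r B \<phi> k w x y"
  let ?l = "barrier_loss r B \<phi> k w x y + barrier_loss r B \<phi> k w y x"
  have nn: "0 \<le> ?g" "0 \<le> ?l"
    using k r by (auto intro!: barrier_gain_nonneg barrier_loss_nonneg add_nonneg_nonneg)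
  have "?g * (riesz \<beta> x y / \<Lambda>) \<le> ?g * K x y" "?l * K x y \<le> ?l * (\<Lambda> * riesz \<beta> x y)"
    using nn K' by (intro mult_left_mono; simp)+
  moreover have "(\<bar>competitor B \<phi> w x - competitor B \<phi> w y\<bar> powr r + ?g) * K x y
      \<le> (\<bar>w x - w y\<bar> powr r + ?l) * K x y"
    using K' by (intro mult_right_mono competitor_inequality r w \<phi>) auto
  ultimately show ?thesis by (simp add: algebra_simps)
qed simp

section \<open>Minimality turns gain into loss\<close>

lemma energy_eq_indicator:
  "energy p q K1 K2 a \<Omega> u =
     (\<integral>\<^sup>+ z. ennreal (\<bar>u (fst z) - u (snd z)\<bar> powr p * K1 (fst z) (snd z)
        + a (fst z) (snd z) * \<bar>u (fst z) - u (snd z)\<bar> powr q * K2 (fst z) (snd z)) * indicator (C_region \<Omega>) z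
      \<partial>lebesgue)"
  unfolding energy_def by (simp add: case_prod_beta)

lemma admissible_iff_riesz_energy:
  "u \<in> admissible s t p q a \<Omega> \<longleftrightarrow> u \<in> borel_measurable lebesgue \<and>
     (\<integral>\<^sup>+ x \<in> \<Omega>. ennreal (\<bar>u x\<bar> powr p) \<partial>lebesgue) < \<infinity> \<and>
     energy p q (riesz (s * p)) (riesz (t * q)) a \<Omega> u < \<infinity>"
  by (simp add: admissible_def energy_def riesz_def)

lemma kernel_cond_riesz: "kernel_cond 1 \<beta> (riesz \<beta>)"
proof -
  have "(\<lambda>z. riesz \<beta> (fst z) (snd z)) \<in> borel_measurable (lborel :: ('a \<times> 'a) measure)"
    by (simp add: borel_prod[symmetric])
  then have "(\<lambda>z. riesz \<beta> (fst z) (snd z)) \<in> borel_measurable (lebesgue :: ('a \<times> 'a) measure)"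
    by (rule measurable_completion)
  then show ?thesis
    by (auto simp: kernel_cond_def case_prod_beta) (simp_all add: riesz_def)
qed

lemma holder_coeff_continuous:
  fixes a :: "'a::euclidean_space \<Rightarrow> 'a \<Rightarrow> real"
  assumes "0 < \<alpha>" "holder_coeff \<alpha> A a"
  shows "continuous_on UNIV (\<lambda>z. a (fst z) (snd z))"
  unfolding continuous_on_def
proof
  fix z0 :: "'a \<times> 'a"
  have "((\<lambda>z. A * (norm (fst z - fst z0) + norm (snd z - snd z0)) powr \<alpha>) \<longlongrightarrow>
      A * (norm (fst z0 - fst z0) + norm (snd z0 - snd z0)) powr \<alpha>) (at z0)"
    using assms by (intro tendsto_intros tendsto_powr') auto
  then have "((\<lambda>z. A * (norm (fst z - fst z0) + norm (snd z - snd z0)) powr \<alpha>) \<longlongrightarrow> 0) (at z0)"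
    by simp
  then have "((\<lambda>z. a (fst z) (snd z) - a (fst z0) (snd z0)) \<longlongrightarrow> 0) (at z0)"
    by (rule Lim_null_comparison[rotated]) (use assms in \<open>auto simp: holder_coeff_def\<close>)
  then show "((\<lambda>z. a (fst z) (snd z)) \<longlongrightarrow> a (fst z0) (snd z0)) (at z0 within UNIV)"
    by (simp add: LIM_zero_iff)
qed

lemma holder_coeff_measurable:
  fixes a :: "'a::euclidean_space \<Rightarrow> 'a \<Rightarrow> real"
  assumes "0 < \<alpha>" "holder_coeff \<alpha> A a"
    and [measurable]: "f \<in> borel_measurable M" "g \<in> borel_measurable M"
  shows "(\<lambda>z. a (f z) (g z)) \<in> borel_measurable M"
proof -
  have "(\<lambda>z. a (fst z) (snd z)) \<in> borel_measurable borel"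
    by (intro borel_measurable_continuous_onI holder_coeff_continuous[OF assms(1,2)])
  from measurable_compose[OF borel_measurable_Pair[OF assms(3,4)] this] show ?thesis by simp
qed

lemma barrier_gain_measurable [measurable (raw)]:
  assumes [measurable]: "B \<in> sets borel" "\<phi> \<in> borel_measurable borel" "w \<in> borel_measurable borel"
    "f \<in> borel_measurable M" "g \<in> borel_measurable M"
  shows "(\<lambda>z. barrier_gain r B \<phi> k w (f z) (g z)) \<in> borel_measurable M"
  unfolding barrier_gain_def by measurable

lemma barrier_loss_measurable [measurable (raw)]:
  assumes [measurable]: "B \<in> sets borel" "\<phi> \<in> borel_measurable borel" "w \<in> borel_measurable borel"
    "f \<in> borel_measurable M" "g \<in> borel_measurable M"
  shows "(\<lambda>z. barrier_loss r B \<phi> k w (f z) (g z)) \<in> borel_measurable M"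
  unfolding barrier_loss_def neg_part_def by measurable

lemma competitor_measurable [measurable (raw)]:
  assumes [measurable]: "B \<in> sets borel" "\<phi> \<in> borel_measurable borel" "w \<in> borel_measurable borel"
    "f \<in> borel_measurable M"
  shows "(\<lambda>z. competitor B \<phi> w (f z)) \<in> borel_measurable M"
  unfolding competitor_def by measurable

text \<open>The minimizer is taken Borel measurable and nonnegative at every point of the ball of radius \<open>4 R\<close>; every
  minimizer that is nonnegative there almost everywhere agrees almost everywhere with such a function.\<close>

locale nonneg_minimizer =
  fixes s t p q \<Lambda> \<alpha> A :: real and \<Omega> :: "'a::euclidean_space set"
    and Ksp Ktq a :: "'a \<Rightarrow> 'a \<Rightarrow> real" and w :: "'a \<Rightarrow> real" and x0 :: 'a and R :: real
  assumes exponents: "0 < s" "s \<le> t" "t < 1" "1 < p" "p \<le> q" "1 \<le> \<Lambda>"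
    "0 < \<alpha>" "\<alpha> \<le> 1" "0 \<le> A" "\<alpha> < t * q" "t * q \<le> s * p + \<alpha>"
    and \<Omega>: "open \<Omega>" "bounded \<Omega>"
    and Ksp: "kernel_cond \<Lambda> (s * p) Ksp" and Ktq: "kernel_cond \<Lambda> (t * q) Ktq"
    and a: "coeff_cond a" "holder_coeff \<alpha> A a"
    and w_borel [measurable]: "w \<in> borel_measurable borel"
    and minimal: "minimizer s t p q Ksp Ktq a \<Omega> w"
    and R: "0 < R" "R \<le> 1" "ball x0 (4 * R) \<subseteq> \<Omega>"
    and w_nonneg: "\<And>x. x \<in> ball x0 (4 * R) \<Longrightarrow> 0 \<le> w x"
begin

lemma a_nonneg: "0 \<le> a x y" and a_commute: "a x y = a y x"
  using a(1) by (auto simp: coeff_cond_def)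

lemma a_measurable [measurable (raw)]:
  "f \<in> borel_measurable M \<Longrightarrow> g \<in> borel_measurable M \<Longrightarrow> (\<lambda>z. a (f z) (g z)) \<in> borel_measurable M"
  using exponents(7) a(2) by (rule holder_coeff_measurable)

abbreviation B4 :: "'a set" where "B4 \<equiv> ball x0 (4 * R)"

definition gain :: "('a \<Rightarrow> real) \<Rightarrow> real \<Rightarrow> 'a \<Rightarrow> 'a \<Rightarrow> real" where
  "gain \<phi> k x y = barrier_gain p B4 \<phi> k w x y * riesz (s * p) x y
     + a x y * (barrier_gain q B4 \<phi> k w x y * riesz (t * q) x y)"

definition loss :: "('a \<Rightarrow> real) \<Rightarrow> real \<Rightarrow> 'a \<Rightarrow> 'a \<Rightarrow> real" where
  "loss \<phi> k x y = barrier_loss p B4 \<phi> k w x y * riesz (s * p) x y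
     + a x y * (barrier_loss q B4 \<phi> k w x y * riesz (t * q) x y)"

lemma gain_nonneg: "0 \<le> gain \<phi> k x y"
  by (simp add: gain_def a_nonneg barrier_gain_nonneg)

lemma loss_nonneg: "0 \<le> k \<Longrightarrow> 0 \<le> loss \<phi> k x y"
  using exponents by (simp add: loss_def a_nonneg barrier_loss_nonneg)

lemma gain_measurable [measurable (raw)]:
  assumes [measurable]: "\<phi> \<in> borel_measurable borel" "f \<in> borel_measurable M" "g \<in> borel_measurable M"
  shows "(\<lambda>z. gain \<phi> k (f z) (g z)) \<in> borel_measurable M"
  unfolding gain_def by measurable

lemma loss_measurable [measurable (raw)]:
  assumes [measurable]: "\<phi> \<in> borel_measurable borel" "f \<in> borel_measurable M" "g \<in> borel_measurable M"
  shows "(\<lambda>z. loss \<phi> k (f z) (g z)) \<in> borel_measurable M"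
  unfolding loss_def by measurable

lemma measurable_lebesgue_of_borel_pair:
  fixes f :: "'a \<times> 'a \<Rightarrow> 'b::topological_space"
  assumes "f \<in> borel_measurable borel"
  shows "f \<in> borel_measurable lebesgue"
  using assms by (intro measurable_completion) simp

lemma energy_integrand_measurable:
  assumes [measurable]: "u \<in> borel_measurable borel" and K: "kernel_cond c \<beta> K1" "kernel_cond c \<beta>' K2"
  shows "(\<lambda>z. ennreal (\<bar>u (fst z) - u (snd z)\<bar> powr p * K1 (fst z) (snd z)
        + a (fst z) (snd z) * \<bar>u (fst z) - u (snd z)\<bar> powr q * K2 (fst z) (snd z)) * indicator (C_region \<Omega>) z)
     \<in> borel_measurable lebesgue"
proof -
  have K_meas [measurable]: "(\<lambda>z. K1 (fst z) (snd z)) \<in> borel_measurable lebesgue"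
    "(\<lambda>z. K2 (fst z) (snd z)) \<in> borel_measurable lebesgue"
    using K[unfolded kernel_cond_def case_prod_beta'] by blast+
  have \<Omega>_meas: "C_region \<Omega> \<in> sets lebesgue"
  proof -
    have "closed (UNIV - \<Omega>)" using \<Omega>(1) by (simp add: Compl_eq_Diff_UNIV[symmetric] closed_Compl)
    then have "closed ((UNIV - \<Omega>) \<times> (UNIV - \<Omega>))" by (intro closed_Times)
    then have "open (C_region \<Omega>)" unfolding C_region_def by (simp add: Compl_eq_Diff_UNIV[symmetric] open_Compl)
    then show ?thesis by (intro sets_completionI_sets) simp
  qed
  have fs [measurable]: "fst \<in> (lebesgue :: ('a \<times> 'a) measure) \<rightarrow>\<^sub>M borel" "snd \<in> (lebesgue :: ('a \<times> 'a) measure) \<rightarrow>\<^sub>M borel"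
    by (auto intro!: measurable_lebesgue_of_borel_pair simp: borel_prod[symmetric])
  have [measurable]: "(\<lambda>z. u (fst z)) \<in> borel_measurable (lebesgue :: ('a \<times> 'a) measure)"
    "(\<lambda>z. u (snd z)) \<in> borel_measurable (lebesgue :: ('a \<times> 'a) measure)"
    using measurable_compose[OF fs(1) assms(1)] measurable_compose[OF fs(2) assms(1)] by auto
  show ?thesis using \<Omega>_meas by measurable
qed

text \<open>The pointwise comparison, integrated.  It is stated for arbitrary kernels because it is used twice: for
  the model kernels it shows that the competitor is admissible, for the given ones it is compared with
  minimality.  The two orderings of a pair contribute the same amount of loss, whence the factor 2.\<close>

lemma energy_competitor:
  assumes \<phi>: "\<And>x. 0 \<le> \<phi> x" "\<And>x. \<phi> x \<le> k" "\<And>x. x \<notin> B4 \<Longrightarrow> \<phi> x = 0"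
    and [measurable]: "\<phi> \<in> borel_measurable borel"
    and c: "1 \<le> c" and K: "kernel_cond c (s * p) K1" "kernel_cond c (t * q) K2"
  shows "energy p q K1 K2 a \<Omega> (competitor B4 \<phi> w) + ennreal (1 / c) * (\<integral>\<^sup>+x. \<integral>\<^sup>+y. ennreal (gain \<phi> k x y) \<partial>lborel \<partial>lborel)
      \<le> energy p q K1 K2 a \<Omega> w + ennreal (2 * c) * (\<integral>\<^sup>+x. \<integral>\<^sup>+y. ennreal (loss \<phi> k x y) \<partial>lborel \<partial>lborel)"
proof -
  have k: "0 \<le> k" using \<phi>(1,2)[of undefined] by linarith
  define v where "v = competitor B4 \<phi> w"
  define E where "E u z = \<bar>u (fst z) - u (snd z)\<bar> powr p * K1 (fst z) (snd z)
        + a (fst z) (snd z) * \<bar>u (fst z) - u (snd z)\<bar> powr q * K2 (fst z) (snd z)"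
    for u :: "'a \<Rightarrow> real" and z :: "'a \<times> 'a"
  have pt: "E v z + gain \<phi> k (fst z) (snd z) / c
      \<le> E w z + c * (loss \<phi> k (fst z) (snd z) + loss \<phi> k (snd z) (fst z))" for z
  proof -
    let ?x = "fst z" and ?y = "snd z"
    note P = competitor_inequality_kernel[where B = B4 and x = ?x and y = ?y, OF _ w_nonneg \<phi> c]
    have "a ?x ?y * (\<bar>v ?x - v ?y\<bar> powr q * K2 ?x ?y + barrier_gain q B4 \<phi> k w ?x ?y * riesz (t * q) ?x ?y / c)
      \<le> a ?x ?y * (\<bar>w ?x - w ?y\<bar> powr q * K2 ?x ?y + c * (barrier_loss q B4 \<phi> k w ?x ?y * riesz (t * q) ?x ?y
          + barrier_loss q B4 \<phi> k w ?y ?x * riesz (t * q) ?x ?y))"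
      unfolding v_def using K(2) exponents by (intro mult_left_mono P a_nonneg) auto
    moreover have "\<bar>v ?x - v ?y\<bar> powr p * K1 ?x ?y + barrier_gain p B4 \<phi> k w ?x ?y * riesz (s * p) ?x ?y / c
      \<le> \<bar>w ?x - w ?y\<bar> powr p * K1 ?x ?y + c * (barrier_loss p B4 \<phi> k w ?x ?y * riesz (s * p) ?x ?y
          + barrier_loss p B4 \<phi> k w ?y ?x * riesz (s * p) ?x ?y)"
      unfolding v_def using K(1) exponents by (intro P) auto
    ultimately show ?thesis
      by (simp add: E_def gain_def loss_def a_commute[of ?y ?x] riesz_commute[of _ ?y ?x] algebra_simps add_divide_distrib)
  qed
  have E_nonneg: "0 \<le> E u z" for u z
    using K a_nonneg by (auto simp: E_def kernel_cond_def)
  have out: "gain \<phi> k (fst z) (snd z) = 0" "loss \<phi> k (fst z) (snd z) = 0" "loss \<phi> k (snd z) (fst z) = 0"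
    if "z \<notin> C_region \<Omega>" for z
    using that R(3) by (auto simp: C_region_def gain_def loss_def barrier_gain_def barrier_loss_def)
  have v_borel: "v \<in> borel_measurable borel" unfolding v_def by measurable
  have [measurable]: "(\<lambda>z. ennreal (E u z) * indicator (C_region \<Omega>) z) \<in> borel_measurable lebesgue"
    if "u \<in> borel_measurable borel" for u
    unfolding E_def by (rule energy_integrand_measurable[OF that K])
  have gl: "(\<lambda>z :: 'a \<times> 'a. gain \<phi> k (fst z) (snd z)) \<in> borel_measurable borel"
    "(\<lambda>z :: 'a \<times> 'a. loss \<phi> k (fst z) (snd z)) \<in> borel_measurable borel"
    "(\<lambda>z :: 'a \<times> 'a. loss \<phi> k (snd z) (fst z)) \<in> borel_measurable borel"
    by (auto intro!: gain_measurable loss_measurable simp: borel_prod[symmetric])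
  have [measurable]: "(\<lambda>z. gain \<phi> k (fst z) (snd z)) \<in> borel_measurable lebesgue"
    "(\<lambda>z. loss \<phi> k (fst z) (snd z)) \<in> borel_measurable lebesgue"
    "(\<lambda>z. loss \<phi> k (snd z) (fst z)) \<in> borel_measurable lebesgue"
    by (auto intro!: measurable_lebesgue_of_borel_pair gl)
  let ?G = "\<integral>\<^sup>+z. ennreal (gain \<phi> k (fst z) (snd z)) \<partial>lebesgue"
  let ?L = "\<integral>\<^sup>+z. ennreal (loss \<phi> k (fst z) (snd z)) \<partial>lebesgue"
  let ?L' = "\<integral>\<^sup>+z. ennreal (loss \<phi> k (snd z) (fst z)) \<partial>lebesgue"
  have G: "?G = (\<integral>\<^sup>+x. \<integral>\<^sup>+y. ennreal (gain \<phi> k x y) \<partial>lborel \<partial>lborel)"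
    by (subst nn_integral_lebesgue_pair(1)) (use gl in auto)
  have L: "?L = (\<integral>\<^sup>+x. \<integral>\<^sup>+y. ennreal (loss \<phi> k x y) \<partial>lborel \<partial>lborel)"
    by (subst nn_integral_lebesgue_pair(1)) (use gl in auto)
  have L': "?L' = (\<integral>\<^sup>+x. \<integral>\<^sup>+y. ennreal (loss \<phi> k x y) \<partial>lborel \<partial>lborel)"
    by (subst nn_integral_lebesgue_pair(2)) (use gl in auto)
  have "energy p q K1 K2 a \<Omega> v + ennreal (1 / c) * ?G
      = (\<integral>\<^sup>+z. ennreal (E v z) * indicator (C_region \<Omega>) z + ennreal (1 / c) * ennreal (gain \<phi> k (fst z) (snd z)) \<partial>lebesgue)"
    using v_borel unfolding energy_eq_indicator E_def[symmetric]
    by (subst nn_integral_add) (auto simp: nn_integral_cmult)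
  also have "\<dots> \<le> (\<integral>\<^sup>+z. ennreal (E w z) * indicator (C_region \<Omega>) z + (ennreal c * ennreal (loss \<phi> k (fst z) (snd z))
      + ennreal c * ennreal (loss \<phi> k (snd z) (fst z))) \<partial>lebesgue)"
  proof (intro nn_integral_mono)
    fix z
    show "ennreal (E v z) * indicator (C_region \<Omega>) z + ennreal (1 / c) * ennreal (gain \<phi> k (fst z) (snd z))
        \<le> ennreal (E w z) * indicator (C_region \<Omega>) z + (ennreal c * ennreal (loss \<phi> k (fst z) (snd z))
      + ennreal c * ennreal (loss \<phi> k (snd z) (fst z)))"
    proof (cases "z \<in> C_region \<Omega>")
      case True
      have "ennreal (E v z) + ennreal (1 / c) * ennreal (gain \<phi> k (fst z) (snd z)) = ennreal (E v z + gain \<phi> k (fst z) (snd z) / c)"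
        using E_nonneg gain_nonneg c by (simp add: ennreal_mult[symmetric] ennreal_plus[symmetric] del: ennreal_plus)
      also have "\<dots> \<le> ennreal (E w z + c * (loss \<phi> k (fst z) (snd z) + loss \<phi> k (snd z) (fst z)))"
        by (intro ennreal_leI pt)
      also have "\<dots> = ennreal (E w z) + (ennreal c * ennreal (loss \<phi> k (fst z) (snd z))
            + ennreal c * ennreal (loss \<phi> k (snd z) (fst z)))"
        using E_nonneg loss_nonneg[OF k] c
        by (simp add: ennreal_mult[symmetric] ennreal_plus[symmetric] distrib_left del: ennreal_plus)
      finally show ?thesis using True by simp
    qed (simp add: out)
  qed
  also have "\<dots> = energy p q K1 K2 a \<Omega> w + (ennreal c * ?L + ennreal c * ?L')"
    unfolding energy_eq_indicator E_def[symmetric]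
    by (subst nn_integral_add; (subst nn_integral_add)?) (auto simp: nn_integral_cmult)
  also have "ennreal c * ?L + ennreal c * ?L' = ennreal (2 * c) * ?L"
  proof -
    have "ennreal (2 * c) = ennreal c + ennreal c" using c by (subst ennreal_plus[symmetric]) auto
    then show ?thesis unfolding L L' by (simp only: distrib_right)
  qed
  finally show ?thesis unfolding G L v_def .
qed

text \<open>If the loss is finite, the competitor is admissible and has finite energy, so minimality allows both
  energies to be cancelled.\<close>

theorem comparison_gain_le_loss:
  assumes \<phi>: "\<And>x. 0 \<le> \<phi> x" "\<And>x. \<phi> x \<le> k" "\<And>x. x \<notin> B4 \<Longrightarrow> \<phi> x = 0"
    and [measurable]: "\<phi> \<in> borel_measurable borel"
  shows "(\<integral>\<^sup>+x. \<integral>\<^sup>+y. ennreal (gain \<phi> k x y) \<partial>lborel \<partial>lborel)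
      \<le> ennreal (2 * \<Lambda>\<^sup>2) * (\<integral>\<^sup>+x. \<integral>\<^sup>+y. ennreal (loss \<phi> k x y) \<partial>lborel \<partial>lborel)"
    (is "?G \<le> _ * ?L")
proof (cases "?L = \<infinity>")
  case True
  then show ?thesis using exponents(6) by (simp add: ennreal_mult_top)
next
  case False
  then have L: "?L < \<infinity>" by (simp add: less_top)
  have k: "0 \<le> k" using \<phi>(1,2)[of undefined] by linarith
  let ?v = "competitor B4 \<phi> w"
  let ?E = "energy p q Ksp Ktq a \<Omega>" and ?Er = "energy p q (riesz (s * p)) (riesz (t * q)) a \<Omega>"
  have wad: "w \<in> admissible s t p q a \<Omega>" using minimal by (simp add: minimizer_def)
  have Erw: "?Er w < \<infinity>" using wad by (simp add: admissible_iff_riesz_energy)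
  have Ew: "?E w < \<infinity>"
  proof -
    have "?E w \<le> (\<integral>\<^sup>+ z. ennreal \<Lambda> * (ennreal (\<bar>w (fst z) - w (snd z)\<bar> powr p * riesz (s * p) (fst z) (snd z)
        + a (fst z) (snd z) * \<bar>w (fst z) - w (snd z)\<bar> powr q * riesz (t * q) (fst z) (snd z)) * indicator (C_region \<Omega>) z)
      \<partial>lebesgue)"
      unfolding energy_eq_indicator
    proof (rule nn_integral_mono)
      fix z :: "'a \<times> 'a"
      let ?x = "fst z" and ?y = "snd z"
      have K: "z' * Ksp ?x ?y \<le> \<Lambda> * (z' * riesz (s * p) ?x ?y)" "z' * Ktq ?x ?y \<le> \<Lambda> * (z' * riesz (t * q) ?x ?y)"
        if "?x \<noteq> ?y" "0 \<le> z'" for z'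
      proof -
        have "Ksp ?x ?y \<le> \<Lambda> * riesz (s * p) ?x ?y" "Ktq ?x ?y \<le> \<Lambda> * riesz (t * q) ?x ?y"
          using Ksp Ktq that(1) by (auto simp: kernel_cond_def riesz_def)
        from this[THEN mult_left_mono, OF that(2)]
        show "z' * Ksp ?x ?y \<le> \<Lambda> * (z' * riesz (s * p) ?x ?y)" "z' * Ktq ?x ?y \<le> \<Lambda> * (z' * riesz (t * q) ?x ?y)"
          by (simp_all add: mult_ac)
      qed
      have "\<bar>w ?x - w ?y\<bar> powr p * Ksp ?x ?y + a ?x ?y * \<bar>w ?x - w ?y\<bar> powr q * Ktq ?x ?y
          \<le> \<Lambda> * (\<bar>w ?x - w ?y\<bar> powr p * riesz (s * p) ?x ?y + a ?x ?y * \<bar>w ?x - w ?y\<bar> powr q * riesz (t * q) ?x ?y)"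
        using K[of "\<bar>w ?x - w ?y\<bar> powr p"] K[of "a ?x ?y * \<bar>w ?x - w ?y\<bar> powr q"] a_nonneg
        by (cases "?x = ?y") (auto simp: distrib_left)
      then show "ennreal (\<bar>w ?x - w ?y\<bar> powr p * Ksp ?x ?y + a ?x ?y * \<bar>w ?x - w ?y\<bar> powr q * Ktq ?x ?y) * indicator (C_region \<Omega>) z
          \<le> ennreal \<Lambda> * (ennreal (\<bar>w ?x - w ?y\<bar> powr p * riesz (s * p) ?x ?y + a ?x ?y * \<bar>w ?x - w ?y\<bar> powr q * riesz (t * q) ?x ?y)
            * indicator (C_region \<Omega>) z)"
        using exponents(6) by (simp add: ennreal_mult'[symmetric] ennreal_leI split: split_indicator)
    qed
    also have "\<dots> = ennreal \<Lambda> * ?Er w"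
      unfolding energy_eq_indicator
      by (intro nn_integral_cmult energy_integrand_measurable[OF w_borel kernel_cond_riesz kernel_cond_riesz])
    also have "\<dots> < \<infinity>" using Erw by (simp add: ennreal_mult_less_top)
    finally show ?thesis .
  qed
  have "?Er ?v + ennreal (1 / 1) * ?G \<le> ?Er w + ennreal (2 * 1) * ?L"
    by (intro energy_competitor \<phi> kernel_cond_riesz) auto
  also have "\<dots> < \<infinity>" using Erw L by (simp add: ennreal_mult_less_top)
  finally have "?Er ?v < \<infinity>" by (simp add: less_top[symmetric])
  moreover have "(\<integral>\<^sup>+ x \<in> \<Omega>. ennreal (\<bar>?v x\<bar> powr p) \<partial>lebesgue) < \<infinity>"
  proof -
    have [measurable]: "\<Omega> \<in> sets borel" using \<Omega>(1) by simp
    have "\<bar>?v x\<bar> powr p \<le> \<bar>w x\<bar> powr p + k powr p" for x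
    proof -
      have "\<bar>?v x\<bar> \<le> \<bar>w x\<bar> \<or> \<bar>?v x\<bar> \<le> k"
        using \<phi>(1,2)[of x] by (auto simp: competitor_def max_def)
      then have "\<bar>?v x\<bar> powr p \<le> \<bar>w x\<bar> powr p \<or> \<bar>?v x\<bar> powr p \<le> k powr p"
        using exponents by (auto intro: powr_mono2)
      then show ?thesis by (auto intro: add_increasing add_increasing2)
    qed
    then have "(\<integral>\<^sup>+ x \<in> \<Omega>. ennreal (\<bar>?v x\<bar> powr p) \<partial>lborel)
        \<le> (\<integral>\<^sup>+ x. ennreal (\<bar>w x\<bar> powr p) * indicator \<Omega> x + ennreal (k powr p) * indicator \<Omega> x \<partial>lborel)"
      by (intro nn_integral_mono) (auto simp: ennreal_plus[symmetric] ennreal_leI simp del: ennreal_plus split: split_indicator)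
    also have "\<dots> = (\<integral>\<^sup>+ x \<in> \<Omega>. ennreal (\<bar>w x\<bar> powr p) \<partial>lborel) + ennreal (k powr p) * emeasure lborel \<Omega>"
      by (subst nn_integral_add) (auto simp: nn_integral_cmult_indicator)
    also have "\<dots> < \<infinity>"
      using wad emeasure_bounded_finite[OF \<Omega>(2)]
      by (simp add: admissible_def nn_integral_completion ennreal_mult_less_top)
    finally show ?thesis by (simp add: nn_integral_completion)
  qed
  moreover have "?v \<in> borel_measurable lebesgue"
    by (intro measurable_completion) simp
  ultimately have vad: "?v \<in> admissible s t p q a \<Omega>"
    by (simp add: admissible_iff_riesz_energy)
  have "AE x in lebesgue. x \<notin> \<Omega> \<longrightarrow> ?v x = w x"
    using R(3) by (intro AE_I2) (auto simp: competitor_def)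
  with vad minimal have Ewv: "?E w \<le> ?E ?v" by (simp add: minimizer_def)
  have cmp: "?E ?v + ennreal (1 / \<Lambda>) * ?G \<le> ?E w + ennreal (2 * \<Lambda>) * ?L"
    using exponents Ksp Ktq by (intro energy_competitor \<phi>) auto
  also have "\<dots> \<le> ?E ?v + ennreal (2 * \<Lambda>) * ?L" by (intro add_mono Ewv) auto
  finally have le: "?E ?v + ennreal (1 / \<Lambda>) * ?G \<le> ?E ?v + ennreal (2 * \<Lambda>) * ?L" .
  have "?E ?v < \<infinity>"
  proof -
    have "?E ?v \<le> ?E ?v + ennreal (1 / \<Lambda>) * ?G" by simp
    also note cmp
    also have "?E w + ennreal (2 * \<Lambda>) * ?L < \<infinity>" using Ew L by (simp add: ennreal_mult_less_top)
    finally show ?thesis .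
  qed
  with le have "ennreal (1 / \<Lambda>) * ?G \<le> ennreal (2 * \<Lambda>) * ?L"
    by (auto simp: ennreal_add_left_cancel_le)
  then have "ennreal \<Lambda> * (ennreal (1 / \<Lambda>) * ?G) \<le> ennreal \<Lambda> * (ennreal (2 * \<Lambda>) * ?L)"
    by (rule mult_left_mono) simp
  moreover have "ennreal \<Lambda> * ennreal (1 / \<Lambda>) = 1" "ennreal \<Lambda> * ennreal (2 * \<Lambda>) = ennreal (2 * \<Lambda>\<^sup>2)"
    using exponents(6) by (subst ennreal_mult[symmetric]; simp add: power2_eq_square)+
  ultimately show ?thesis by (simp only: mult.assoc[symmetric] mult_1)
qed

end

section \<open>The loss of a truncated constant barrier\<close>

context nonneg_minimizer
begin

definition a_low :: real where "a_low = a_inf a x0 (4 * R)"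

text \<open>The function \<open>h\<close> of the ball of radius \<open>4 R\<close>, with the powers of the radius taken at \<open>R\<close> instead.\<close>

definition hR :: "real \<Rightarrow> real" where
  "hR k = k powr (p - 1) / R powr (s * p) + a_low * (k powr (q - 1) / R powr (t * q))"

lemma
  shows a_low_le: "x \<in> B4 \<Longrightarrow> y \<in> B4 \<Longrightarrow> a_low \<le> a x y" and a_low_nonneg: "0 \<le> a_low"
proof -
  have bdd: "bdd_below ((\<lambda>(x, y). a x y) ` (B4 \<times> B4))"
    by (intro bdd_belowI[of _ 0]) (auto simp: a_nonneg)
  show "x \<in> B4 \<Longrightarrow> y \<in> B4 \<Longrightarrow> a_low \<le> a x y"
    unfolding a_low_def a_inf_def using cINF_lower[OF bdd, of "(x, y)"] by simp
  have "x0 \<in> B4" using R(1) by simp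
  then have "B4 \<noteq> {}" by blast
  then show "0 \<le> a_low"
    unfolding a_low_def a_inf_def by (intro cINF_greatest) (auto simp: a_nonneg)
qed

text \<open>The infimum is taken over pairs of points of the ball, all of which lie within \<open>8 R\<close> of \<open>x\<close>;
  \<open>32\<close> absorbs \<open>2 powr \<alpha> * 16 powr \<alpha>\<close>.\<close>

lemma a_le_a_low:
  assumes x: "x \<in> B4"
  shows "a x y \<le> a_low + 32 * A * (R powr \<alpha> + norm (x - y) powr \<alpha>)"
proof -
  have "a x y - 32 * A * (R powr \<alpha> + norm (x - y) powr \<alpha>) \<le> a x' y'" if "x' \<in> B4" "y' \<in> B4" for x' y'
  proof -
    have d: "norm (x - x') \<le> 8 * R" "norm (x - y') \<le> 8 * R"
      using x that norm_triangle_ineq4[of "x0 - x'" "x0 - x"] norm_triangle_ineq4[of "x0 - y'" "x0 - x"]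
      by (auto simp: dist_norm norm_minus_commute)
    have "norm (y - y') \<le> norm (x - y) + norm (x - y')"
      using norm_triangle_ineq4[of "x - y'" "x - y"] by (simp add: norm_minus_commute)
    with d have "norm (x - x') + norm (y - y') \<le> 16 * R + norm (x - y)" by simp
    then have "(norm (x - x') + norm (y - y')) powr \<alpha> \<le> (16 * R + norm (x - y)) powr \<alpha>"
      using exponents by (intro powr_mono2) auto
    also have "\<dots> \<le> 2 powr \<alpha> * ((16 * R) powr \<alpha> + norm (x - y) powr \<alpha>)"
      using R exponents by (intro powr_add_le) auto
    also have "\<dots> \<le> 2 * (16 * R powr \<alpha> + norm (x - y) powr \<alpha>)"
    proof -
      have "2 powr \<alpha> \<le> 2" "16 powr \<alpha> \<le> 16"
        using powr_mono[of \<alpha> 1 2] powr_mono[of \<alpha> 1 16] exponents by auto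
      then show ?thesis
        using R by (intro mult_mono add_mono) (auto simp: powr_mult intro!: mult_right_mono)
    qed
    also have "\<dots> \<le> 32 * (R powr \<alpha> + norm (x - y) powr \<alpha>)" by simp
    finally have "A * (norm (x - x') + norm (y - y')) powr \<alpha> \<le> A * (32 * (R powr \<alpha> + norm (x - y) powr \<alpha>))"
      using exponents by (intro mult_left_mono) auto
    moreover have "\<bar>a x y - a x' y'\<bar> \<le> A * (norm (x - x') + norm (y - y')) powr \<alpha>"
      using a(2) by (auto simp: holder_coeff_def)
    ultimately show ?thesis by (simp add: mult_ac)
  qed
  then have "a x y - 32 * A * (R powr \<alpha> + norm (x - y) powr \<alpha>) \<le> a_low"
    unfolding a_low_def a_inf_def using R(1) by (intro cINF_greatest) auto
  then show ?thesis by simp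
qed

lemma hR_nonneg: "0 \<le> hR k"
  by (simp add: hR_def a_low_nonneg)

lemma hR_pos: "0 < k \<Longrightarrow> 0 < hR k"
  using R(1) by (auto simp: hR_def a_low_nonneg intro!: add_pos_nonneg)

lemma hR_mono: "0 \<le> k \<Longrightarrow> k \<le> l \<Longrightarrow> hR k \<le> hR l"
  using exponents R(1) a_low_nonneg unfolding hR_def
  by (intro add_mono divide_right_mono mult_left_mono powr_mono2) auto

definition cutoff :: "real \<Rightarrow> real \<Rightarrow> 'a \<Rightarrow> real" where
  "cutoff r \<rho> x = max 0 (min 1 ((\<rho> - norm (x - x0)) / (\<rho> - r)))"

lemma cutoff_measurable [measurable (raw)]:
  assumes [measurable]: "f \<in> borel_measurable M"
  shows "(\<lambda>z. cutoff r \<rho> (f z)) \<in> borel_measurable M"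
  unfolding cutoff_def by measurable

lemma cutoff_bounds: "0 \<le> cutoff r \<rho> x" "cutoff r \<rho> x \<le> 1"
  by (auto simp: cutoff_def)

lemma cutoff_eq_1: "r < \<rho> \<Longrightarrow> x \<in> ball x0 r \<Longrightarrow> cutoff r \<rho> x = 1"
  by (auto simp: cutoff_def dist_norm norm_minus_commute field_simps)

lemma cutoff_eq_0: "r < \<rho> \<Longrightarrow> x \<notin> ball x0 \<rho> \<Longrightarrow> cutoff r \<rho> x = 0"
  by (auto simp: cutoff_def dist_norm norm_minus_commute max_def min_def field_simps)

lemma cutoff_lipschitz:
  assumes "r < \<rho>"
  shows "\<bar>cutoff r \<rho> x - cutoff r \<rho> y\<bar> \<le> min 1 (norm (x - y) / (\<rho> - r))"
proof -
  have "\<bar>cutoff r \<rho> x - cutoff r \<rho> y\<bar> \<le> \<bar>(\<rho> - norm (x - x0)) / (\<rho> - r) - (\<rho> - norm (y - x0)) / (\<rho> - r)\<bar>"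
    unfolding cutoff_def by linarith
  also have "\<dots> = \<bar>norm (y - x0) - norm (x - x0)\<bar> / (\<rho> - r)"
    using assms by (simp add: diff_divide_distrib[symmetric])
  also have "\<dots> \<le> norm (x - y) / (\<rho> - r)"
    using assms norm_triangle_ineq3[of "y - x0" "x - x0"]
    by (intro divide_right_mono) (auto simp: norm_minus_commute)
  finally show ?thesis using cutoff_bounds[of r \<rho> x] cutoff_bounds[of r \<rho> y] by (simp add: abs_le_iff)
qed

text \<open>The barrier varies at most like \<open>k * R / (\<rho> - r)\<close> times the distance truncated at \<open>R\<close>, which produces the
  first term.  For \<open>y\<close> outside the ball of radius \<open>4 R\<close> the distance from \<open>x\<close> is at least \<open>R\<close>, so the
  part \<open>k powr e\<close> of the tail term goes into the first term as well; the remaining part is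
  recentred at \<open>x0\<close>, which costs the factor 4 in the distance.\<close>

lemma barrier_loss_cutoff_le:
  assumes e: "1 < e" "0 \<le> \<beta>" and r: "0 < r" "r < \<rho>" "\<rho> \<le> 3 * R" "\<rho> - r \<le> R" and k: "0 \<le> k"
    and x: "x \<in> ball x0 \<rho>"
  shows "barrier_loss e B4 (\<lambda>z. k * cutoff r \<rho> z) k w x y * riesz \<beta> x y
    \<le> (1 + e * 2 powr e) * (k powr e * (R / (\<rho> - r)) powr e) * (min 1 (norm (x - y) / R) powr e * riesz \<beta> x y)
      + e * 2 powr e * k * 4 powr (real DIM('a) + \<beta>) *
        (neg_part w y powr (e - 1) / norm (y - x0) powr (real DIM('a) + \<beta>) * indicator (UNIV - B4) y)"
proof -
  define D where "D = R / (\<rho> - r)"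
  define \<mu> where "\<mu> = min 1 (norm (x - y) / R)"
  have D: "1 \<le> D" using r by (simp add: D_def)
  have \<mu>: "0 \<le> \<mu>" using R(1) by (simp add: \<mu>_def)
  have c: "\<bar>cutoff r \<rho> x - cutoff r \<rho> y\<bar> \<le> D * \<mu>"
  proof -
    have "norm (x - y) / (\<rho> - r) = D * (norm (x - y) / R)" using R(1) by (simp add: D_def)
    then have "\<bar>cutoff r \<rho> x - cutoff r \<rho> y\<bar> \<le> min 1 (D * (norm (x - y) / R))"
      using cutoff_lipschitz[OF r(2), of x y] by simp
    also have "\<dots> \<le> D * \<mu>"
      using D by (auto simp: \<mu>_def min_def)
    finally show ?thesis .
  qed
  have "\<bar>k * cutoff r \<rho> x - k * cutoff r \<rho> y\<bar> = k * \<bar>cutoff r \<rho> x - cutoff r \<rho> y\<bar>"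
    using k by (simp add: abs_mult right_diff_distrib[symmetric])
  also have "\<dots> \<le> k * (D * \<mu>)" using c k by (intro mult_left_mono)
  finally have "\<bar>k * cutoff r \<rho> x - k * cutoff r \<rho> y\<bar> powr e \<le> (k * (D * \<mu>)) powr e"
    using e by (intro powr_mono2) auto
  also have "\<dots> = k powr e * D powr e * \<mu> powr e" using k D \<mu> by (simp add: powr_mult)
  finally have main: "\<bar>k * cutoff r \<rho> x - k * cutoff r \<rho> y\<bar> powr e \<le> k powr e * D powr e * \<mu> powr e" .
  have nn: "0 \<le> e * 2 powr e" using e by simp
  have kk: "k * k powr (e - 1) = k powr e" using k by (cases "k = 0") (auto simp: powr_mult_base)
  show ?thesis
  proof (cases "y \<in> B4")
    case True
    have "barrier_loss e B4 (\<lambda>z. k * cutoff r \<rho> z) k w x y \<le> k powr e * D powr e * \<mu> powr e"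
      using main True by (simp add: barrier_loss_def)
    also have "\<dots> \<le> (1 + e * 2 powr e) * (k powr e * D powr e * \<mu> powr e)"
      using nn by (simp add: distrib_right)
    finally have "barrier_loss e B4 (\<lambda>z. k * cutoff r \<rho> z) k w x y * riesz \<beta> x y
       \<le> (1 + e * 2 powr e) * (k powr e * D powr e * \<mu> powr e) * riesz \<beta> x y"
      by (intro mult_right_mono) auto
    then show ?thesis using True by (simp add: D_def \<mu>_def mult_ac)
  next
    case False
    have d: "4 * R \<le> norm (y - x0)" "norm (x - x0) < 3 * R"
      using False x r by (auto simp: dist_norm norm_minus_commute)
    have tri: "norm (y - x0) \<le> norm (x - y) + norm (x - x0)"
      using norm_triangle_ineq4[of "x - x0" "x - y"] by (simp add: norm_minus_commute)
    then have "R \<le> norm (x - y)" using d by linarith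
    then have \<mu>1: "\<mu> = 1" using R(1) by (simp add: \<mu>_def)
    have "norm (y - x0) / 4 \<le> norm (x - y)" using d tri by linarith
    then have "riesz \<beta> x y \<le> 1 / (norm (y - x0) / 4) powr (real DIM('a) + \<beta>)"
      using d R(1) e by (intro riesz_le) auto
    also have "\<dots> = 4 powr (real DIM('a) + \<beta>) / norm (y - x0) powr (real DIM('a) + \<beta>)"
      by (simp add: powr_divide)
    finally have rz: "riesz \<beta> x y \<le> 4 powr (real DIM('a) + \<beta>) / norm (y - x0) powr (real DIM('a) + \<beta>)" .
    have "1 \<le> D powr e" using D e by (simp add: ge_one_powr_ge_zero)
    then have kD: "k powr e \<le> k powr e * D powr e * \<mu> powr e"
      using mult_left_mono[of 1 "D powr e" "k powr e"] by (simp add: \<mu>1)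
    let ?n = "neg_part w y powr (e - 1)"
    have "barrier_loss e B4 (\<lambda>z. k * cutoff r \<rho> z) k w x y
        \<le> k powr e * D powr e * \<mu> powr e + e * 2 powr e * (k * (k powr (e - 1) + ?n))"
      using main False nn k D \<mu> by (simp add: barrier_loss_def)
    also have "\<dots> \<le> (1 + e * 2 powr e) * (k powr e * D powr e * \<mu> powr e) + e * 2 powr e * (k * ?n)"
      using mult_left_mono[OF kD nn] by (simp add: distrib_left distrib_right kk)
    finally have "barrier_loss e B4 (\<lambda>z. k * cutoff r \<rho> z) k w x y * riesz \<beta> x y
      \<le> ((1 + e * 2 powr e) * (k powr e * D powr e * \<mu> powr e) + e * 2 powr e * (k * ?n)) * riesz \<beta> x y"
      by (intro mult_right_mono) auto
    also have "\<dots> = (1 + e * 2 powr e) * (k powr e * D powr e) * (\<mu> powr e * riesz \<beta> x y) + e * 2 powr e * (k * ?n) * riesz \<beta> x y"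
      by (simp add: algebra_simps)
    also have "\<dots> \<le> (1 + e * 2 powr e) * (k powr e * D powr e) * (\<mu> powr e * riesz \<beta> x y)
        + e * 2 powr e * (k * ?n) * (4 powr (real DIM('a) + \<beta>) / norm (y - x0) powr (real DIM('a) + \<beta>))"
      using nn k by (intro add_left_mono mult_left_mono rz) auto
    finally show ?thesis using False by (simp add: D_def \<mu>_def mult_ac)
  qed
qed

end

text \<open>\<open>C\<close> bounds the truncated kernel integrals and \<open>M\<close> the admissible levels.  Both are fixed here, so that the
  constants derived below visibly depend on the data only.\<close>

locale nonneg_minimizer_bounds = nonneg_minimizer s t p q \<Lambda> \<alpha> A \<Omega> Ksp Ktq a w x0 R
  for s t p q \<Lambda> \<alpha> A :: real and \<Omega> :: "'a::euclidean_space set"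
    and Ksp Ktq a :: "'a \<Rightarrow> 'a \<Rightarrow> real" and w :: "'a \<Rightarrow> real" and x0 :: 'a and R :: real +
  fixes C M :: real
  assumes C: "0 \<le> C" and M: "0 \<le> M"
    and mass_p: "\<And>x::'a. (\<integral>\<^sup>+y. ennreal (min 1 (norm (x - y) / R) powr p * riesz (s * p) x y) \<partial>lborel) \<le> ennreal (C / R powr (s * p))"
    and mass_q: "\<And>x::'a. (\<integral>\<^sup>+y. ennreal (min 1 (norm (x - y) / R) powr q * riesz (t * q) x y) \<partial>lborel) \<le> ennreal (C / R powr (t * q))"
    and mass_a: "\<And>x::'a. (\<integral>\<^sup>+y. ennreal (min 1 (norm (x - y) / R) powr q * riesz (t * q - \<alpha>) x y) \<partial>lborel) \<le> ennreal (C / R powr (t * q - \<alpha>))"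
begin

definition c_loss :: real where
  "c_loss = (1 + q * 2 powr q) * (C + 64 * A * C * M powr (q - p)) + q * 2 powr q * 4 powr (real DIM('a) + t * q)"

lemma sp_le_tq: "s * p \<le> t * q"
  using exponents by (intro mult_mono) auto

text \<open>Replacing \<open>a\<close> by its infimum leaves the error \<open>A * k powr q * R powr (\<alpha> - t * q)\<close>.  It is a \<open>p\<close>-term:
  \<open>k powr (q - p) \<le> M powr (q - p)\<close>, and \<open>R powr (\<alpha> - t * q) \<le> R powr - (s * p)\<close> because \<open>R \<le> 1\<close> and
  \<open>t * q \<le> s * p + \<alpha>\<close>.  The growth of \<open>a\<close> at infinity is integrable against the kernel since \<open>\<alpha> < t * q\<close>.\<close>

lemma loss_integral_le:
  assumes r: "0 < r" "r < \<rho>" "\<rho> \<le> 3 * R" "\<rho> - r \<le> R" and k: "0 < k" "k \<le> M"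
    and tails: "Tail s p (neg_part w) x0 (4 * R) + Tail_a t q a (neg_part w) x0 (4 * R) \<le> ennreal (hR k)"
    and x: "x \<in> ball x0 \<rho>"
  shows "(\<integral>\<^sup>+y. ennreal (loss (\<lambda>z. k * cutoff r \<rho> z) k x y) \<partial>lborel)
     \<le> ennreal (c_loss * (R / (\<rho> - r)) powr q * (k * hR k))"
proof -
  define N where "N = real DIM('a)"
  define D where "D = R / (\<rho> - r)"
  define c4 where "c4 = q * 2 powr q * k * 4 powr (N + t * q)"
  define c1 where "c1 = (1 + q * 2 powr q) * D powr q"
  define m where "m e y = min 1 (norm (x - y) / R) powr e" for e y
  define ta where "ta e \<beta> y = neg_part w y powr (e - 1) / norm (y - x0) powr (N + \<beta>) * indicator (UNIV - B4) y" for e \<beta> y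
  have D: "1 \<le> D" using r by (simp add: D_def)
  have x4: "x \<in> B4" using x r R(1) by auto
  have pq: "p * 2 powr p \<le> q * 2 powr q" using exponents by (intro mult_mono powr_mono) auto
  have DD: "D powr p \<le> D powr q" using exponents D by (intro powr_mono) auto
  have nn: "0 \<le> c1" "0 \<le> c4" using exponents k by (auto simp: c1_def c4_def)
  have mn: "0 \<le> m e y" "0 \<le> ta e \<beta> y" for e \<beta> y by (auto simp: m_def ta_def)
  have [measurable]: "B4 \<in> sets borel" by simp
  have [measurable]: "(\<lambda>y. ta e \<beta> y) \<in> borel_measurable borel" "(\<lambda>y. m e y) \<in> borel_measurable borel" for e \<beta>
    unfolding ta_def m_def neg_part_def by measurable
  have P: "barrier_loss p B4 (\<lambda>z. k * cutoff r \<rho> z) k w x y * riesz (s * p) x y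
     \<le> c1 * k powr p * (m p y * riesz (s * p) x y) + c4 * ta p (s * p) y" for y
  proof -
    have "barrier_loss p B4 (\<lambda>z. k * cutoff r \<rho> z) k w x y * riesz (s * p) x y
     \<le> (1 + p * 2 powr p) * (k powr p * D powr p) * (m p y * riesz (s * p) x y)
      + p * 2 powr p * k * 4 powr (N + s * p) * ta p (s * p) y"
      unfolding m_def ta_def D_def N_def using exponents r x k by (intro barrier_loss_cutoff_le) auto
    also have "\<dots> \<le> (1 + q * 2 powr q) * (k powr p * D powr q) * (m p y * riesz (s * p) x y)
      + c4 * ta p (s * p) y"
    proof -
      have "4 powr (N + s * p) \<le> 4 powr (N + t * q)" using sp_le_tq by (intro powr_mono) auto
      then show ?thesis
        unfolding c4_def using exponents pq DD k mn
        by (intro add_mono mult_right_mono mult_mono mult_left_mono mult_nonneg_nonneg) auto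
    qed
    finally show ?thesis by (simp add: c1_def mult_ac)
  qed
  have Q: "a x y * (barrier_loss q B4 (\<lambda>z. k * cutoff r \<rho> z) k w x y * riesz (t * q) x y)
     \<le> c1 * k powr q * (a_low + 32 * A * R powr \<alpha>) * (m q y * riesz (t * q) x y)
       + c1 * k powr q * (32 * A) * (m q y * riesz (t * q - \<alpha>) x y) + c4 * (a x y * ta q (t * q) y)" for y
  proof -
    have "barrier_loss q B4 (\<lambda>z. k * cutoff r \<rho> z) k w x y * riesz (t * q) x y
     \<le> (1 + q * 2 powr q) * (k powr q * D powr q) * (m q y * riesz (t * q) x y)
      + q * 2 powr q * k * 4 powr (N + t * q) * ta q (t * q) y"
      unfolding m_def ta_def D_def N_def using exponents r x k by (intro barrier_loss_cutoff_le) auto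
    then have "a x y * (barrier_loss q B4 (\<lambda>z. k * cutoff r \<rho> z) k w x y * riesz (t * q) x y)
      \<le> a x y * (c1 * k powr q * (m q y * riesz (t * q) x y) + c4 * ta q (t * q) y)"
      by (intro mult_left_mono a_nonneg) (simp add: c1_def c4_def mult_ac)
    also have "\<dots> = c1 * k powr q * (a x y * (m q y * riesz (t * q) x y)) + c4 * (a x y * ta q (t * q) y)"
      by (simp add: algebra_simps)
    also have "c1 * k powr q * (a x y * (m q y * riesz (t * q) x y))
       \<le> c1 * k powr q * ((a_low + 32 * A * (R powr \<alpha> + norm (x - y) powr \<alpha>)) * (m q y * riesz (t * q) x y))"
      using nn mn by (intro mult_left_mono mult_right_mono a_le_a_low x4) auto
    also have "\<dots> = c1 * k powr q * (a_low + 32 * A * R powr \<alpha>) * (m q y * riesz (t * q) x y)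
       + c1 * k powr q * (32 * A) * (m q y * (norm (x - y) powr \<alpha> * riesz (t * q) x y))"
      by (simp add: algebra_simps)
    also have "norm (x - y) powr \<alpha> * riesz (t * q) x y = riesz (t * q - \<alpha>) x y"
      by (cases "x = y") (auto simp: riesz_def powr_diff powr_add field_simps)
    finally show ?thesis by simp
  qed
  have T1: "(\<integral>\<^sup>+y. ennreal (ta p (s * p) y) \<partial>lborel) = Tail s p (neg_part w) x0 (4 * R)"
    unfolding Tail_def N_def ta_def nn_integral_completion
    by (intro nn_integral_cong) (auto split: split_indicator)
  have T2: "(\<integral>\<^sup>+y. ennreal (a x y * ta q (t * q) y) \<partial>lborel) \<le> Tail_a t q a (neg_part w) x0 (4 * R)"
    unfolding Tail_a_def N_def ta_def nn_integral_completion
    by (rule SUP_upper2[OF x4]) (auto intro!: nn_integral_mono simp: a_commute[of x] split: split_indicator)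
  define S1 where "S1 = c1 * k powr p * (C / R powr (s * p))"
  define S2 where "S2 = c1 * k powr q * (a_low + 32 * A * R powr \<alpha>) * (C / R powr (t * q))"
  define S3 where "S3 = c1 * k powr q * (32 * A) * (C / R powr (t * q - \<alpha>))"
  have Sn: "0 \<le> S1" "0 \<le> S2" "0 \<le> S3"
    using nn k C a_low_nonneg exponents by (auto simp: S1_def S2_def S3_def intro!: mult_nonneg_nonneg add_nonneg_nonneg)
  have "(\<integral>\<^sup>+y. ennreal (loss (\<lambda>z. k * cutoff r \<rho> z) k x y) \<partial>lborel)
     \<le> (\<integral>\<^sup>+y. ennreal (c1 * k powr p) * ennreal (m p y * riesz (s * p) x y) + ennreal c4 * ennreal (ta p (s * p) y)
       + ennreal (c1 * k powr q * (a_low + 32 * A * R powr \<alpha>)) * ennreal (m q y * riesz (t * q) x y)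
       + ennreal (c1 * k powr q * (32 * A)) * ennreal (m q y * riesz (t * q - \<alpha>) x y)
       + ennreal c4 * ennreal (a x y * ta q (t * q) y) \<partial>lborel)"
  proof (intro nn_integral_mono)
    fix y
    have nn': "0 \<le> c1 * k powr p" "0 \<le> c1 * k powr q * (a_low + 32 * A * R powr \<alpha>)" "0 \<le> c1 * k powr q * (32 * A)"
      using nn k a_low_nonneg exponents by auto
    have "loss (\<lambda>z. k * cutoff r \<rho> z) k x y \<le> c1 * k powr p * (m p y * riesz (s * p) x y) + c4 * ta p (s * p) y
       + c1 * k powr q * (a_low + 32 * A * R powr \<alpha>) * (m q y * riesz (t * q) x y)
       + c1 * k powr q * (32 * A) * (m q y * riesz (t * q - \<alpha>) x y)
       + c4 * (a x y * ta q (t * q) y)"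
      using P[of y] Q[of y] by (simp add: loss_def)
    then have "ennreal (loss (\<lambda>z. k * cutoff r \<rho> z) k x y)
       \<le> ennreal (c1 * k powr p * (m p y * riesz (s * p) x y) + c4 * ta p (s * p) y
       + c1 * k powr q * (a_low + 32 * A * R powr \<alpha>) * (m q y * riesz (t * q) x y)
       + c1 * k powr q * (32 * A) * (m q y * riesz (t * q - \<alpha>) x y)
       + c4 * (a x y * ta q (t * q) y))"
      by (rule ennreal_leI)
    also have "\<dots> = ennreal (c1 * k powr p) * ennreal (m p y * riesz (s * p) x y) + ennreal c4 * ennreal (ta p (s * p) y)
       + ennreal (c1 * k powr q * (a_low + 32 * A * R powr \<alpha>)) * ennreal (m q y * riesz (t * q) x y)
       + ennreal (c1 * k powr q * (32 * A)) * ennreal (m q y * riesz (t * q - \<alpha>) x y)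
       + ennreal c4 * ennreal (a x y * ta q (t * q) y)"
      using nn nn' mn a_nonneg
      by (simp only: ennreal_plus ennreal_mult riesz_nonneg mult_nonneg_nonneg add_nonneg_nonneg)
    finally show "ennreal (loss (\<lambda>z. k * cutoff r \<rho> z) k x y) \<le> ennreal (c1 * k powr p) * ennreal (m p y * riesz (s * p) x y) + ennreal c4 * ennreal (ta p (s * p) y)
       + ennreal (c1 * k powr q * (a_low + 32 * A * R powr \<alpha>)) * ennreal (m q y * riesz (t * q) x y)
       + ennreal (c1 * k powr q * (32 * A)) * ennreal (m q y * riesz (t * q - \<alpha>) x y)
       + ennreal c4 * ennreal (a x y * ta q (t * q) y)" .
  qed
  also have "\<dots> = ennreal (c1 * k powr p) * (\<integral>\<^sup>+y. ennreal (m p y * riesz (s * p) x y) \<partial>lborel)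
       + ennreal c4 * (\<integral>\<^sup>+y. ennreal (ta p (s * p) y) \<partial>lborel)
       + ennreal (c1 * k powr q * (a_low + 32 * A * R powr \<alpha>)) * (\<integral>\<^sup>+y. ennreal (m q y * riesz (t * q) x y) \<partial>lborel)
       + ennreal (c1 * k powr q * (32 * A)) * (\<integral>\<^sup>+y. ennreal (m q y * riesz (t * q - \<alpha>) x y) \<partial>lborel)
       + ennreal c4 * (\<integral>\<^sup>+y. ennreal (a x y * ta q (t * q) y) \<partial>lborel)"
    by (simp add: nn_integral_add nn_integral_cmult)
  also have "\<dots> \<le> ennreal (c1 * k powr p) * ennreal (C / R powr (s * p))
       + ennreal c4 * Tail s p (neg_part w) x0 (4 * R)
       + ennreal (c1 * k powr q * (a_low + 32 * A * R powr \<alpha>)) * ennreal (C / R powr (t * q))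
       + ennreal (c1 * k powr q * (32 * A)) * ennreal (C / R powr (t * q - \<alpha>))
       + ennreal c4 * Tail_a t q a (neg_part w) x0 (4 * R)"
    unfolding m_def by (intro add_mono mult_left_mono mass_p mass_q mass_a T2) (auto simp: T1)
  also have "\<dots> = ennreal S1 + ennreal S2 + ennreal S3
       + ennreal c4 * (Tail s p (neg_part w) x0 (4 * R) + Tail_a t q a (neg_part w) x0 (4 * R))"
    using nn k C a_low_nonneg exponents unfolding S1_def S2_def S3_def
    by (subst (1 2 3) ennreal_mult[symmetric]) (auto simp: distrib_left add_ac)
  also have "\<dots> \<le> ennreal S1 + ennreal S2 + ennreal S3 + ennreal c4 * ennreal (hR k)"
    by (intro add_left_mono mult_left_mono tails) auto
  also have "\<dots> = ennreal (S1 + S2 + S3 + c4 * hR k)"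
    using Sn nn hR_nonneg by (simp add: ennreal_mult)
  also have "\<dots> \<le> ennreal (c_loss * (R / (\<rho> - r)) powr q * (k * hR k))"
  proof (rule ennreal_leI)
    have kp: "k powr p = k * k powr (p - 1)" "k powr q = k * k powr (q - 1)"
      using k by (auto simp: powr_mult_base)
    \<comment> \<open>\<open>X\<close> and \<open>Y\<close> are the two phases, so that \<open>k * hR k = X + a_low * Y\<close>.\<close>
    define X where "X = k powr p / R powr (s * p)"
    define Y where "Y = k powr q / R powr (t * q)"
    have XY: "0 \<le> X" "0 \<le> Y" by (auto simp: X_def Y_def)
    have kl: "k * hR k = X + a_low * Y"
      by (simp add: hR_def kp X_def Y_def distrib_left)
    have Z: "k powr q / R powr (t * q - \<alpha>) \<le> M powr (q - p) * X"
    proof -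
      have "k powr q = k powr (q - p) * k powr p" using k by (simp add: powr_add[symmetric])
      also have "\<dots> \<le> M powr (q - p) * k powr p"
        using k exponents by (intro mult_right_mono powr_mono2) auto
      finally have 1: "k powr q \<le> M powr (q - p) * k powr p" .
      have "R powr (s * p) \<le> R powr (t * q - \<alpha>)"
        using R exponents by (intro powr_mono') auto
      then have "1 / R powr (t * q - \<alpha>) \<le> 1 / R powr (s * p)"
        using R(1) by (intro divide_left_mono) auto
      then have "k powr q * (1 / R powr (t * q - \<alpha>)) \<le> M powr (q - p) * k powr p * (1 / R powr (s * p))"
        using 1 by (intro mult_mono) auto
      then show ?thesis by (simp add: X_def)
    qed
    have Ra: "R powr \<alpha> / R powr (t * q) = 1 / R powr (t * q - \<alpha>)"
      using R(1) by (simp add: powr_diff)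
    have e1: "S1 = c1 * C * X" by (simp add: S1_def X_def)
    have e2: "S2 = c1 * C * (a_low * Y) + c1 * C * 32 * A * (k powr q / R powr (t * q - \<alpha>))"
    proof -
      have "S2 = c1 * C * (a_low * Y) + c1 * C * 32 * A * (k powr q * (R powr \<alpha> / R powr (t * q)))"
        by (simp add: S2_def Y_def algebra_simps add_divide_distrib)
      then show ?thesis unfolding Ra by simp
    qed
    have e3: "S3 = c1 * C * 32 * A * (k powr q / R powr (t * q - \<alpha>))"
      by (simp add: S3_def field_simps)
    have "S1 + S2 + S3 = c1 * C * (X + a_low * Y) + c1 * C * 64 * A * (k powr q / R powr (t * q - \<alpha>))"
      unfolding e1 e2 e3 by (simp add: algebra_simps)
    also have "\<dots> \<le> c1 * C * (X + a_low * Y) + c1 * C * 64 * A * (M powr (q - p) * X)"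
      using nn C exponents by (intro add_left_mono mult_left_mono Z) auto
    also have "\<dots> \<le> c1 * C * (X + a_low * Y) + c1 * C * 64 * A * (M powr (q - p) * (X + a_low * Y))"
      using nn C exponents XY a_low_nonneg by (intro add_left_mono mult_left_mono) auto
    finally have "S1 + S2 + S3 \<le> c1 * (C + 64 * A * C * M powr (q - p)) * (k * hR k)"
      unfolding kl by (simp add: algebra_simps)
    moreover have "c4 * hR k \<le> q * 2 powr q * 4 powr (N + t * q) * D powr q * (k * hR k)"
    proof -
      have "1 \<le> D powr q" using D exponents by (simp add: ge_one_powr_ge_zero)
      then have "c4 * hR k * 1 \<le> c4 * hR k * D powr q"
        using nn hR_nonneg by (intro mult_left_mono) auto
      then show ?thesis by (simp add: c4_def mult_ac)
    qed
    ultimately show "S1 + S2 + S3 + c4 * hR k \<le> c_loss * (R / (\<rho> - r)) powr q * (k * hR k)"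
      unfolding c_loss_def c1_def D_def[symmetric] N_def by (simp add: algebra_simps)
  qed
  finally show ?thesis .
qed

text \<open>This plays the role of the Caccioppoli inequality: the singular double integral on the left is the part
  of the energy that couples low and high values.\<close>

theorem sublevel_estimate:
  assumes r: "0 < r" "r < \<rho>" "\<rho> \<le> 3 * R" "\<rho> - r \<le> R" and k: "0 < k" "k \<le> M"
    and tails: "Tail s p (neg_part w) x0 (4 * R) + Tail_a t q a (neg_part w) x0 (4 * R) \<le> ennreal (hR k)"
  shows "(\<integral>\<^sup>+x\<in>{x \<in> ball x0 r. w x < k}. (\<integral>\<^sup>+y\<in>{y \<in> B4. k \<le> w y}.
        ennreal ((k - w x) * ((w y - w x) powr (p - 1) * riesz (s * p) x y + a_low * ((w y - w x) powr (q - 1) * riesz (t * q) x y)))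
        \<partial>lborel) \<partial>lborel)
     \<le> ennreal (2 * \<Lambda>\<^sup>2 * c_loss * (R / (\<rho> - r)) powr q * (k * hR k)) * emeasure lborel {x \<in> ball x0 \<rho>. w x < k}"
proof -
  let ?\<phi> = "\<lambda>z. k * cutoff r \<rho> z"
  have [measurable]: "{x \<in> ball x0 \<rho>. w x < k} \<in> sets borel" for \<rho> by measurable
  have cl: "0 \<le> c_loss" using C exponents by (simp add: c_loss_def)
  have "(\<integral>\<^sup>+x\<in>{x \<in> ball x0 r. w x < k}. (\<integral>\<^sup>+y\<in>{y \<in> B4. k \<le> w y}.
        ennreal ((k - w x) * ((w y - w x) powr (p - 1) * riesz (s * p) x y + a_low * ((w y - w x) powr (q - 1) * riesz (t * q) x y)))
        \<partial>lborel) \<partial>lborel) \<le> (\<integral>\<^sup>+x. \<integral>\<^sup>+y. ennreal (gain ?\<phi> k x y) \<partial>lborel \<partial>lborel)"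
  proof (intro nn_integral_mono)
    fix x
    show "(\<integral>\<^sup>+y\<in>{y \<in> B4. k \<le> w y}.
        ennreal ((k - w x) * ((w y - w x) powr (p - 1) * riesz (s * p) x y + a_low * ((w y - w x) powr (q - 1) * riesz (t * q) x y)))
        \<partial>lborel) * indicator {x \<in> ball x0 r. w x < k} x \<le> (\<integral>\<^sup>+y. ennreal (gain ?\<phi> k x y) \<partial>lborel)"
    proof (cases "x \<in> ball x0 r \<and> w x < k")
      case True
      have x4: "x \<in> B4" using True r R(1) by auto
      show ?thesis
        using True
      proof (simp, intro nn_integral_mono)
        fix y
        show "ennreal ((k - w x) * ((w y - w x) powr (p - 1) * riesz (s * p) x y + a_low * ((w y - w x) powr (q - 1) * riesz (t * q) x y)))
            * indicator {y. dist x0 y < 4 * R \<and> k \<le> w y} y \<le> ennreal (gain ?\<phi> k x y)"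
        proof (cases "y \<in> B4 \<and> k \<le> w y")
          case y: True
          have "gain ?\<phi> k x y = (k - w x) * ((w y - w x) powr (p - 1) * riesz (s * p) x y + a x y * ((w y - w x) powr (q - 1) * riesz (t * q) x y))"
            using True x4 y r by (simp add: gain_def barrier_gain_def cutoff_eq_1 algebra_simps)
          then have "(k - w x) * ((w y - w x) powr (p - 1) * riesz (s * p) x y + a_low * ((w y - w x) powr (q - 1) * riesz (t * q) x y))
             \<le> gain ?\<phi> k x y"
            using True x4 y a_low_le[of x y] by (auto intro!: mult_left_mono mult_right_mono)
          then show ?thesis using y by (simp add: ennreal_leI)
        qed simp
      qed
    qed auto
  qed
  also have "\<dots> \<le> ennreal (2 * \<Lambda>\<^sup>2) * (\<integral>\<^sup>+x. \<integral>\<^sup>+y. ennreal (loss ?\<phi> k x y) \<partial>lborel \<partial>lborel)"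
  proof (rule comparison_gain_le_loss)
    show "0 \<le> ?\<phi> x" "?\<phi> x \<le> k" for x
      using k cutoff_bounds[of r \<rho> x] by (auto simp: mult_left_le)
    show "?\<phi> x = 0" if "x \<notin> B4" for x
      using that r R(1) cutoff_eq_0[of r \<rho> x] by auto
  qed measurable
  also have "(\<integral>\<^sup>+x. \<integral>\<^sup>+y. ennreal (loss ?\<phi> k x y) \<partial>lborel \<partial>lborel)
     \<le> (\<integral>\<^sup>+x. ennreal (c_loss * (R / (\<rho> - r)) powr q * (k * hR k)) * indicator {x \<in> ball x0 \<rho>. w x < k} x \<partial>lborel)"
  proof (intro nn_integral_mono)
    fix x
    show "(\<integral>\<^sup>+y. ennreal (loss ?\<phi> k x y) \<partial>lborel)
      \<le> ennreal (c_loss * (R / (\<rho> - r)) powr q * (k * hR k)) * indicator {x \<in> ball x0 \<rho>. w x < k} x"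
    proof (cases "x \<in> ball x0 \<rho> \<and> w x < k")
      case True
      then show ?thesis using loss_integral_le[OF r k tails, of x] by simp
    next
      case False
      have "loss ?\<phi> k x y = 0" for y
      proof (rule ccontr)
        assume "loss ?\<phi> k x y \<noteq> 0"
        then have *: "x \<in> B4" "w x < ?\<phi> x" by (auto simp: loss_def barrier_loss_def split: if_splits)
        have "?\<phi> x \<le> k" using k cutoff_bounds[of r \<rho> x] by (auto simp: mult_left_le)
        moreover have "?\<phi> x \<noteq> 0" using *(2) w_nonneg[OF *(1)] by linarith
        then have "x \<in> ball x0 \<rho>" using cutoff_eq_0[OF r(2), of x] by auto
        ultimately show False using False *(2) by simp
      qed
      then show ?thesis by simp
    qed
  qed
  also have "\<dots> = ennreal (c_loss * (R / (\<rho> - r)) powr q * (k * hR k)) * emeasure lborel {x \<in> ball x0 \<rho>. w x < k}"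
    by (intro nn_integral_cmult_indicator) measurable
  also have "ennreal (2 * \<Lambda>\<^sup>2) * \<dots>
      = ennreal (2 * \<Lambda>\<^sup>2 * c_loss * (R / (\<rho> - r)) powr q * (k * hR k)) * emeasure lborel {x \<in> ball x0 \<rho>. w x < k}"
  proof -
    have "ennreal (2 * \<Lambda>\<^sup>2) * ennreal (c_loss * (R / (\<rho> - r)) powr q * (k * hR k))
        = ennreal (2 * \<Lambda>\<^sup>2 * c_loss * (R / (\<rho> - r)) powr q * (k * hR k))"
      using cl k hR_nonneg by (subst ennreal_mult[symmetric]) (auto simp: mult.assoc)
    then show ?thesis by (simp add: mult.assoc[symmetric])
  qed
  finally show ?thesis by (simp add: mult_left_mono)
qed

end

section \<open>Iteration over sublevel sets\<close>

lemma ennreal_le_divide_of_mult_le: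
  assumes "ennreal z * X \<le> ennreal y" "0 < z" "0 \<le> y"
  shows "X \<le> ennreal (y / z)"
proof -
  have "X = ennreal (1 / z) * (ennreal z * X)"
    using assms(2) by (simp add: mult.assoc[symmetric] ennreal_mult[symmetric])
  also have "\<dots> \<le> ennreal (1 / z) * ennreal y" by (intro mult_left_mono assms(1)) simp
  also have "\<dots> = ennreal (y / z)" using assms by (simp add: ennreal_mult[symmetric])
  finally show ?thesis .
qed

lemma cmult_emeasure_le_nn_integral:
  assumes "S \<in> sets M" "S \<subseteq> X" "\<And>x. x \<in> S \<Longrightarrow> c \<le> F x"
  shows "c * emeasure M S \<le> (\<integral>\<^sup>+x\<in>X. F x \<partial>M)"
proof -
  have "c * emeasure M S = (\<integral>\<^sup>+x. c * indicator S x \<partial>M)"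
    using assms(1) by (simp add: nn_integral_cmult_indicator)
  also have "\<dots> \<le> (\<integral>\<^sup>+x\<in>X. F x \<partial>M)"
    using assms(2,3) by (intro nn_integral_mono) (auto split: split_indicator)
  finally show ?thesis .
qed

text \<open>At least half of the ball of radius \<open>d\<close> is left after \<open>E\<close> is removed, and on it the kernel is at least its
  value at distance \<open>d\<close>.\<close>

lemma riesz_integral_ge_off_small_set:
  fixes x :: "'a::euclidean_space"
  assumes d: "0 < d" and \<beta>: "0 \<le> \<beta>" and [measurable]: "E \<in> sets borel" "G \<in> sets borel"
    and E: "emeasure lborel E \<le> ennreal (ball_vol TYPE('a) * d powr real DIM('a) / 2)"
    and G: "ball x d - E \<subseteq> G"
  shows "ennreal (ball_vol TYPE('a) / 2 / d powr \<beta>) \<le> (\<integral>\<^sup>+y\<in>G. ennreal (riesz \<beta> x y) \<partial>lborel)"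
proof -
  define N V where "N = real DIM('a)" and "V = ball_vol TYPE('a)"
  have V: "0 < V" by (simp add: V_def)
  have b: "emeasure lborel (ball x d) = ennreal (V * d powr N)"
    unfolding V_def N_def using d by (rule emeasure_lborel_ball_powr)
  have [measurable]: "ball x d \<in> sets borel" by simp
  have "ennreal (V * d powr N) \<le> emeasure lborel (ball x d - E) + emeasure lborel E"
    unfolding b[symmetric] by (rule order_trans[OF emeasure_mono emeasure_subadditive]) auto
  also have "\<dots> \<le> emeasure lborel (ball x d - E) + ennreal (V * d powr N / 2)"
    using E by (intro add_left_mono) (simp add: V_def N_def)
  finally have "ennreal (V * d powr N / 2) + ennreal (V * d powr N / 2) \<le> emeasure lborel (ball x d - E) + ennreal (V * d powr N / 2)"
    using V by (simp add: ennreal_plus[symmetric] del: ennreal_plus)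
  then have half: "ennreal (V * d powr N / 2) \<le> emeasure lborel (ball x d - E)"
    by (simp add: ennreal_add_left_cancel_le add.commute)
  have "ennreal (V / 2 / d powr \<beta>) = ennreal (1 / d powr (N + \<beta>)) * ennreal (V * d powr N / 2)"
    using d V by (subst ennreal_mult[symmetric]) (auto simp: powr_add)
  also have "\<dots> \<le> ennreal (1 / d powr (N + \<beta>)) * emeasure lborel (ball x d - E)"
    by (intro mult_left_mono half) simp
  also have "\<dots> = (\<integral>\<^sup>+y. ennreal (1 / d powr (N + \<beta>)) * indicator (ball x d - E) y \<partial>lborel)"
    by (rule nn_integral_cmult_indicator[symmetric]) measurable
  also have "\<dots> \<le> (\<integral>\<^sup>+y\<in>G. ennreal (riesz \<beta> x y) \<partial>lborel)"
  proof (rule nn_integral_mono_AE)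
    have "AE y in lborel. y \<noteq> x" by (rule AE_lborel_singleton)
    then show "AE y in lborel. ennreal (1 / d powr (N + \<beta>)) * indicator (ball x d - E) y \<le> ennreal (riesz \<beta> x y) * indicator G y"
    proof eventually_elim
      case (elim y)
      show ?case
      proof (cases "y \<in> ball x d - E")
        case True
        then have "1 / d powr (N + \<beta>) \<le> riesz \<beta> x y"
          unfolding N_def using elim \<beta> by (intro riesz_ge) (auto simp: dist_norm)
        then show ?thesis using True G by (auto simp: ennreal_leI)
      qed simp
    qed
  qed
  finally show ?thesis by (simp add: V_def)
qed

definition sublevel :: "('a::euclidean_space \<Rightarrow> real) \<Rightarrow> 'a \<Rightarrow> real \<Rightarrow> real \<Rightarrow> 'a set" where
  "sublevel w x0 r k = {x \<in> ball x0 r. w x < k}"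

lemma sublevel_measurable [measurable]:
  assumes [measurable]: "w \<in> borel_measurable borel"
  shows "sublevel w x0 r k \<in> sets borel"
  unfolding sublevel_def by measurable

text \<open>The hypothesis of the iteration: passing to a smaller ball and a lower level gains the factor
  \<open>(d / R) powr \<beta>\<close>, where \<open>d\<close> is any radius whose ball has at least twice the measure of the larger
  sublevel set.  Choosing \<open>d\<close> freely avoids fractional powers of measures.\<close>

definition degiorgi_decay ::
  "real \<Rightarrow> real \<Rightarrow> real \<Rightarrow> ('a::euclidean_space \<Rightarrow> real) \<Rightarrow> 'a \<Rightarrow> real \<Rightarrow> real \<Rightarrow> bool" where
  "degiorgi_decay C Q \<beta> w x0 R k0 \<longleftrightarrow>
    (\<forall>r \<rho> l k d. R \<le> r \<and> r < \<rho> \<and> \<rho> \<le> 2 * R \<and> k0 / 2 \<le> l \<and> l < k \<and> k \<le> k0 \<and> 0 < d \<and> d \<le> \<rho> - r \<and>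
       emeasure lborel (sublevel w x0 \<rho> k) \<le> ennreal (ball_vol TYPE('a) * d powr real DIM('a) / 2) \<longrightarrow>
       emeasure lborel (sublevel w x0 r l)
         \<le> ennreal (C * (R / (\<rho> - r) * (k / (k - l))) powr Q * (d / R) powr \<beta> * d powr real DIM('a)))"

text \<open>With radii \<open>R * (1 + 2 powr - j)\<close> and levels \<open>k0 / 2 * (1 + 2 powr - j)\<close> one proves by induction that the \<open>j\<close>-th
  sublevel set has at most half the measure of a ball of radius \<open>d j = e * R * \<theta> ^ j\<close>.  The ratio \<open>\<theta>\<close> is so small
  that \<open>\<theta> powr \<beta>\<close> beats the growth \<open>2 powr (2 * Q)\<close> of the constants, \<open>e\<close> is so small that \<open>e powr \<beta>\<close>
  absorbs the fixed factor that remains, and \<open>\<epsilon>\<close> is what the start at \<open>j = 0\<close> requires.\<close>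

lemma degiorgi_iteration:
  fixes C Q \<beta> :: real
  assumes C: "0 \<le> C" and Q: "0 \<le> Q" and \<beta>: "0 < \<beta>"
  shows "\<exists>\<epsilon>>0. \<forall>(w :: 'a::euclidean_space \<Rightarrow> real) x0 R k0.
    w \<in> borel_measurable borel \<longrightarrow> 0 < R \<longrightarrow> 0 < k0 \<longrightarrow>
    degiorgi_decay C Q \<beta> w x0 R k0 \<longrightarrow>
    emeasure lborel (sublevel w x0 (2 * R) k0) \<le> ennreal (\<epsilon> * R powr real DIM('a)) \<longrightarrow>
    emeasure lborel (sublevel w x0 R (k0 / 2)) = 0"
proof -
  define N V where "N = real DIM('a)" and "V = ball_vol TYPE('a)"
  have N: "0 < N" and V: "0 < V" by (auto simp: N_def V_def)
  define \<theta> where "\<theta> = min (1 / 2) ((1 / 2) powr (2 * Q / \<beta>))"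
  have \<theta>: "0 < \<theta>" "\<theta> \<le> 1 / 2" by (auto simp: \<theta>_def)
  have \<theta>Q: "2 powr (2 * Q) * \<theta> powr \<beta> \<le> 1"
  proof -
    have "\<theta> powr \<beta> \<le> ((1 / 2) powr (2 * Q / \<beta>)) powr \<beta>"
      using \<theta> \<beta> by (intro powr_mono2) (auto simp: \<theta>_def)
    also have "\<dots> = (1 / 2) powr (2 * Q)" using \<beta> by (simp add: powr_powr)
    also have "\<dots> = 1 / 2 powr (2 * Q)" by (simp add: powr_divide)
    finally show ?thesis by (simp add: field_simps)
  qed
  define z where "z = V * \<theta> powr N / (2 * (C * 2 powr (3 * Q) + 1))"
  have pos: "0 < C * 2 powr (3 * Q) + 1" using C by (simp add: add_nonneg_pos)
  have z: "0 < z" unfolding z_def using V \<theta> pos by (intro divide_pos_pos mult_pos_pos) auto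
  define e where "e = min (1 / 2) (z powr (1 / \<beta>))"
  have e: "0 < e" "e \<le> 1 / 2" using z by (auto simp: e_def)
  have eC: "C * 2 powr (3 * Q) * e powr \<beta> \<le> V * \<theta> powr N / 2"
  proof -
    have "e powr \<beta> \<le> (z powr (1 / \<beta>)) powr \<beta>"
      using e \<beta> by (intro powr_mono2) (auto simp: e_def)
    also have "\<dots> = z" using \<beta> z by (simp add: powr_powr)
    finally have "(C * 2 powr (3 * Q) + 1) * e powr \<beta> \<le> (C * 2 powr (3 * Q) + 1) * z"
      using pos by (intro mult_left_mono) auto
    also have "\<dots> = V * \<theta> powr N / 2"
    proof -
      have "P * (W / (2 * P)) = W / 2" if "0 < P" for P W :: real using that by simp
      from this[OF pos] show ?thesis unfolding z_def .
    qed
    finally have "(C * 2 powr (3 * Q) + 1) * e powr \<beta> \<le> V * \<theta> powr N / 2" .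
    moreover have "C * 2 powr (3 * Q) * e powr \<beta> \<le> (C * 2 powr (3 * Q) + 1) * e powr \<beta>"
      by (intro mult_right_mono) auto
    ultimately show ?thesis by linarith
  qed
  show ?thesis
  proof (intro exI[of _ "V * e powr N / 2"] conjI allI impI)
    show "0 < V * e powr N / 2" using V e(1) by (intro divide_pos_pos mult_pos_pos) auto
    fix w :: "'a \<Rightarrow> real" and x0 and R k0 :: real
    assume [measurable]: "w \<in> borel_measurable borel" and R: "0 < R" and k0: "0 < k0"
      and step: "degiorgi_decay C Q \<beta> w x0 R k0"
      and init: "emeasure lborel (sublevel w x0 (2 * R) k0) \<le> ennreal (V * e powr N / 2 * R powr real DIM('a))"
    define r where "r j = R * (1 + (1 / 2) ^ j)" for j :: nat
    define k where "k j = k0 / 2 * (1 + (1 / 2) ^ j)" for j :: nat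
    define d where "d j = e * R * \<theta> ^ j" for j :: nat
    have dpos: "0 < d j" for j using e R \<theta> by (simp add: d_def)
    have pj: "0 < (1 / 2 :: real) ^ j" "(1 / 2 :: real) ^ j \<le> 1" for j :: nat
      by (auto simp: power_le_one)
    have claim: "emeasure lborel (sublevel w x0 (r j) (k j)) \<le> ennreal (V * d j powr N / 2)" for j
    proof (induction j)
      case 0
      have "V * d 0 powr N / 2 = V * e powr N / 2 * R powr N" using e R by (simp add: d_def powr_mult)
      moreover have "r 0 = 2 * R" "k 0 = k0" by (auto simp: r_def k_def)
      ultimately show ?case using init by (simp only: N_def)
    next
      case (Suc j)
      have rd: "r j - r (Suc j) = R * (1 / 2) ^ Suc j" by (simp add: r_def field_simps)
      have kd: "k j - k (Suc j) = k0 / 2 * (1 / 2) ^ Suc j" by (simp add: k_def field_simps)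
      have r1: "R \<le> r (Suc j)" "r (Suc j) < r j" "r j \<le> 2 * R"
        using R pj[of "Suc j"] pj[of j] rd by (auto simp: r_def)
      have k1: "k0 / 2 \<le> k (Suc j)" "k (Suc j) < k j" "k j \<le> k0"
        using k0 pj[of "Suc j"] pj[of j] kd by (auto simp: k_def)
      have dr: "d j \<le> r j - r (Suc j)"
      proof -
        have "d j \<le> 1 / 2 * R * (1 / 2) ^ j"
          unfolding d_def using e R \<theta> by (intro mult_mono power_mono) auto
        then show ?thesis by (simp add: rd)
      qed
      have "R \<le> r (Suc j) \<and> r (Suc j) < r j \<and> r j \<le> 2 * R \<and> k0 / 2 \<le> k (Suc j) \<and> k (Suc j) < k j \<and> k j \<le> k0 \<and> 0 < d j \<and> d j \<le> r j - r (Suc j) \<and>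
       emeasure lborel (sublevel w x0 (r j) (k j)) \<le> ennreal (ball_vol TYPE('a) * d j powr real DIM('a) / 2)"
        using r1 k1 dr dpos Suc by (simp add: N_def V_def)
      from step[unfolded degiorgi_decay_def, rule_format, OF this]
      have "emeasure lborel (sublevel w x0 (r (Suc j)) (k (Suc j)))
         \<le> ennreal (C * (R / (r j - r (Suc j)) * (k j / (k j - k (Suc j)))) powr Q * (d j / R) powr \<beta> * d j powr N)"
        by (simp add: N_def)
      also have "\<dots> \<le> ennreal (V * d (Suc j) powr N / 2)"
      proof (rule ennreal_leI)
        have "k j / (k j - k (Suc j)) \<le> k0 / (k j - k (Suc j))"
          using k1 by (intro divide_right_mono) auto
        also have "\<dots> = 2 ^ (j + 2)" unfolding kd using k0 by (simp add: field_simps power_one_over)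
        finally have a1: "k j / (k j - k (Suc j)) \<le> 2 ^ (j + 2)" .
        have a2: "R / (r j - r (Suc j)) = 2 ^ (j + 1)" unfolding rd using R by (simp add: field_simps power_one_over)
        have kj: "0 < k j" using k1 k0 by linarith
        have "R / (r j - r (Suc j)) * (k j / (k j - k (Suc j))) \<le> 2 ^ (j + 1) * 2 ^ (j + 2)"
          unfolding a2 by (intro mult_left_mono a1) simp
        also have "\<dots> = 2 ^ (2 * j + 3)"
          by (subst power_add[symmetric], rule arg_cong[where f = "power 2"]) simp
        also have "\<dots> = 2 powr (real (2 * j + 3))"
          by (rule powr_realpow[symmetric]) simp
        finally have "(R / (r j - r (Suc j)) * (k j / (k j - k (Suc j)))) powr Q \<le> (2 powr (real (2 * j + 3))) powr Q"
          using Q r1 k1 R kj by (intro powr_mono2) auto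
        also have "\<dots> = 2 powr (3 * Q) * (2 powr (2 * Q)) ^ j"
          by (simp add: powr_powr powr_add[symmetric] powr_power algebra_simps)
        finally have b1: "(R / (r j - r (Suc j)) * (k j / (k j - k (Suc j)))) powr Q \<le> 2 powr (3 * Q) * (2 powr (2 * Q)) ^ j" .
        have b2: "(d j / R) powr \<beta> = e powr \<beta> * (\<theta> powr \<beta>) ^ j"
          using R e \<theta> by (simp add: d_def powr_mult powr_power powr_realpow[symmetric] powr_powr mult.commute)
        have b3: "d (Suc j) powr N = \<theta> powr N * d j powr N"
          using R e \<theta> by (simp add: d_def powr_mult[symmetric] mult_ac)
        have "C * (R / (r j - r (Suc j)) * (k j / (k j - k (Suc j)))) powr Q * (d j / R) powr \<beta> * d j powr N
           \<le> C * (2 powr (3 * Q) * (2 powr (2 * Q)) ^ j) * (e powr \<beta> * (\<theta> powr \<beta>) ^ j) * d j powr N"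
          unfolding b2 using C b1 by (intro mult_right_mono mult_left_mono) auto
        also have "\<dots> = (C * 2 powr (3 * Q) * e powr \<beta>) * (2 powr (2 * Q) * \<theta> powr \<beta>) ^ j * d j powr N"
          by (simp add: power_mult_distrib mult_ac)
        also have "\<dots> \<le> (V * \<theta> powr N / 2) * 1 * d j powr N"
          using eC \<theta>Q V by (intro mult_right_mono mult_mono power_le_one) auto
        also have "\<dots> = V * d (Suc j) powr N / 2" by (simp add: b3 mult_ac)
        finally show "C * (R / (r j - r (Suc j)) * (k j / (k j - k (Suc j)))) powr Q * (d j / R) powr \<beta> * d j powr N
          \<le> V * d (Suc j) powr N / 2" .
      qed
      finally show ?case .
    qed
    have le: "emeasure lborel (sublevel w x0 R (k0 / 2)) \<le> ennreal (V * d j powr N / 2)" for j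
    proof -
      have "sublevel w x0 R (k0 / 2) \<subseteq> sublevel w x0 (r j) (k j)"
      proof -
        have "R \<le> r j" "k0 / 2 \<le> k j" using R k0 by (simp_all add: r_def k_def distrib_left)
        then show ?thesis by (auto simp: sublevel_def)
      qed
      then have "emeasure lborel (sublevel w x0 R (k0 / 2)) \<le> emeasure lborel (sublevel w x0 (r j) (k j))"
        by (intro emeasure_mono) auto
      with claim[of j] show ?thesis by simp
    qed
    have "(\<lambda>j. V * d j powr N / 2) \<longlonglongrightarrow> V * 0 powr N / 2"
    proof (intro tendsto_intros tendsto_powr')
      have "(\<lambda>j. e * R * \<theta> ^ j) \<longlonglongrightarrow> e * R * 0"
        using \<theta> by (intro tendsto_intros LIMSEQ_power_zero) auto
      then show "d \<longlonglongrightarrow> 0" unfolding d_def by simp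
    qed (use N dpos in \<open>auto intro!: always_eventually less_imp_le\<close>)
    then have "(\<lambda>j. ennreal (V * d j powr N / 2)) \<longlonglongrightarrow> ennreal 0"
      using N by (intro tendsto_ennrealI) simp
    then have "emeasure lborel (sublevel w x0 R (k0 / 2)) \<le> ennreal 0"
      by (rule LIMSEQ_le_const) (use le in auto)
    then show "emeasure lborel (sublevel w x0 R (k0 / 2)) = 0" by simp
  qed
qed

context nonneg_minimizer_bounds
begin

text \<open>The gain at a point of the lower sublevel set is bounded below by the kernel integral over the
  points within distance \<open>d\<close> that lie above the level \<open>k\<close>.  As \<open>d \<le> R\<close> and \<open>s * p \<le> t * q\<close>, both
  phases improve at least by \<open>(R / d) powr (s * p)\<close>, so that \<open>k * hR k\<close> cancels.\<close>

lemma sublevel_step: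
  assumes r: "R \<le> r" "r < \<rho>" "\<rho> \<le> 2 * R" and k: "0 < l" "l < k" "k \<le> M" and d: "0 < d" "d \<le> \<rho> - r"
    and tails: "Tail s p (neg_part w) x0 (4 * R) + Tail_a t q a (neg_part w) x0 (4 * R) \<le> ennreal (hR k)"
    and small: "emeasure lborel (sublevel w x0 \<rho> k) \<le> ennreal (ball_vol TYPE('a) * d powr real DIM('a) / 2)"
  shows "emeasure lborel (sublevel w x0 r l)
     \<le> ennreal (2 * \<Lambda>\<^sup>2 * c_loss * (R / (\<rho> - r) * (k / (k - l))) powr q * (d / R) powr (s * p) * d powr real DIM('a))"
proof -
  define N V where "N = real DIM('a)" and "V = ball_vol TYPE('a)"
  have V: "0 < V" by (simp add: V_def)
  have kpos: "0 < k" "0 < k - l" using k by auto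
  have dR: "d \<le> R" using d r by linarith
  have cl: "0 \<le> c_loss" using C exponents by (simp add: c_loss_def)
  have sp: "0 \<le> s * p" "0 \<le> t * q" using exponents by auto
  define Z where "Z = ((k - l) / k) powr q * (V / 2) * (R / d) powr (s * p) * (k * hR k)"
  have Z: "0 < Z" using kpos V R(1) d hR_pos[OF kpos(1)] by (simp add: Z_def)
  let ?G = "{y \<in> B4. k \<le> w y}"
  let ?I = "\<lambda>x y. (k - w x) * ((w y - w x) powr (p - 1) * riesz (s * p) x y + a_low * ((w y - w x) powr (q - 1) * riesz (t * q) x y))"
  have [measurable]: "?G \<in> sets borel" by measurable
  have inner: "ennreal Z \<le> (\<integral>\<^sup>+y\<in>?G. ennreal (?I x y) \<partial>lborel)" if x: "x \<in> sublevel w x0 r l" for x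
  proof -
    define K where "K \<beta> = (\<integral>\<^sup>+y\<in>?G. ennreal (riesz \<beta> x y) \<partial>lborel)" for \<beta>
    have xd: "x \<in> ball x0 r" "w x < l" using x by (auto simp: sublevel_def)
    have "ball x d - sublevel w x0 \<rho> k \<subseteq> ?G"
    proof
      fix y assume y: "y \<in> ball x d - sublevel w x0 \<rho> k"
      have "dist x0 y \<le> dist x0 x + dist x y" by (rule dist_triangle)
      then have "dist x0 y < \<rho>" using y xd d by (auto simp: dist_commute)
      then show "y \<in> ?G" using y r R(1) by (auto simp: sublevel_def)
    qed
    then have K: "ennreal (V / 2 / d powr \<beta>) \<le> K \<beta>" if "0 \<le> \<beta>" for \<beta>
      unfolding K_def V_def using d small that by (intro riesz_integral_ge_off_small_set[where E = "sublevel w x0 \<rho> k"]) auto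
    define z1 z2 where "z1 = (k - l) powr p" and "z2 = a_low * (k - l) powr q"
    have z: "0 \<le> z1" "0 \<le> z2" by (auto simp: z1_def z2_def a_low_nonneg)
    have "Z \<le> z1 * (V / 2 / d powr (s * p)) + z2 * (V / 2 / d powr (t * q))"
    proof -
      have f: "((k - l) / k) powr q * k powr p \<le> (k - l) powr p"
      proof -
        have "((k - l) / k) powr q \<le> ((k - l) / k) powr p"
          using k kpos exponents by (intro powr_mono') auto
        then have "((k - l) / k) powr q * k powr p \<le> ((k - l) / k) powr p * k powr p"
          by (intro mult_right_mono) auto
        also have "\<dots> = (k - l) powr p" using kpos by (simp add: powr_divide)
        finally show ?thesis .
      qed
      have g: "((k - l) / k) powr q * k powr q = (k - l) powr q" using kpos by (simp add: powr_divide)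
      have "(R / d) powr (s * p) \<le> (R / d) powr (t * q)"
        using d dR sp_le_tq by (intro powr_mono) auto
      then have h: "(R / d) powr (s * p) / R powr (t * q) \<le> 1 / d powr (t * q)"
        using d R(1) by (simp add: powr_divide field_simps)
      have h': "(R / d) powr (s * p) / R powr (s * p) = 1 / d powr (s * p)"
        using d R(1) by (simp add: powr_divide field_simps)
      have kp: "k * k powr (p - 1) = k powr p" "k * k powr (q - 1) = k powr q"
        using kpos by (auto simp: powr_mult_base)
      have "k * hR k = k powr p / R powr (s * p) + a_low * (k powr q / R powr (t * q))"
        unfolding hR_def kp[symmetric] by (simp add: algebra_simps)
      then have "Z = (V / 2) * ((((k - l) / k) powr q * k powr p) * ((R / d) powr (s * p) / R powr (s * p))
          + a_low * (((k - l) / k) powr q * k powr q) * ((R / d) powr (s * p) / R powr (t * q)))"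
        unfolding Z_def by (simp add: algebra_simps)
      also have "\<dots> \<le> (V / 2) * ((k - l) powr p * (1 / d powr (s * p)) + a_low * (k - l) powr q * (1 / d powr (t * q)))"
        unfolding h' g using V h a_low_nonneg by (intro mult_left_mono add_mono mult_right_mono f) auto
      finally show ?thesis by (simp add: z1_def z2_def algebra_simps)
    qed
    then have "ennreal Z \<le> ennreal (z1 * (V / 2 / d powr (s * p)) + z2 * (V / 2 / d powr (t * q)))"
      by (rule ennreal_leI)
    also have "\<dots> = ennreal z1 * ennreal (V / 2 / d powr (s * p)) + ennreal z2 * ennreal (V / 2 / d powr (t * q))"
      using z V by (subst ennreal_plus; (subst (1 2) ennreal_mult)?) auto
    also have "\<dots> \<le> ennreal z1 * K (s * p) + ennreal z2 * K (t * q)"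
      using sp by (intro add_mono mult_left_mono K) auto
    also have "\<dots> = (\<integral>\<^sup>+y. ennreal z1 * (ennreal (riesz (s * p) x y) * indicator ?G y) + ennreal z2 * (ennreal (riesz (t * q) x y) * indicator ?G y) \<partial>lborel)"
      unfolding K_def by (subst nn_integral_add) (auto simp: nn_integral_cmult)
    also have "\<dots> \<le> (\<integral>\<^sup>+y\<in>?G. ennreal (?I x y) \<partial>lborel)"
    proof (intro nn_integral_mono)
      fix y
      show "ennreal z1 * (ennreal (riesz (s * p) x y) * indicator ?G y) + ennreal z2 * (ennreal (riesz (t * q) x y) * indicator ?G y)
        \<le> ennreal (?I x y) * indicator ?G y"
      proof (cases "y \<in> ?G")
        case True
        have pw: "(k - l) powr e \<le> (k - w x) * (w y - w x) powr (e - 1)" if "1 < e" for e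
        proof -
          have "(k - l) powr e = (k - l) * (k - l) powr (e - 1)" using kpos by (simp add: powr_mult_base)
          also have "\<dots> \<le> (k - w x) * (w y - w x) powr (e - 1)"
            using xd True kpos that by (intro mult_mono powr_mono2) auto
          finally show ?thesis .
        qed
        have "z1 * riesz (s * p) x y \<le> (k - w x) * (w y - w x) powr (p - 1) * riesz (s * p) x y"
          unfolding z1_def using exponents by (intro mult_right_mono pw) auto
        moreover have "z2 * riesz (t * q) x y \<le> a_low * ((k - w x) * (w y - w x) powr (q - 1)) * riesz (t * q) x y"
          unfolding z2_def using exponents a_low_nonneg by (intro mult_right_mono mult_left_mono pw) auto
        ultimately have "z1 * riesz (s * p) x y + z2 * riesz (t * q) x y \<le> ?I x y" by (simp add: algebra_simps)
        then have "ennreal (z1 * riesz (s * p) x y + z2 * riesz (t * q) x y) \<le> ennreal (?I x y)" by (rule ennreal_leI)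
        then show ?thesis using True z by (simp add: ennreal_mult)
      qed simp
    qed
    finally show ?thesis .
  qed
  have "ennreal Z * emeasure lborel (sublevel w x0 r l)
      \<le> (\<integral>\<^sup>+x\<in>{x \<in> ball x0 r. w x < k}. (\<integral>\<^sup>+y\<in>?G. ennreal (?I x y) \<partial>lborel) \<partial>lborel)"
  proof (rule cmult_emeasure_le_nn_integral)
    show "sublevel w x0 r l \<subseteq> {x \<in> ball x0 r. w x < k}" using k by (auto simp: sublevel_def)
  qed (use inner in auto)
  also have "\<dots> \<le> ennreal (2 * \<Lambda>\<^sup>2 * c_loss * (R / (\<rho> - r)) powr q * (k * hR k)) * emeasure lborel {x \<in> ball x0 \<rho>. w x < k}"
    using r R(1) k by (intro sublevel_estimate tails) auto
  also have "\<dots> \<le> ennreal (2 * \<Lambda>\<^sup>2 * c_loss * (R / (\<rho> - r)) powr q * (k * hR k)) * ennreal (V * d powr N / 2)"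
    using small by (intro mult_left_mono) (auto simp: sublevel_def V_def N_def)
  also have "\<dots> = ennreal (2 * \<Lambda>\<^sup>2 * c_loss * (R / (\<rho> - r)) powr q * (k * hR k) * (V * d powr N / 2))"
    using cl kpos hR_nonneg V by (intro ennreal_mult[symmetric]) auto
  finally have "emeasure lborel (sublevel w x0 r l)
     \<le> ennreal (2 * \<Lambda>\<^sup>2 * c_loss * (R / (\<rho> - r)) powr q * (k * hR k) * (V * d powr N / 2) / Z)"
    using Z cl kpos hR_nonneg V by (intro ennreal_le_divide_of_mult_le) auto
  also have "2 * \<Lambda>\<^sup>2 * c_loss * (R / (\<rho> - r)) powr q * (k * hR k) * (V * d powr N / 2) / Z
     = 2 * \<Lambda>\<^sup>2 * c_loss * (R / (\<rho> - r) * (k / (k - l))) powr q * (d / R) powr (s * p) * d powr N"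
  proof -
    have cancel: "c * X * L * (V * D / 2) / (1 / a * (V / 2) * b * L) = c * (X * a) * (1 / b) * D"
      if "0 < a" "0 < b" "0 < L" for a b c D L X :: real
      using that V by (simp add: field_simps)
    have 1: "(R / (\<rho> - r) * (k / (k - l))) powr q = (R / (\<rho> - r)) powr q * (k / (k - l)) powr q"
      by (rule powr_mult)
    have 2: "(d / R) powr (s * p) = 1 / (R / d) powr (s * p)" "((k - l) / k) powr q = 1 / (k / (k - l)) powr q"
      using R(1) d kpos by (simp_all add: powr_divide)
    show ?thesis
      unfolding Z_def 1 2 by (rule cancel) (use kpos R(1) d hR_pos[OF kpos(1)] in auto)
  qed
  finally show ?thesis by (simp add: N_def)
qed

end

section \<open>Smallness of the first sublevel set\<close>

lemma superlevel_power_integral: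
  fixes w :: "'a::euclidean_space \<Rightarrow> real"
  assumes [measurable]: "B \<in> sets borel" "w \<in> borel_measurable borel"
    and vol: "emeasure lborel B = ennreal vol" "0 \<le> vol" and w: "\<And>x. x \<in> B \<Longrightarrow> 0 \<le> w x"
    and e: "0 \<le> e" and k: "k powr e \<le> m powr e / 2"
    and mean: "ennreal (vol * m powr e) \<le> (\<integral>\<^sup>+x\<in>B. ennreal (w x powr e) \<partial>lborel)"
  shows "ennreal (vol * m powr e / 2) \<le> (\<integral>\<^sup>+x\<in>{x \<in> B. k \<le> w x}. ennreal (w x powr e) \<partial>lborel)"
    (is "_ \<le> ?I")
proof -
  have [measurable]: "{x \<in> B. k \<le> w x} \<in> sets borel" by measurable
  have "(\<integral>\<^sup>+x\<in>B. ennreal (w x powr e) \<partial>lborel)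
    \<le> (\<integral>\<^sup>+x. ennreal (w x powr e) * indicator {x \<in> B. k \<le> w x} x + ennreal (k powr e) * indicator B x \<partial>lborel)"
  proof (intro nn_integral_mono)
    fix x
    show "ennreal (w x powr e) * indicator B x
       \<le> ennreal (w x powr e) * indicator {x \<in> B. k \<le> w x} x + ennreal (k powr e) * indicator B x"
    proof (cases "x \<in> B \<and> \<not> k \<le> w x")
      case True
      then have "w x powr e \<le> k powr e" using w e by (intro powr_mono2) auto
      then show ?thesis using True by (simp add: ennreal_leI)
    qed (auto split: split_indicator)
  qed
  also have "\<dots> = ?I + ennreal (k powr e) * emeasure lborel B"
    by (subst nn_integral_add) (auto simp: nn_integral_cmult_indicator)
  also have "\<dots> \<le> ?I + ennreal (vol * m powr e / 2)"
  proof (intro add_left_mono)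
    have "k powr e * vol \<le> m powr e / 2 * vol" using k vol by (intro mult_right_mono)
    then show "ennreal (k powr e) * emeasure lborel B \<le> ennreal (vol * m powr e / 2)"
      using vol by (simp add: ennreal_mult[symmetric] ennreal_leI mult.commute)
  qed
  finally have "ennreal (vol * m powr e) \<le> ?I + ennreal (vol * m powr e / 2)"
    using mean by (rule order_trans[rotated])
  moreover have "ennreal (vol * m powr e) = ennreal (vol * m powr e / 2) + ennreal (vol * m powr e / 2)"
    using vol by (subst ennreal_plus[symmetric]) auto
  ultimately have "ennreal (vol * m powr e / 2) + ennreal (vol * m powr e / 2) \<le> ennreal (vol * m powr e / 2) + ?I"
    by (simp add: add.commute)
  then show ?thesis by (simp add: ennreal_add_left_cancel_le)
qed

context nonneg_minimizer_bounds
begin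

lemma c_loss_nonneg: "0 \<le> c_loss"
  using C exponents by (simp add: c_loss_def)

lemma minimizer_degiorgi_decay:
  assumes k: "0 < k0" "k0 \<le> M"
    and tails: "Tail s p (neg_part w) x0 (4 * R) + Tail_a t q a (neg_part w) x0 (4 * R) \<le> ennreal (hR (k0 / 2))"
  shows "degiorgi_decay (2 * \<Lambda>\<^sup>2 * c_loss) q (s * p) w x0 R k0"
  unfolding degiorgi_decay_def
proof (intro allI impI, elim conjE)
  fix r \<rho> l k d
  assume *: "R \<le> r" "r < \<rho>" "\<rho> \<le> 2 * R" "k0 / 2 \<le> l" "l < k" "k \<le> k0" "0 < d" "d \<le> \<rho> - r"
    "emeasure lborel (sublevel w x0 \<rho> k) \<le> ennreal (ball_vol TYPE('a) * d powr real DIM('a) / 2)"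
  have "hR (k0 / 2) \<le> hR k" using * k by (intro hR_mono) auto
  then have "Tail s p (neg_part w) x0 (4 * R) + Tail_a t q a (neg_part w) x0 (4 * R) \<le> ennreal (hR k)"
    using tails by (meson ennreal_leI order_trans)
  then show "emeasure lborel (sublevel w x0 r l)
     \<le> ennreal (2 * \<Lambda>\<^sup>2 * c_loss * (R / (\<rho> - r) * (k / (k - l))) powr q * (d / R) powr (s * p) * d powr real DIM('a))"
    using * k by (intro sublevel_step) auto
qed

definition c_init :: real where
  "c_init = 8 * \<Lambda>\<^sup>2 * c_loss * 3 powr real DIM('a) * 2 powr (q - 1) * 4 powr (real DIM('a) + t * q) / 2 powr real DIM('a)"

text \<open>Here \<open>g\<close> is the ratio of the level to the means.  The points of the superlevel set carry at least half of the
  mean powers, and for \<open>y\<close> among them \<open>w y - w x \<ge> w y / 2\<close>.  Since \<open>m = k / g\<close>, the gain carries the factor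
  \<open>g powr (1 - p)\<close> against the loss; the \<open>q\<close>-phase has an even better factor.\<close>

lemma initial_smallness:
  assumes m: "0 < m" and g: "0 < g" "g \<le> 1" and k: "k = g * m" "k \<le> M"
    and tails: "Tail s p (neg_part w) x0 (4 * R) + Tail_a t q a (neg_part w) x0 (4 * R) \<le> ennreal (hR k)"
    and Ip: "ennreal (ball_vol TYPE('a) * (2 * R) powr real DIM('a) * m powr (p - 1) / 2)
      \<le> (\<integral>\<^sup>+y\<in>{y \<in> ball x0 (2 * R). k \<le> w y}. ennreal (w y powr (p - 1)) \<partial>lborel)"
    and Iq: "ennreal (ball_vol TYPE('a) * (2 * R) powr real DIM('a) * m powr (q - 1) / 2)
      \<le> (\<integral>\<^sup>+y\<in>{y \<in> ball x0 (2 * R). k \<le> w y}. ennreal (w y powr (q - 1)) \<partial>lborel)"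
  shows "emeasure lborel (sublevel w x0 (2 * R) (k / 2)) \<le> ennreal (c_init * g powr (p - 1) * R powr real DIM('a))"
proof -
  define N V where "N = real DIM('a)" and "V = ball_vol TYPE('a)"
  have V: "0 < V" by (simp add: V_def)
  have kpos: "0 < k" using m g k by simp
  have sp: "0 \<le> s * p" "0 \<le> t * q" using exponents by auto
  define c0 where "c0 = 1 / 2 powr (q - 1) / 4 powr (N + t * q) * (V * 2 powr N / 2)"
  have c0: "0 < c0" using V by (simp add: c0_def)
  define Z where "Z = k / 2 * (c0 * (1 / g powr (p - 1)) * hR k)"
  have Z: "0 < Z" using kpos c0 g hR_pos[OF kpos] by (simp add: Z_def)
  let ?G = "{y \<in> B4. k \<le> w y}" and ?H = "{y \<in> ball x0 (2 * R). k \<le> w y}"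
  let ?I = "\<lambda>x y. (k - w x) * ((w y - w x) powr (p - 1) * riesz (s * p) x y + a_low * ((w y - w x) powr (q - 1) * riesz (t * q) x y))"
  have [measurable]: "?H \<in> sets borel" by measurable
  define J where "J e = (\<integral>\<^sup>+y\<in>?H. ennreal (w y powr (e - 1)) \<partial>lborel)" for e
  define b where "b e \<beta> = 1 / 2 powr (e - 1) / (4 * R) powr (N + \<beta>)" for e \<beta>
  have b0: "0 \<le> b e \<beta>" for e \<beta> by (simp add: b_def)
  have low: "c0 * (1 / g powr (p - 1)) * (k powr (e - 1) / R powr \<beta>)
     \<le> b e \<beta> * (V * (2 * R) powr N * m powr (e - 1) / 2)" if e: "p \<le> e" "e \<le> q" "\<beta> \<le> t * q" for e \<beta>
  proof -
    have "m powr (e - 1) = (k / g) powr (e - 1)" using k g by simp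
    also have "\<dots> = k powr (e - 1) * (1 / g powr (e - 1))" by (simp add: powr_divide)
    finally have me: "m powr (e - 1) = k powr (e - 1) * (1 / g powr (e - 1))" .
    have "g powr (e - 1) \<le> g powr (p - 1)" using g e by (intro powr_mono') auto
    then have ge: "1 / g powr (p - 1) \<le> 1 / g powr (e - 1)" using g by (intro divide_left_mono) auto
    have "2 powr (e - 1) \<le> 2 powr (q - 1)" using e by (intro powr_mono) auto
    then have e2: "1 / 2 powr (q - 1) \<le> 1 / 2 powr (e - 1)" by (intro divide_left_mono) auto
    have "4 powr (N + \<beta>) \<le> 4 powr (N + t * q)" using e by (intro powr_mono) auto
    then have e4: "1 / 4 powr (N + t * q) \<le> 1 / 4 powr (N + \<beta>)" by (intro divide_left_mono) auto
    have R1: "1 / (4 * R) powr (N + \<beta>) * (2 * R) powr N = 1 / 4 powr (N + \<beta>) * 2 powr N * (1 / R powr \<beta>)"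
      using R(1) by (simp add: powr_mult powr_add)
    have "c0 * (1 / g powr (p - 1)) * (k powr (e - 1) / R powr \<beta>)
       = (1 / 2 powr (q - 1)) * (1 / 4 powr (N + t * q)) * (1 / g powr (p - 1)) * (V / 2 * 2 powr N * (1 / R powr \<beta>) * k powr (e - 1))"
      by (simp add: c0_def)
    also have "\<dots> \<le> (1 / 2 powr (e - 1)) * (1 / 4 powr (N + \<beta>)) * (1 / g powr (e - 1)) * (V / 2 * 2 powr N * (1 / R powr \<beta>) * k powr (e - 1))"
      using V by (intro mult_right_mono mult_mono e2 e4 ge) auto
    also have "\<dots> = (1 / 2 powr (e - 1)) * (1 / 4 powr (N + \<beta>) * 2 powr N * (1 / R powr \<beta>)) * (V / 2) * (k powr (e - 1) * (1 / g powr (e - 1)))"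
      by (simp add: mult_ac)
    also have "\<dots> = b e \<beta> * (V * (2 * R) powr N * m powr (e - 1) / 2)"
      unfolding R1[symmetric] me[symmetric] b_def by (simp add: mult_ac)
    finally show ?thesis .
  qed
  have J: "ennreal (V * (2 * R) powr N * m powr (p - 1) / 2) \<le> J p" "ennreal (V * (2 * R) powr N * m powr (q - 1) / 2) \<le> J q"
    using Ip Iq by (auto simp: J_def V_def N_def)
  have inner: "ennreal Z \<le> (\<integral>\<^sup>+y\<in>?G. ennreal (?I x y) \<partial>lborel)" if x: "x \<in> sublevel w x0 (2 * R) (k / 2)" for x
  proof -
    have xk: "w x < k / 2" "x \<in> ball x0 (2 * R)" using x by (auto simp: sublevel_def)
    define z1 z2 where "z1 = k / 2 * b p (s * p)" and "z2 = k / 2 * (a_low * b q (t * q))"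
    have z: "0 \<le> z1" "0 \<le> z2" using kpos b0 a_low_nonneg by (auto simp: z1_def z2_def)
    have "Z = k / 2 * (c0 * (1 / g powr (p - 1)) * (k powr (p - 1) / R powr (s * p)) + a_low * (c0 * (1 / g powr (p - 1)) * (k powr (q - 1) / R powr (t * q))))"
      by (simp add: Z_def hR_def algebra_simps)
    also have "\<dots> \<le> k / 2 * (b p (s * p) * (V * (2 * R) powr N * m powr (p - 1) / 2) + a_low * (b q (t * q) * (V * (2 * R) powr N * m powr (q - 1) / 2)))"
      using kpos exponents a_low_nonneg sp_le_tq by (intro mult_left_mono add_mono low) auto
    also have "\<dots> = z1 * (V * (2 * R) powr N * m powr (p - 1) / 2) + z2 * (V * (2 * R) powr N * m powr (q - 1) / 2)"
      by (simp add: z1_def z2_def algebra_simps)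
    finally have "ennreal Z \<le> ennreal (z1 * (V * (2 * R) powr N * m powr (p - 1) / 2) + z2 * (V * (2 * R) powr N * m powr (q - 1) / 2))"
      by (rule ennreal_leI)
    also have "\<dots> = ennreal z1 * ennreal (V * (2 * R) powr N * m powr (p - 1) / 2) + ennreal z2 * ennreal (V * (2 * R) powr N * m powr (q - 1) / 2)"
      using z V by (subst ennreal_plus; (subst (1 2) ennreal_mult)?) auto
    also have "\<dots> \<le> ennreal z1 * J p + ennreal z2 * J q"
      by (intro add_mono mult_left_mono J) auto
    also have "\<dots> = (\<integral>\<^sup>+y. ennreal z1 * (ennreal (w y powr (p - 1)) * indicator ?H y) + ennreal z2 * (ennreal (w y powr (q - 1)) * indicator ?H y) \<partial>lborel)"
      unfolding J_def by (subst nn_integral_add) (auto simp: nn_integral_cmult)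
    also have "\<dots> \<le> (\<integral>\<^sup>+y\<in>?G. ennreal (?I x y) \<partial>lborel)"
    proof (intro nn_integral_mono)
      fix y
      show "ennreal z1 * (ennreal (w y powr (p - 1)) * indicator ?H y) + ennreal z2 * (ennreal (w y powr (q - 1)) * indicator ?H y)
        \<le> ennreal (?I x y) * indicator ?G y"
      proof (cases "y \<in> ?H")
        case True
        have y: "y \<in> ?G" using True R(1) by auto
        have wy: "k \<le> w y" "y \<in> ball x0 (2 * R)" using True by auto
        have xy: "x \<noteq> y" using wy xk kpos by auto
        have nm: "norm (x - y) \<le> 4 * R"
          using norm_triangle_ineq4[of "x - x0" "y - x0"] xk wy by (auto simp: dist_norm norm_minus_commute)
        have pw: "k / 2 * (b e \<beta> * w y powr (e - 1)) \<le> (k - w x) * ((w y - w x) powr (e - 1) * riesz \<beta> x y)"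
          if "1 < e" "0 \<le> \<beta>" for e \<beta>
        proof -
          have "b e \<beta> * w y powr (e - 1) = (w y / 2) powr (e - 1) * (1 / (4 * R) powr (N + \<beta>))"
            by (simp add: b_def powr_divide)
          also have "\<dots> \<le> (w y - w x) powr (e - 1) * riesz \<beta> x y"
            unfolding N_def using wy xk kpos that nm xy by (intro mult_mono powr_mono2 riesz_ge) auto
          finally have "b e \<beta> * w y powr (e - 1) \<le> (w y - w x) powr (e - 1) * riesz \<beta> x y" .
          then show ?thesis
            by (rule mult_mono[rotated]) (use xk kpos b0 in \<open>auto intro!: mult_nonneg_nonneg\<close>)
        qed
        have "z1 * w y powr (p - 1) \<le> (k - w x) * ((w y - w x) powr (p - 1) * riesz (s * p) x y)"
          using pw[of p "s * p"] exponents sp by (simp add: z1_def mult.assoc)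
        moreover have "z2 * w y powr (q - 1) \<le> a_low * ((k - w x) * ((w y - w x) powr (q - 1) * riesz (t * q) x y))"
          using mult_left_mono[OF pw[of q "t * q"] a_low_nonneg] exponents sp by (simp add: z2_def mult_ac)
        ultimately have "z1 * w y powr (p - 1) + z2 * w y powr (q - 1) \<le> ?I x y" by (simp add: algebra_simps)
        then have "ennreal (z1 * w y powr (p - 1) + z2 * w y powr (q - 1)) \<le> ennreal (?I x y)" by (rule ennreal_leI)
        moreover have "ennreal (z1 * w y powr (p - 1) + z2 * w y powr (q - 1)) = ennreal z1 * ennreal (w y powr (p - 1)) + ennreal z2 * ennreal (w y powr (q - 1))"
          using z by (simp add: ennreal_mult)
        ultimately show ?thesis using True y by (simp only: indicator_simps mult_1_right)
      qed simp
    qed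
    finally show ?thesis .
  qed
  have "ennreal Z * emeasure lborel (sublevel w x0 (2 * R) (k / 2))
      \<le> (\<integral>\<^sup>+x\<in>{x \<in> ball x0 (2 * R). w x < k}. (\<integral>\<^sup>+y\<in>?G. ennreal (?I x y) \<partial>lborel) \<partial>lborel)"
  proof (rule cmult_emeasure_le_nn_integral)
    show "sublevel w x0 (2 * R) (k / 2) \<subseteq> {x \<in> ball x0 (2 * R). w x < k}"
      using kpos by (auto simp: sublevel_def)
  qed (use inner in auto)
  also have "\<dots> \<le> ennreal (2 * \<Lambda>\<^sup>2 * c_loss * (R / (3 * R - 2 * R)) powr q * (k * hR k)) * emeasure lborel {x \<in> ball x0 (3 * R). w x < k}"
    using R(1) kpos k by (intro sublevel_estimate tails) auto
  also have "\<dots> \<le> ennreal (2 * \<Lambda>\<^sup>2 * c_loss * (k * hR k)) * ennreal (V * (3 * R) powr N)"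
  proof (intro mult_mono)
    have "emeasure lborel {x \<in> ball x0 (3 * R). w x < k} \<le> emeasure lborel (ball x0 (3 * R))"
      by (intro emeasure_mono) auto
    also have "\<dots> = ennreal (V * (3 * R) powr N)"
      unfolding V_def N_def using R(1) by (intro emeasure_lborel_ball_powr) simp
    finally show "emeasure lborel {x \<in> ball x0 (3 * R). w x < k} \<le> ennreal (V * (3 * R) powr N)" .
  qed (use R(1) in simp_all)
  also have "\<dots> = ennreal (2 * \<Lambda>\<^sup>2 * c_loss * (k * hR k) * (V * (3 * R) powr N))"
    using c_loss_nonneg kpos hR_nonneg V by (intro ennreal_mult[symmetric]) auto
  finally have "emeasure lborel (sublevel w x0 (2 * R) (k / 2))
     \<le> ennreal (2 * \<Lambda>\<^sup>2 * c_loss * (k * hR k) * (V * (3 * R) powr N) / Z)"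
    using Z c_loss_nonneg kpos hR_nonneg V by (intro ennreal_le_divide_of_mult_le) auto
  also have "2 * \<Lambda>\<^sup>2 * c_loss * (k * hR k) * (V * (3 * R) powr N) / Z = c_init * g powr (p - 1) * R powr N"
  proof -
    have cancel: "2 * X * (k * L) * (V * (T * Rn)) / (k / 2 * ((1 / a / b * (V * h / 2)) * (1 / G) * L))
       = 8 * X * T * a * b / h * G * Rn" if "0 < a" "0 < b" "0 < h" "0 < L" "0 < G" for a b h L G T X Rn :: real
      using that V kpos by (simp add: field_simps)
    show ?thesis
      unfolding Z_def c_init_def c0_def N_def[symmetric]
      using cancel[of "2 powr (q - 1)" "4 powr (N + t * q)" "2 powr N" "hR k" "g powr (p - 1)" "\<Lambda>\<^sup>2 * c_loss" "3 powr N" "R powr N"]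
        hR_pos[OF kpos] g by (simp add: powr_mult mult.assoc)
  qed
  finally show ?thesis by (simp add: N_def)
qed

end

section \<open>Lower bounds with constants depending on the data\<close>

lemma exists_small_powr:
  fixes \<delta> e :: real
  assumes "0 < \<delta>" "0 < e"
  shows "\<exists>g. 0 < g \<and> g < 1 \<and> g powr e \<le> \<delta>"
proof (intro exI[of _ "min (1 / 2) (\<delta> powr (1 / e))"] conjI)
  have "min (1 / 2) (\<delta> powr (1 / e)) powr e \<le> (\<delta> powr (1 / e)) powr e"
    using assms by (intro powr_mono2) auto
  also have "\<dots> = \<delta>" using assms by (simp add: powr_powr)
  finally show "min (1 / 2) (\<delta> powr (1 / e)) powr e \<le> \<delta>" .
qed (use assms in auto)

text \<open>The \<open>e\<close>-mean over the ball, \<open>(average of w powr e) powr (1 / e)\<close>, is at least \<open>m\<close>.\<close>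

definition power_mean_ge :: "('a::euclidean_space \<Rightarrow> real) \<Rightarrow> 'a \<Rightarrow> real \<Rightarrow> real \<Rightarrow> real \<Rightarrow> bool" where
  "power_mean_ge w x0 r e m \<longleftrightarrow>
     ennreal (ball_vol TYPE('a) * r powr real DIM('a) * m powr e) \<le> (\<integral>\<^sup>+x\<in>ball x0 r. ennreal (w x powr e) \<partial>lborel)"

lemma power_mean_ge_superlevel:
  fixes w :: "'a::euclidean_space \<Rightarrow> real"
  assumes "w \<in> borel_measurable borel" "0 < r" "\<And>x. x \<in> ball x0 r \<Longrightarrow> 0 \<le> w x" "0 \<le> e"
    "power_mean_ge w x0 r e m" "k powr e \<le> m powr e / 2"
  shows "ennreal (ball_vol TYPE('a) * r powr real DIM('a) * m powr e / 2)
    \<le> (\<integral>\<^sup>+x\<in>{x \<in> ball x0 r. k \<le> w x}. ennreal (w x powr e) \<partial>lborel)"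
  using assms
  by (intro superlevel_power_integral emeasure_lborel_ball_powr) (auto simp: power_mean_ge_def)

context nonneg_minimizer
begin

lemma h_fun_le_hR: "h_fun s t p q a x0 (4 * R) k \<le> hR k"
proof -
  have "1 / (4 * R) powr b \<le> 1 / R powr b" if "0 \<le> b" for b
    using R(1) that by (intro divide_left_mono powr_mono2 mult_pos_pos) auto
  from mult_left_mono[OF this, of _ "k powr (p - 1)"] mult_left_mono[OF this, of _ "k powr (q - 1)"]
  have "k powr (p - 1) / (4 * R) powr (s * p) \<le> k powr (p - 1) / R powr (s * p)"
    "k powr (q - 1) / (4 * R) powr (t * q) \<le> k powr (q - 1) / R powr (t * q)"
    using exponents by auto
  then show ?thesis
    unfolding h_fun_def hR_def a_low_def[symmetric] using a_low_nonneg by (intro add_mono mult_left_mono) auto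
qed

end

text \<open>The levels are \<open>k = g * m\<close> for the initial estimate, \<open>k / 2\<close> where the iteration starts and \<open>k / 4\<close> where it
  ends; hence \<open>\<gamma> = g / 4\<close>, and it suffices to control the tails at the lowest level.\<close>

lemma lower_bound_of_level_bound:
  fixes s t p q \<Lambda> \<alpha> A M :: real
  assumes ex: "0 < s" "s \<le> t" "t < 1" "1 < p" "p \<le> q" "1 \<le> \<Lambda>"
    "0 < \<alpha>" "\<alpha> \<le> 1" "0 \<le> A" "\<alpha> < t * q" "t * q \<le> s * p + \<alpha>" and M: "0 \<le> M"
  shows "\<exists>\<gamma>. 0 < \<gamma> \<and> \<gamma> < 1 \<and> (\<forall>(\<Omega> :: 'a::euclidean_space set) Ksp Ktq a w x0 R m.
     nonneg_minimizer s t p q \<Lambda> \<alpha> A \<Omega> Ksp Ktq a w x0 R \<longrightarrow> 0 < m \<longrightarrow> m \<le> M \<longrightarrow>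
     power_mean_ge w x0 (2 * R) (p - 1) m \<longrightarrow> power_mean_ge w x0 (2 * R) (q - 1) m \<longrightarrow>
     Tail s p (neg_part w) x0 (4 * R) + Tail_a t q a (neg_part w) x0 (4 * R)
       \<le> ennreal (h_fun s t p q a x0 (4 * R) (\<gamma> * m)) \<longrightarrow>
     emeasure lborel (sublevel w x0 R (\<gamma> * m)) = 0)"
proof -
  have sp: "0 < s * p" "s * p < p" "0 < t * q" "t * q < q" "0 < t * q - \<alpha>" "t * q - \<alpha> < q"
  proof -
    show 1: "s * p < p" "t * q < q" "0 < s * p" "0 < t * q" using ex by auto
    show "0 < t * q - \<alpha>" "t * q - \<alpha> < q" using 1(2) ex(7,10) by linarith+
  qed
  from truncated_riesz_integral[OF sp(1,2), where 'a = 'a]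
  obtain C1 where C1: "C1 > 0" "\<forall>R>0. \<forall>x::'a.
     (\<integral>\<^sup>+y. ennreal (min 1 (norm (x - y) / R) powr p * riesz (s * p) x y) \<partial>lborel) \<le> ennreal (C1 / R powr (s * p))"
    by (elim exE conjE)
  from truncated_riesz_integral[OF sp(3,4), where 'a = 'a]
  obtain C2 where C2: "C2 > 0" "\<forall>R>0. \<forall>x::'a.
     (\<integral>\<^sup>+y. ennreal (min 1 (norm (x - y) / R) powr q * riesz (t * q) x y) \<partial>lborel) \<le> ennreal (C2 / R powr (t * q))"
    by (elim exE conjE)
  from truncated_riesz_integral[OF sp(5,6), where 'a = 'a]
  obtain C3 where C3: "C3 > 0" "\<forall>R>0. \<forall>x::'a.
     (\<integral>\<^sup>+y. ennreal (min 1 (norm (x - y) / R) powr q * riesz (t * q - \<alpha>) x y) \<partial>lborel) \<le> ennreal (C3 / R powr (t * q - \<alpha>))"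
    by (elim exE conjE)
  define C where "C = max C1 (max C2 C3)"
  \<comment> \<open>\<open>cl\<close> and \<open>ci\<close> are \<open>c_loss\<close> and \<open>c_init\<close>, written out before a minimizer or a ball is chosen.\<close>
  define cl where "cl = (1 + q * 2 powr q) * (C + 64 * A * C * M powr (q - p)) + q * 2 powr q * 4 powr (real DIM('a) + t * q)"
  define ci where "ci = 8 * \<Lambda>\<^sup>2 * cl * 3 powr real DIM('a) * 2 powr (q - 1) * 4 powr (real DIM('a) + t * q) / 2 powr real DIM('a)"
  have C0: "0 \<le> C" using C1 by (simp add: C_def)
  have cl0: "0 \<le> cl" using C0 ex by (simp add: cl_def)
  have ci0: "0 \<le> ci" using cl0 by (simp add: ci_def)
  have "0 \<le> 2 * \<Lambda>\<^sup>2 * cl" "0 \<le> q" using cl0 ex by auto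
  from degiorgi_iteration[OF this sp(1), where 'a = 'a]
  obtain \<epsilon> where \<epsilon>: "\<epsilon> > 0" "\<And>w (x0::'a) R k0. w \<in> borel_measurable borel \<Longrightarrow> 0 < R \<Longrightarrow> 0 < k0 \<Longrightarrow>
      degiorgi_decay (2 * \<Lambda>\<^sup>2 * cl) q (s * p) w x0 R k0 \<Longrightarrow>
      emeasure lborel (sublevel w x0 (2 * R) k0) \<le> ennreal (\<epsilon> * R powr real DIM('a)) \<Longrightarrow>
      emeasure lborel (sublevel w x0 R (k0 / 2)) = 0"
    by blast
  have "0 < min (1 / 2) (\<epsilon> / (ci + 1))" "0 < p - 1" using \<epsilon>(1) ci0 ex by auto
  from exists_small_powr[OF this] obtain g where g: "0 < g" "g < 1" "g powr (p - 1) \<le> min (1 / 2) (\<epsilon> / (ci + 1))"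
    by blast
  have gp: "g powr (p - 1) \<le> 1 / 2" "g powr (p - 1) \<le> \<epsilon> / (ci + 1)" using g(3) by auto
  have "g powr (q - 1) \<le> g powr (p - 1)" using g ex by (intro powr_mono') auto
  then have gq: "g powr (q - 1) \<le> 1 / 2" using gp by simp
  have gi: "ci * g powr (p - 1) \<le> \<epsilon>"
  proof -
    have "ci * g powr (p - 1) \<le> (ci + 1) * g powr (p - 1)" by (intro mult_right_mono) auto
    also have "\<dots> \<le> (ci + 1) * (\<epsilon> / (ci + 1))" using gp ci0 by (intro mult_left_mono) auto
    finally show ?thesis using ci0 by simp
  qed
  show ?thesis
  proof (intro exI[of _ "g / 4"] conjI allI impI)
    fix \<Omega> :: "'a set" and Ksp Ktq a w x0 R m
    assume nm: "nonneg_minimizer s t p q \<Lambda> \<alpha> A \<Omega> Ksp Ktq a w x0 R" and m: "0 < m" "m \<le> M"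
      and means: "power_mean_ge w x0 (2 * R) (p - 1) m" "power_mean_ge w x0 (2 * R) (q - 1) m"
      and tails: "Tail s p (neg_part w) x0 (4 * R) + Tail_a t q a (neg_part w) x0 (4 * R)
       \<le> ennreal (h_fun s t p q a x0 (4 * R) (g / 4 * m))"
    interpret nonneg_minimizer s t p q \<Lambda> \<alpha> A \<Omega> Ksp Ktq a w x0 R by (rule nm)
    have C_le: "ennreal (C' / R powr b) \<le> ennreal (C / R powr b)" if "C' \<le> C" for C' b
      using that by (intro ennreal_leI divide_right_mono) auto
    interpret nonneg_minimizer_bounds s t p q \<Lambda> \<alpha> A \<Omega> Ksp Ktq a w x0 R C M
    proof unfold_locales
      fix x :: 'a
      show "(\<integral>\<^sup>+y. ennreal (min 1 (norm (x - y) / R) powr p * riesz (s * p) x y) \<partial>lborel) \<le> ennreal (C / R powr (s * p))"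
        using C1(2)[rule_format, OF R(1)] C_le[of C1] by (rule order_trans) (simp add: C_def)
      show "(\<integral>\<^sup>+y. ennreal (min 1 (norm (x - y) / R) powr q * riesz (t * q) x y) \<partial>lborel) \<le> ennreal (C / R powr (t * q))"
        using C2(2)[rule_format, OF R(1)] C_le[of C2] by (rule order_trans) (simp add: C_def)
      show "(\<integral>\<^sup>+y. ennreal (min 1 (norm (x - y) / R) powr q * riesz (t * q - \<alpha>) x y) \<partial>lborel) \<le> ennreal (C / R powr (t * q - \<alpha>))"
        using C3(2)[rule_format, OF R(1)] C_le[of C3] by (rule order_trans) (simp add: C_def)
    qed (use C0 M in auto)
    have cc: "c_loss = cl" "c_init = ci"
      by (simp_all add: c_loss_def cl_def c_init_def ci_def)
    define k where "k = g * m"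
    have k: "0 < k" "k \<le> M" "k = g * m"
      using g(1,2) m order_trans[OF mult_left_le_one_le[of m g] m(2)] by (auto simp: k_def)
    have "ennreal (h_fun s t p q a x0 (4 * R) (g / 4 * m)) \<le> ennreal (hR (k / 4))"
      using h_fun_le_hR[of "k / 4"] by (intro ennreal_leI) (simp add: k_def)
    also have lv: "hR (k / 4) \<le> hR k'" if "k / 4 \<le> k'" for k' using k that by (intro hR_mono) auto
    finally have tl: "Tail s p (neg_part w) x0 (4 * R) + Tail_a t q a (neg_part w) x0 (4 * R) \<le> ennreal (hR k')"
      if "k / 4 \<le> k'" for k'
      using tails that by (meson ennreal_leI lv order_trans)
    have kp: "k powr e \<le> m powr e / 2" if "g powr e \<le> 1 / 2" for e
      using mult_right_mono[OF that, of "m powr e"] by (simp add: k_def powr_mult)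
    have nn: "\<And>x. x \<in> ball x0 (2 * R) \<Longrightarrow> 0 \<le> w x" using w_nonneg R(1) by auto
    have "emeasure lborel (sublevel w x0 (2 * R) (k / 2)) \<le> ennreal (c_init * g powr (p - 1) * R powr real DIM('a))"
      using m g k R(1) ex
      by (intro initial_smallness[OF _ _ _ k(3)] tl power_mean_ge_superlevel means kp gp gq nn) auto
    also have "\<dots> \<le> ennreal (\<epsilon> * R powr real DIM('a))"
      unfolding cc by (intro ennreal_leI mult_right_mono gi) auto
    finally have small: "emeasure lborel (sublevel w x0 (2 * R) (k / 2)) \<le> ennreal (\<epsilon> * R powr real DIM('a))" .
    have "degiorgi_decay (2 * \<Lambda>\<^sup>2 * c_loss) q (s * p) w x0 R (k / 2)"
      using k tl[of "k / 4"] by (intro minimizer_degiorgi_decay) auto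
    then have "emeasure lborel (sublevel w x0 R (k / 2 / 2)) = 0"
      unfolding cc using small k R(1) by (intro \<epsilon>(2)) auto
    then show "emeasure lborel (sublevel w x0 R (g / 4 * m)) = 0" by (simp add: k_def)
  qed (use g in auto)
qed

text \<open>For \<open>\<sigma> > n\<close> functions of finite Gagliardo energy are Hoelder continuous.  The quantitative part that matters
  here follows from the same iteration: the energy bounds the measure of a sublevel set times
  \<open>d powr - \<sigma>\<close>, and \<open>d powr \<sigma> = d powr n * d powr (\<sigma> - n)\<close> has decay to spare.  \<open>R \<le> 1\<close> lets the
  surplus powers of \<open>R\<close> be dropped.\<close>

lemma lower_bound_of_gagliardo:
  fixes \<sigma> p :: real
  assumes p: "1 < p" and \<sigma>: "real DIM('a::euclidean_space) < \<sigma>"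
  shows "\<exists>g. 0 < g \<and> g < 1 \<and> (\<forall>(w :: 'a \<Rightarrow> real) x0 R M m.
    w \<in> borel_measurable borel \<longrightarrow> 0 < R \<longrightarrow> R \<le> 1 \<longrightarrow> (\<forall>x\<in>ball x0 (4 * R). 0 \<le> w x) \<longrightarrow>
    (\<integral>\<^sup>+x\<in>ball x0 (4 * R). (\<integral>\<^sup>+y\<in>ball x0 (4 * R). ennreal (\<bar>w x - w y\<bar> powr p * riesz \<sigma> x y) \<partial>lborel) \<partial>lborel)
      \<le> ennreal (M powr p) \<longrightarrow>
    0 < m \<longrightarrow> 0 \<le> M \<longrightarrow> M \<le> g * m \<longrightarrow> power_mean_ge w x0 (2 * R) (p - 1) m \<longrightarrow>
    emeasure lborel (sublevel w x0 R (g * m / 2)) = 0)"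
proof -
  define N V where "N = real DIM('a)" and "V = ball_vol TYPE('a)"
  have N: "0 < N" "N < \<sigma>" and V: "0 < V" using \<sigma> by (auto simp: N_def V_def)
  define C where "C = 2 * 2 powr p / V"
  define c where "c = 2 * 2 powr (p - 1) * 4 powr (N + \<sigma>) / (V * 2 powr N)"
  have c: "0 < c" using V by (simp add: c_def)
  have "0 \<le> C" "0 \<le> p" "0 < \<sigma> - N" using V p N by (auto simp: C_def)
  from degiorgi_iteration[OF this, where 'a = 'a]
  obtain \<epsilon> where \<epsilon>: "\<epsilon> > 0" "\<And>w (x0::'a) R k0. w \<in> borel_measurable borel \<Longrightarrow> 0 < R \<Longrightarrow> 0 < k0 \<Longrightarrow>
      degiorgi_decay C p (\<sigma> - N) w x0 R k0 \<Longrightarrow>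
      emeasure lborel (sublevel w x0 (2 * R) k0) \<le> ennreal (\<epsilon> * R powr real DIM('a)) \<Longrightarrow>
      emeasure lborel (sublevel w x0 R (k0 / 2)) = 0"
    by blast
  have "0 < min (1 / 2 / 2 powr (p - 1)) (\<epsilon> / c)" "0 < p - 1" using \<epsilon>(1) c p by auto
  from exists_small_powr[OF this] obtain g where g: "0 < g" "g < 1"
    "g powr (p - 1) \<le> min (1 / 2 / 2 powr (p - 1)) (\<epsilon> / c)"
    by blast
  have g2: "2 powr (p - 1) * g powr (p - 1) \<le> 1 / 2" and gc: "c * g powr (p - 1) \<le> \<epsilon>"
    using g(3) c by (auto simp: field_simps)
  show ?thesis
  proof (intro exI[of _ g] conjI allI impI g)
    fix w :: "'a \<Rightarrow> real" and x0 R M m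
    assume w [measurable]: "w \<in> borel_measurable borel" and R: "0 < R" "R \<le> 1"
      and nn: "\<forall>x\<in>ball x0 (4 * R). 0 \<le> w x"
      and E: "(\<integral>\<^sup>+x\<in>ball x0 (4 * R). (\<integral>\<^sup>+y\<in>ball x0 (4 * R). ennreal (\<bar>w x - w y\<bar> powr p * riesz \<sigma> x y) \<partial>lborel) \<partial>lborel)
      \<le> ennreal (M powr p)"
      and m: "0 < m" and M: "0 \<le> M" "M \<le> g * m" and mean: "power_mean_ge w x0 (2 * R) (p - 1) m"
    define k0 where "k0 = g * m"
    have k0: "0 < k0" "M \<le> k0" using g m M by (auto simp: k0_def)
    let ?F = "\<lambda>x. \<integral>\<^sup>+y\<in>ball x0 (4 * R). ennreal (\<bar>w x - w y\<bar> powr p * riesz \<sigma> x y) \<partial>lborel"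
    have decay: "degiorgi_decay C p (\<sigma> - N) w x0 R k0"
      unfolding degiorgi_decay_def
    proof (intro allI impI, elim conjE)
      fix r \<rho> l k d
      assume *: "R \<le> r" "r < \<rho>" "\<rho> \<le> 2 * R" "k0 / 2 \<le> l" "l < k" "k \<le> k0" "0 < d" "d \<le> \<rho> - r"
        "emeasure lborel (sublevel w x0 \<rho> k) \<le> ennreal (ball_vol TYPE('a) * d powr real DIM('a) / 2)"
      have kpos: "0 < k" "M \<le> 2 * k" using * k0 by linarith+
      let ?G = "{y \<in> ball x0 (4 * R). k \<le> w y}"
      have [measurable]: "?G \<in> sets borel" by measurable
      have inner: "ennreal ((k - l) powr p * (V / 2 / d powr \<sigma>)) \<le> ?F x" if x: "x \<in> sublevel w x0 r l" for x
      proof -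
        have xd: "x \<in> ball x0 r" "w x < l" using x by (auto simp: sublevel_def)
        have "ball x d - sublevel w x0 \<rho> k \<subseteq> ?G"
        proof
          fix y assume y: "y \<in> ball x d - sublevel w x0 \<rho> k"
          have "dist x0 y \<le> dist x0 x + dist x y" by (rule dist_triangle)
          then have "dist x0 y < \<rho>" using y xd * by (auto simp: dist_commute)
          then show "y \<in> ?G" using y * R(1) by (auto simp: sublevel_def)
        qed
        then have K: "ennreal (V / 2 / d powr \<sigma>) \<le> (\<integral>\<^sup>+y\<in>?G. ennreal (riesz \<sigma> x y) \<partial>lborel)"
          unfolding V_def using * N by (intro riesz_integral_ge_off_small_set[where E = "sublevel w x0 \<rho> k"]) auto
        have "ennreal ((k - l) powr p * (V / 2 / d powr \<sigma>)) = ennreal ((k - l) powr p) * ennreal (V / 2 / d powr \<sigma>)"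
          using V by (intro ennreal_mult) auto
        also have "\<dots> \<le> ennreal ((k - l) powr p) * (\<integral>\<^sup>+y\<in>?G. ennreal (riesz \<sigma> x y) \<partial>lborel)"
          by (intro mult_left_mono K) auto
        also have "\<dots> = (\<integral>\<^sup>+y. ennreal ((k - l) powr p) * (ennreal (riesz \<sigma> x y) * indicator ?G y) \<partial>lborel)"
          by (simp add: nn_integral_cmult)
        also have "\<dots> \<le> ?F x"
        proof (intro nn_integral_mono)
          fix y
          show "ennreal ((k - l) powr p) * (ennreal (riesz \<sigma> x y) * indicator ?G y)
            \<le> ennreal (\<bar>w x - w y\<bar> powr p * riesz \<sigma> x y) * indicator (ball x0 (4 * R)) y"
          proof (cases "y \<in> ?G")
            case True
            then have "(k - l) powr p * riesz \<sigma> x y \<le> \<bar>w x - w y\<bar> powr p * riesz \<sigma> x y"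
              using xd * p by (intro mult_right_mono powr_mono2) auto
            then show ?thesis using True by (simp add: ennreal_mult[symmetric] ennreal_leI)
          qed simp
        qed
        finally show ?thesis .
      qed
      have "sublevel w x0 r l \<subseteq> ball x0 (4 * R)" using * R(1) by (auto simp: sublevel_def)
      then have "ennreal ((k - l) powr p * (V / 2 / d powr \<sigma>)) * emeasure lborel (sublevel w x0 r l)
          \<le> (\<integral>\<^sup>+x\<in>ball x0 (4 * R). ?F x \<partial>lborel)"
        using inner by (intro cmult_emeasure_le_nn_integral) auto
      also note E
      finally have "emeasure lborel (sublevel w x0 r l) \<le> ennreal (M powr p / ((k - l) powr p * (V / 2 / d powr \<sigma>)))"
        using * V by (intro ennreal_le_divide_of_mult_le) auto
      also have "\<dots> \<le> ennreal (C * (R / (\<rho> - r) * (k / (k - l))) powr p * (d / R) powr (\<sigma> - N) * d powr N)"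
      proof (rule ennreal_leI)
        have D: "1 \<le> R / (\<rho> - r)" using * by simp
        have "M powr p / (k - l) powr p = (M / (k - l)) powr p" using * M by (simp add: powr_divide)
        also have "\<dots> \<le> (2 * (R / (\<rho> - r) * (k / (k - l)))) powr p"
        proof (rule powr_mono2)
          have "M / (k - l) \<le> 2 * (1 * (k / (k - l)))"
            using kpos * by (simp add: divide_right_mono)
          also have "\<dots> \<le> 2 * (R / (\<rho> - r) * (k / (k - l)))"
            using D kpos * by (intro mult_left_mono mult_right_mono) auto
          finally show "M / (k - l) \<le> 2 * (R / (\<rho> - r) * (k / (k - l)))" .
        qed (use p M * in auto)
        also have "\<dots> = 2 powr p * (R / (\<rho> - r) * (k / (k - l))) powr p" by (rule powr_mult)
        finally have a1: "M powr p / (k - l) powr p \<le> 2 powr p * (R / (\<rho> - r) * (k / (k - l))) powr p" .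
        have "d powr (\<sigma> - N) \<le> (d / R) powr (\<sigma> - N)"
          using * R N by (intro powr_mono2) (auto simp: field_simps mult_left_le)
        then have a2: "d powr \<sigma> \<le> (d / R) powr (\<sigma> - N) * d powr N"
          using * mult_right_mono[of "d powr (\<sigma> - N)" "(d / R) powr (\<sigma> - N)" "d powr N"]
          by (simp add: powr_add[symmetric])
        have "M powr p / ((k - l) powr p * (V / 2 / d powr \<sigma>)) = 2 / V * (M powr p / (k - l) powr p) * d powr \<sigma>"
          using * V by (simp add: field_simps)
        also have "\<dots> \<le> 2 / V * (2 powr p * (R / (\<rho> - r) * (k / (k - l))) powr p) * ((d / R) powr (\<sigma> - N) * d powr N)"
          using V by (intro mult_mono a1 a2 mult_left_mono) auto
        also have "\<dots> = C * (R / (\<rho> - r) * (k / (k - l))) powr p * (d / R) powr (\<sigma> - N) * d powr N"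
          by (simp add: C_def mult_ac)
        finally show "M powr p / ((k - l) powr p * (V / 2 / d powr \<sigma>))
          \<le> C * (R / (\<rho> - r) * (k / (k - l))) powr p * (d / R) powr (\<sigma> - N) * d powr N" .
      qed
      finally show "emeasure lborel (sublevel w x0 r l)
        \<le> ennreal (C * (R / (\<rho> - r) * (k / (k - l))) powr p * (d / R) powr (\<sigma> - N) * d powr real DIM('a))"
        by (simp add: N_def)
    qed
    have small: "emeasure lborel (sublevel w x0 (2 * R) k0) \<le> ennreal (\<epsilon> * R powr real DIM('a))"
    proof -
      let ?H = "{y \<in> ball x0 (2 * R). 2 * k0 \<le> w y}"
      have [measurable]: "?H \<in> sets borel" by measurable
      define b where "b = k0 / 2 powr (p - 1) / (4 * R) powr (N + \<sigma>)"
      have b: "0 < b" using k0 R by (simp add: b_def)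
      have "(2 * k0) powr (p - 1) \<le> m powr (p - 1) / 2"
        using mult_right_mono[OF g2, of "m powr (p - 1)"] by (simp add: k0_def powr_mult mult_ac)
      then have J: "ennreal (V * (2 * R) powr N * m powr (p - 1) / 2) \<le> (\<integral>\<^sup>+y\<in>?H. ennreal (w y powr (p - 1)) \<partial>lborel)"
        unfolding V_def N_def using nn R(1) p by (intro power_mean_ge_superlevel mean) auto
      define Z where "Z = b * (V * (2 * R) powr N * m powr (p - 1) / 2)"
      have Z: "0 < Z" using b V R m by (simp add: Z_def)
      have inner: "ennreal Z \<le> ?F x" if x: "x \<in> sublevel w x0 (2 * R) k0" for x
      proof -
        have xk: "w x < k0" "x \<in> ball x0 (2 * R)" using x by (auto simp: sublevel_def)
        have "ennreal Z = ennreal b * ennreal (V * (2 * R) powr N * m powr (p - 1) / 2)"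
          unfolding Z_def using b V by (intro ennreal_mult) auto
        also have "\<dots> \<le> ennreal b * (\<integral>\<^sup>+y\<in>?H. ennreal (w y powr (p - 1)) \<partial>lborel)"
          by (intro mult_left_mono J) auto
        also have "\<dots> = (\<integral>\<^sup>+y. ennreal b * (ennreal (w y powr (p - 1)) * indicator ?H y) \<partial>lborel)"
          by (simp add: nn_integral_cmult)
        also have "\<dots> \<le> ?F x"
        proof (intro nn_integral_mono)
          fix y
          show "ennreal b * (ennreal (w y powr (p - 1)) * indicator ?H y)
            \<le> ennreal (\<bar>w x - w y\<bar> powr p * riesz \<sigma> x y) * indicator (ball x0 (4 * R)) y"
          proof (cases "y \<in> ?H")
            case True
            then have wy: "2 * k0 \<le> w y" "y \<in> ball x0 (2 * R)" "y \<in> ball x0 (4 * R)" using R(1) by auto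
            have xy: "x \<noteq> y" using wy xk k0 by auto
            have nm: "norm (x - y) \<le> 4 * R"
              using norm_triangle_ineq4[of "x - x0" "y - x0"] xk wy by (auto simp: dist_norm norm_minus_commute)
            have "k0 * (w y / 2) powr (p - 1) \<le> (w y / 2) * (w y / 2) powr (p - 1)"
              using wy by (intro mult_right_mono) auto
            also have "\<dots> = (w y / 2) powr p" using wy k0 powr_mult_base[of "w y / 2" "p - 1"] by simp
            also have "\<dots> \<le> \<bar>w x - w y\<bar> powr p" using wy xk k0 p by (intro powr_mono2) auto
            finally have "k0 * (w y / 2) powr (p - 1) * (1 / (4 * R) powr (N + \<sigma>)) \<le> \<bar>w x - w y\<bar> powr p * riesz \<sigma> x y"
              unfolding N_def using xy nm N by (intro mult_mono riesz_ge) auto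
            moreover have "k0 * (w y / 2) powr (p - 1) * (1 / (4 * R) powr (N + \<sigma>)) = b * w y powr (p - 1)"
              by (simp add: b_def powr_divide)
            ultimately have "b * w y powr (p - 1) \<le> \<bar>w x - w y\<bar> powr p * riesz \<sigma> x y" by simp
            then have "ennreal (b * w y powr (p - 1)) \<le> ennreal (\<bar>w x - w y\<bar> powr p * riesz \<sigma> x y)" by (rule ennreal_leI)
            moreover have "ennreal (b * w y powr (p - 1)) = ennreal b * ennreal (w y powr (p - 1))"
              using b by (intro ennreal_mult) auto
            ultimately show ?thesis using True wy(3) by (simp only: indicator_simps mult_1_right)
          qed simp
        qed
        finally show ?thesis .
      qed
      have "sublevel w x0 (2 * R) k0 \<subseteq> ball x0 (4 * R)" using R(1) by (auto simp: sublevel_def)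
      then have "ennreal Z * emeasure lborel (sublevel w x0 (2 * R) k0) \<le> (\<integral>\<^sup>+x\<in>ball x0 (4 * R). ?F x \<partial>lborel)"
        using inner by (intro cmult_emeasure_le_nn_integral) auto
      also note E
      finally have "emeasure lborel (sublevel w x0 (2 * R) k0) \<le> ennreal (M powr p / Z)"
        using Z by (intro ennreal_le_divide_of_mult_le) auto
      also have "\<dots> \<le> ennreal (\<epsilon> * R powr N)"
      proof (rule ennreal_leI)
        have kk: "k0 powr p = k0 * (g powr (p - 1) * m powr (p - 1))"
          using k0 by (simp add: k0_def powr_mult[symmetric] powr_mult_base)
        have "M powr p \<le> k0 powr p" using k0 M p by (intro powr_mono2) auto
        then have "M powr p / Z \<le> k0 * (g powr (p - 1) * m powr (p - 1)) / Z"
          unfolding kk using Z by (intro divide_right_mono) auto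
        also have "\<dots> = c * g powr (p - 1) * R powr \<sigma>"
        proof -
          have cancel: "k0 * (G * m') / (k0 / a / (b' * (Rn * Rs)) * (V * (h * Rn) * m' / 2)) = 2 * a * b' / (V * h) * G * Rs"
            if "0 < m'" "0 < a" "0 < b'" "0 < Rn" "0 < Rs" "0 < h" for G m' a b' Rn Rs h :: real
            using that V k0 by (simp add: field_simps)
          show ?thesis
            unfolding Z_def b_def c_def powr_mult powr_add[of R]
            by (rule cancel) (use m R in auto)
        qed
        also have "\<dots> \<le> \<epsilon> * R powr N"
          using gc R N \<epsilon>(1) by (intro mult_mono powr_mono') auto
        finally show "M powr p / Z \<le> \<epsilon> * R powr N" .
      qed
      finally show ?thesis by (simp add: N_def)
    qed
    show "emeasure lborel (sublevel w x0 R (g * m / 2)) = 0"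
      using \<epsilon>(2)[OF w R(1) k0(1) decay small] by (simp add: k0_def)
  qed
qed

section \<open>Passage to a Borel representative and the final estimate\<close>

lemma energy_cong_AE:
  assumes "AE x in lebesgue. u x = w x"
  shows "energy p q K1 K2 a \<Omega> u = energy p q K1 K2 a \<Omega> w"
  unfolding energy_eq_indicator
  by (intro nn_integral_cong_AE, use AE_lebesgue_pair[OF assms] in eventually_elim) simp

lemma minimizer_cong_AE:
  assumes ae: "AE x in lebesgue. u x = w x" and [measurable]: "w \<in> borel_measurable lebesgue"
    and u: "minimizer s t p q Ksp Ktq a \<Omega> u"
  shows "minimizer s t p q Ksp Ktq a \<Omega> w"
proof -
  have "(\<integral>\<^sup>+ x \<in> \<Omega>. ennreal (\<bar>w x\<bar> powr p) \<partial>lebesgue) = (\<integral>\<^sup>+ x \<in> \<Omega>. ennreal (\<bar>u x\<bar> powr p) \<partial>lebesgue)"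
    by (intro nn_integral_cong_AE, use ae in eventually_elim) simp
  moreover have "u \<in> admissible s t p q a \<Omega>" using u by (simp add: minimizer_def)
  ultimately have "w \<in> admissible s t p q a \<Omega>"
    by (simp add: admissible_iff_riesz_energy energy_cong_AE[OF ae])
  moreover have "energy p q Ksp Ktq a \<Omega> w \<le> energy p q Ksp Ktq a \<Omega> v"
    if "v \<in> admissible s t p q a \<Omega>" "AE x in lebesgue. x \<notin> \<Omega> \<longrightarrow> v x = w x" for v
  proof -
    have "AE x in lebesgue. x \<notin> \<Omega> \<longrightarrow> v x = u x"
      using that(2) ae by eventually_elim simp
    then show ?thesis using u that(1) by (simp add: minimizer_def energy_cong_AE[OF ae])
  qed
  ultimately show ?thesis by (simp add: minimizer_def)
qed

lemma borel_version_nonneg_on: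
  fixes u :: "'a::euclidean_space \<Rightarrow> real"
  assumes u: "u \<in> borel_measurable lebesgue" and D [measurable]: "D \<in> sets borel"
    and nn: "AE x in lebesgue. x \<in> D \<longrightarrow> 0 \<le> u x"
  obtains w where "w \<in> borel_measurable borel" "AE x in lebesgue. u x = w x" "\<And>x. x \<in> D \<Longrightarrow> 0 \<le> w x"
proof -
  obtain w0 where w0: "w0 \<in> borel_measurable lborel" "AE x in lborel. u x = w0 x"
    using completion_ex_borel_measurable_real[OF u] by blast
  have [measurable]: "w0 \<in> borel_measurable borel" using w0(1) by simp
  have "AE x in lebesgue. u x = w0 x" using w0(2) by (simp add: AE_completion_iff)
  then have "AE x in lebesgue. u x = (if x \<in> D then \<bar>w0 x\<bar> else w0 x)"
    using nn by eventually_elim auto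
  then show ?thesis by (intro that[of "\<lambda>x. if x \<in> D then \<bar>w0 x\<bar> else w0 x"]) auto
qed

lemma Tail_cong_AE:
  assumes "AE x in lebesgue. u x = w x"
  shows "Tail s p (neg_part u) x0 r = Tail s p (neg_part w) x0 r"
  unfolding Tail_def neg_part_def
  by (intro nn_integral_cong_AE, use assms in eventually_elim) simp

lemma Tail_a_cong_AE:
  assumes "AE x in lebesgue. u x = w x"
  shows "Tail_a t q a (neg_part u) x0 r = Tail_a t q a (neg_part w) x0 r"
  unfolding Tail_a_def neg_part_def
  by (intro SUP_cong refl nn_integral_cong_AE, use assms in eventually_elim) simp

lemma norm_shift_powr_le:
  fixes x x0 :: "'a::euclidean_space"
  assumes "0 < r" "r \<le> norm (x - x0)" "0 \<le> b"
  shows "1 / norm (x - x0) powr b \<le> (1 + (1 + norm x0) / r) powr b * (1 / (1 + norm x) powr b)"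
proof -
  have "1 + norm x \<le> (1 + norm x0) + norm (x - x0)"
    using norm_triangle_ineq[of x0 "x - x0"] by simp
  also have "1 + norm x0 \<le> (1 + norm x0) / r * norm (x - x0)"
  proof -
    have "(1 + norm x0) / r * r \<le> (1 + norm x0) / r * norm (x - x0)"
      using assms by (intro mult_left_mono) (auto intro!: divide_nonneg_nonneg add_nonneg_nonneg)
    then show ?thesis using assms by simp
  qed
  finally have "1 + norm x \<le> (1 + (1 + norm x0) / r) * norm (x - x0)" by (simp add: distrib_right)
  then have "(1 + norm x) powr b \<le> ((1 + (1 + norm x0) / r) * norm (x - x0)) powr b"
    using assms by (intro powr_mono2) auto
  then have "(1 + norm x) powr b \<le> (1 + (1 + norm x0) / r) powr b * norm (x - x0) powr b"
    by (simp add: powr_mult)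
  moreover have "0 < 1 + norm x" by (simp add: add_pos_nonneg)
  moreover have "0 < norm (x - x0)" using assms(1,2) by (rule order_less_le_trans)
  ultimately show ?thesis by (simp add: field_simps)
qed

text \<open>Away from \<open>x0\<close> the weight centred at \<open>x0\<close> is comparable to the one centred at the origin.\<close>

lemma Tail_finite:
  fixes w :: "'a::euclidean_space \<Rightarrow> real"
  assumes [measurable]: "w \<in> borel_measurable borel" and ex: "0 < r" "0 \<le> s * p" "1 \<le> p"
    and fin: "(\<integral>\<^sup>+ x. ennreal (\<bar>w x\<bar> powr (p - 1) / (1 + norm x) powr (real DIM('a) + s * p)) \<partial>lebesgue) < \<infinity>"
  shows "Tail s p (neg_part w) x0 r < \<infinity>"
proof -
  define b where "b = real DIM('a) + s * p"
  define c where "c = (1 + (1 + norm x0) / r) powr b"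
  have "Tail s p (neg_part w) x0 r \<le> (\<integral>\<^sup>+ x. ennreal c * ennreal (\<bar>w x\<bar> powr (p - 1) / (1 + norm x) powr b) \<partial>lborel)"
    unfolding Tail_def nn_integral_completion b_def[symmetric]
  proof (intro nn_integral_mono)
    fix x
    show "ennreal (neg_part w x powr (p - 1) / norm (x - x0) powr b) * indicator (UNIV - ball x0 r) x
      \<le> ennreal c * ennreal (\<bar>w x\<bar> powr (p - 1) / (1 + norm x) powr b)"
    proof (cases "x \<in> ball x0 r")
      case False
      then have d: "r \<le> norm (x - x0)" by (simp add: dist_norm norm_minus_commute)
      have "neg_part w x powr (p - 1) * (1 / norm (x - x0) powr b) \<le> \<bar>w x\<bar> powr (p - 1) * (c * (1 / (1 + norm x) powr b))"
        unfolding c_def using ex d by (intro mult_mono norm_shift_powr_le powr_mono2) (auto simp: neg_part_def b_def)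
      then have "neg_part w x powr (p - 1) / norm (x - x0) powr b \<le> c * (\<bar>w x\<bar> powr (p - 1) / (1 + norm x) powr b)"
        by (simp add: mult_ac)
      then show ?thesis using False by (simp add: ennreal_mult'[symmetric] c_def ennreal_leI)
    qed simp
  qed
  also have "\<dots> = ennreal c * (\<integral>\<^sup>+ x. ennreal (\<bar>w x\<bar> powr (p - 1) / (1 + norm x) powr b) \<partial>lborel)"
    by (intro nn_integral_cmult) measurable
  also have "\<dots> < \<infinity>" using fin by (simp add: nn_integral_completion b_def ennreal_mult_less_top)
  finally show ?thesis .
qed

lemma Tail_a_finite:
  fixes w :: "'a::euclidean_space \<Rightarrow> real"
  assumes [measurable]: "w \<in> borel_measurable borel" and ex: "0 < r" "0 \<le> t * q" "1 \<le> q"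
    and a: "coeff_cond a" and a_low: "\<And>y. (\<lambda>x. a y x) \<in> borel_measurable borel" and sub: "ball x0 r \<subseteq> \<Omega>"
    and fin: "(SUP x\<in>\<Omega>. \<integral>\<^sup>+ y. ennreal (a x y * (\<bar>w y\<bar> powr (q - 1) / (1 + norm y) powr (real DIM('a) + t * q))) \<partial>lebesgue) < \<infinity>"
      (is "?S < \<infinity>")
  shows "Tail_a t q a (neg_part w) x0 r < \<infinity>"
proof -
  define b where "b = real DIM('a) + t * q"
  define c where "c = (1 + (1 + norm x0) / r) powr b"
  have a0: "0 \<le> a x y" "a x y = a y x" for x y using a by (auto simp: coeff_cond_def)
  note [measurable] = a_low
  have "Tail_a t q a (neg_part w) x0 r \<le> ennreal c * ?S"
    unfolding Tail_a_def
  proof (rule SUP_least)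
    fix y assume y: "y \<in> ball x0 r"
    have "(\<integral>\<^sup>+ x \<in> UNIV - ball x0 r.
        ennreal (a x y * (neg_part w x powr (q - 1) / norm (x - x0) powr (real DIM('a) + t * q))) \<partial>lebesgue)
      \<le> (\<integral>\<^sup>+ x. ennreal c * ennreal (a y x * (\<bar>w x\<bar> powr (q - 1) / (1 + norm x) powr b)) \<partial>lborel)"
      unfolding nn_integral_completion b_def[symmetric]
    proof (intro nn_integral_mono)
      fix x
      show "ennreal (a x y * (neg_part w x powr (q - 1) / norm (x - x0) powr b)) * indicator (UNIV - ball x0 r) x
        \<le> ennreal c * ennreal (a y x * (\<bar>w x\<bar> powr (q - 1) / (1 + norm x) powr b))"
      proof (cases "x \<in> ball x0 r")
        case False
        then have d: "r \<le> norm (x - x0)" by (simp add: dist_norm norm_minus_commute)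
        have "neg_part w x powr (q - 1) * (1 / norm (x - x0) powr b) \<le> \<bar>w x\<bar> powr (q - 1) * (c * (1 / (1 + norm x) powr b))"
          unfolding c_def using ex d by (intro mult_mono norm_shift_powr_le powr_mono2) (auto simp: neg_part_def b_def)
        then have "a x y * (neg_part w x powr (q - 1) / norm (x - x0) powr b) \<le> a x y * (c * (\<bar>w x\<bar> powr (q - 1) / (1 + norm x) powr b))"
          by (intro mult_left_mono a0) (simp add: mult_ac)
        also have "\<dots> = c * (a y x * (\<bar>w x\<bar> powr (q - 1) / (1 + norm x) powr b))" by (simp add: a0(2)[of x y])
        finally show ?thesis using False by (simp add: ennreal_mult'[symmetric] c_def ennreal_leI)
      qed simp
    qed
    also have "\<dots> = ennreal c * (\<integral>\<^sup>+ x. ennreal (a y x * (\<bar>w x\<bar> powr (q - 1) / (1 + norm x) powr b)) \<partial>lborel)"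
      by (intro nn_integral_cmult) measurable
    also have "\<dots> \<le> ennreal c * ?S"
      using y sub unfolding nn_integral_completion b_def by (intro mult_left_mono SUP_upper) auto
    finally show "(\<integral>\<^sup>+ x \<in> UNIV - ball x0 r.
        ennreal (a x y * (neg_part w x powr (q - 1) / norm (x - x0) powr (real DIM('a) + t * q))) \<partial>lebesgue) \<le> ennreal c * ?S" .
  qed
  also have "\<dots> < \<infinity>" using fin by (simp add: ennreal_mult_less_top)
  finally show ?thesis .
qed

lemma
  fixes s t p q r :: real
  assumes "1 < p" "1 < q" "0 < r" "0 \<le> a_inf a x0 r" "0 \<le> y"
  shows h_inv_nonneg: "0 \<le> h_inv s t p q a x0 r y"
    and h_fun_h_inv: "h_fun s t p q a x0 r (h_inv s t p q a x0 r y) = y"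
proof -
  let ?h = "h_fun s t p q a x0 r"
  define K where "K = (y * r powr (s * p)) powr (1 / (p - 1))"
  have "K powr (p - 1) = y * r powr (s * p)"
    using assms by (simp add: K_def powr_powr)
  then have "K powr (p - 1) / r powr (s * p) = y" using assms by simp
  then have K: "y \<le> ?h K" "0 \<le> K" using assms by (auto simp: h_fun_def K_def)
  have "continuous_on {0..K} ?h"
    unfolding h_fun_def using assms by (intro continuous_intros continuous_on_powr') auto
  then have "\<exists>x\<ge>0. x \<le> K \<and> ?h x = y"
    using K assms by (intro IVT') (auto simp: h_fun_def)
  then have y: "y \<in> ?h ` {0..}" by auto
  show "0 \<le> h_inv s t p q a x0 r y"
    using inv_into_into[OF y] by (simp add: h_inv_def)
  show "?h (h_inv s t p q a x0 r y) = y"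
    using f_inv_into_f[OF y] by (simp add: h_inv_def)
qed

lemma h_fun_mono:
  assumes "1 < p" "1 < q" "0 \<le> a_inf a x0 r" "0 \<le> k" "k \<le> l"
  shows "h_fun s t p q a x0 r k \<le> h_fun s t p q a x0 r l"
  unfolding h_fun_def using assms
  by (intro add_mono divide_right_mono mult_left_mono powr_mono2) auto

lemma essinf_on_ge:
  fixes u :: "'a::euclidean_space \<Rightarrow> real"
  assumes [measurable]: "u \<in> borel_measurable lebesgue" and D: "D \<in> sets lebesgue"
    and ae: "AE x in lebesgue. x \<in> D \<longrightarrow> c \<le> u x"
  shows "ereal c \<le> essinf_on D u"
proof -
  have "esssup (lebesgue_on D) (\<lambda>x. - ereal (u x)) \<le> - ereal c"
  proof (rule esssup_I)
    show "(\<lambda>x. - ereal (u x)) \<in> borel_measurable (lebesgue_on D)"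
      by (intro measurable_restrict_space1) measurable
    show "AE x in lebesgue_on D. - ereal (u x) \<le> - ereal c"
      using D ae by (subst AE_restrict_space_iff) auto
  qed
  then have "- (- ereal c) \<le> - esssup (lebesgue_on D) (\<lambda>x. - ereal (u x))"
    by (simp only: ereal_minus_le_minus)
  then show ?thesis by (simp add: essinf_on_def)
qed

lemma emeasure_sublevel_zero_AE:
  assumes [measurable]: "w \<in> borel_measurable borel" and "emeasure lborel (sublevel w x0 R c) = 0"
  shows "AE x in lebesgue. x \<in> ball x0 R \<longrightarrow> c \<le> w x"
proof -
  have "sublevel w x0 R c \<in> null_sets lborel" using assms by (auto simp: null_sets_def)
  then have "AE x in lborel. x \<notin> sublevel w x0 R c" by (rule AE_not_in)
  then have "AE x in lborel. x \<in> ball x0 R \<longrightarrow> c \<le> w x"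
    by eventually_elim (auto simp: sublevel_def)
  then show ?thesis by (simp add: AE_completion_iff)
qed

text \<open>The average is 0 if \<open>u powr e\<close> is not integrable, which the assumption \<open>0 < m\<close> excludes.\<close>

lemma power_mean_ge_of_average:
  fixes u w :: "'a::euclidean_space \<Rightarrow> real"
  assumes ae: "AE x in lebesgue. u x = w x" and e: "0 < e" and r: "0 < r" and m: "0 < m"
    and le: "m \<le> average (ball x0 r) (\<lambda>x. u x powr e) powr (1 / e)"
  shows "power_mean_ge w x0 r e m"
proof -
  define I where "I = (LINT x:ball x0 r|lebesgue. u x powr e)"
  define vol where "vol = ball_vol TYPE('a) * r powr real DIM('a)"
  have vol: "0 < vol" using r by (simp add: vol_def)
  have "measure lebesgue (ball x0 r) = vol"
    using emeasure_lborel_ball_powr[OF r, of x0] vol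
    by (simp add: measure_def vol_def)
  then have av: "average (ball x0 r) (\<lambda>x. u x powr e) = I / vol"
    by (simp add: average_def I_def)
  have I0: "0 \<le> I" unfolding I_def set_lebesgue_integral_def by (intro integral_nonneg_AE) auto
  have "I \<noteq> 0" using le m av by auto
  then have int: "integrable lebesgue (\<lambda>x. indicator (ball x0 r) x *\<^sub>R (u x powr e))"
    using not_integrable_integral_eq unfolding I_def set_lebesgue_integral_def by blast
  have "m powr e \<le> ((I / vol) powr (1 / e)) powr e"
    using le m e unfolding av by (intro powr_mono2) auto
  also have "\<dots> = I / vol" using I0 vol e by (simp add: powr_powr)
  finally have "vol * m powr e \<le> I" using vol by (simp add: field_simps)
  then have "ennreal (vol * m powr e) \<le> ennreal I" by (rule ennreal_leI)
  also have "\<dots> = (\<integral>\<^sup>+x. ennreal (indicator (ball x0 r) x *\<^sub>R (u x powr e)) \<partial>lebesgue)"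
    unfolding I_def set_lebesgue_integral_def by (intro nn_integral_eq_integral[symmetric] int) auto
  also have "\<dots> = (\<integral>\<^sup>+x\<in>ball x0 r. ennreal (w x powr e) \<partial>lebesgue)"
    by (intro nn_integral_cong_AE, use ae in eventually_elim) (auto split: split_indicator)
  finally show ?thesis by (simp add: power_mean_ge_def vol_def nn_integral_completion)
qed

lemma power_mean_ge_le_bound:
  fixes w :: "'a::euclidean_space \<Rightarrow> real"
  assumes e: "0 < e" and r: "0 < r" and m: "0 < m" and M: "0 \<le> M"
    and mean: "power_mean_ge w x0 r e m"
    and bd: "AE x in lebesgue. x \<in> ball x0 r \<longrightarrow> \<bar>w x\<bar> \<le> M" and nn: "\<And>x. x \<in> ball x0 r \<Longrightarrow> 0 \<le> w x"
  shows "m \<le> M"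
proof -
  define vol where "vol = ball_vol TYPE('a) * r powr real DIM('a)"
  have vol: "0 < vol" using r by (simp add: vol_def)
  have "ennreal (vol * m powr e) \<le> (\<integral>\<^sup>+x\<in>ball x0 r. ennreal (w x powr e) \<partial>lebesgue)"
    using mean by (simp add: power_mean_ge_def vol_def nn_integral_completion)
  also have "\<dots> \<le> (\<integral>\<^sup>+x. ennreal (M powr e) * indicator (ball x0 r) x \<partial>lebesgue)"
  proof (rule nn_integral_mono_AE, use bd in eventually_elim)
    fix x assume b: "x \<in> ball x0 r \<longrightarrow> \<bar>w x\<bar> \<le> M"
    show "ennreal (w x powr e) * indicator (ball x0 r) x \<le> ennreal (M powr e) * indicator (ball x0 r) x"
    proof (cases "x \<in> ball x0 r")
      case True
      then have "w x powr e \<le> M powr e" using b nn[OF True] e by (intro powr_mono2) auto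
      then show ?thesis using True by (simp add: ennreal_leI)
    qed simp
  qed
  also have "\<dots> = ennreal (M powr e) * ennreal vol"
    unfolding vol_def nn_integral_completion emeasure_lborel_ball_powr[OF r, of x0, symmetric]
    by (rule nn_integral_cmult_indicator) simp
  also have "\<dots> = ennreal (vol * M powr e)" using vol by (simp add: ennreal_mult[symmetric] mult.commute)
  finally have "vol * m powr e \<le> vol * M powr e" using vol by (simp add: ennreal_le_iff)
  then have "m powr e \<le> M powr e" using vol by simp
  then show ?thesis using e m M by (metis powr_less_mono2 not_le)
qed

lemma gagliardo_bound:
  fixes u w :: "'a::euclidean_space \<Rightarrow> real"
  assumes ae: "AE x in lebesgue. u x = w x" and w [measurable]: "w \<in> borel_measurable borel"
    and D [measurable]: "D \<in> sets borel" and p: "0 < p" and M: "0 \<le> M"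
    and eq: "gagliardo_seminorm s p D u = ennreal M"
  shows "(\<integral>\<^sup>+x\<in>D. (\<integral>\<^sup>+y\<in>D. ennreal (\<bar>w x - w y\<bar> powr p * riesz (s * p) x y) \<partial>lborel) \<partial>lborel) \<le> ennreal (M powr p)"
proof -
  define I where "I = (\<integral>\<^sup>+ z \<in> D \<times> D. (case z of (x, y) \<Rightarrow>
                    ennreal (\<bar>u x - u y\<bar> powr p / norm (x - y) powr (real DIM('a) + s * p))) \<partial>lebesgue)"
  have fin: "I \<noteq> \<infinity>" and MI: "enn2real I powr (1 / p) = M"
    using eq M unfolding gagliardo_seminorm_def Let_def I_def[symmetric] by (auto split: if_splits)
  have "enn2real I = M powr p" using p unfolding MI[symmetric] by (simp add: powr_powr)
  then have IM: "I = ennreal (M powr p)" using fin by (metis ennreal_enn2real_if infinity_ennreal_def)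
  have [measurable]: "D \<times> D \<in> sets borel" using D by (simp add: borel_prod[symmetric])
  have bm: "(\<lambda>z. ennreal (\<bar>w (fst z) - w (snd z)\<bar> powr p * riesz (s * p) (fst z) (snd z)) * indicator (D \<times> D) z)
    \<in> borel_measurable (borel :: ('a \<times> 'a) measure)"
    unfolding borel_prod[symmetric] using D by measurable
  have "I = (\<integral>\<^sup>+ z. ennreal (\<bar>w (fst z) - w (snd z)\<bar> powr p * riesz (s * p) (fst z) (snd z)) * indicator (D \<times> D) z \<partial>lebesgue)"
    unfolding I_def
    by (intro nn_integral_cong_AE, use AE_lebesgue_pair[OF ae] in eventually_elim) (auto simp: riesz_def case_prod_beta)
  also have "\<dots> = (\<integral>\<^sup>+x. \<integral>\<^sup>+y. ennreal (\<bar>w x - w y\<bar> powr p * riesz (s * p) x y) * indicator (D \<times> D) (x, y) \<partial>lborel \<partial>lborel)"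
    by (subst nn_integral_lebesgue_pair(1)[OF bm]) simp
  also have "\<dots> = (\<integral>\<^sup>+x\<in>D. (\<integral>\<^sup>+y\<in>D. ennreal (\<bar>w x - w y\<bar> powr p * riesz (s * p) x y) \<partial>lborel) \<partial>lborel)"
    by (intro nn_integral_cong) (auto simp: indicator_times intro!: nn_integral_cong split: split_indicator)
  finally show ?thesis using IM by simp
qed

text \<open>If \<open>h\<inverse>\<close> of the tails is at least \<open>\<gamma> * m\<close>, nonnegativity of \<open>u\<close> suffices.  Otherwise the tails are at
  most \<open>h (\<gamma> * m)\<close>, and the lower bounds of the previous section give \<open>u \<ge> \<gamma> * m\<close> in the small ball.\<close>

theorem theorem1p3:
  fixes s t p q \<Lambda> \<alpha> A M :: real
  assumes "CARD('n::finite) \<ge> 2"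
    and "0 < s" "s \<le> t" "t < 1"
    and "1 < p" "p \<le> q"
    and "\<Lambda> \<ge> 1"
    and "0 < \<alpha>" "\<alpha> \<le> 1" "A \<ge> 0"
    and "\<alpha> < t * q" "t * q \<le> s * p + \<alpha>"
    and "M \<ge> 0"
  shows "\<exists>\<gamma>. 0 < \<gamma> \<and> \<gamma> < 1 \<and>
    (\<forall>(\<Omega> :: (real ^ 'n) set) Ksp Ktq a u x0 R.
       open \<Omega> \<and> bounded \<Omega> \<and>
       kernel_cond \<Lambda> (s * p) Ksp \<and> kernel_cond \<Lambda> (t * q) Ktq \<and>
       coeff_cond a \<and> holder_coeff \<alpha> A a \<and>
       u \<in> admissible s t p q a \<Omega> \<inter> tail_space s p \<inter> weighted_tail_space t q a \<Omega> \<and>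
       locally_bounded_in \<Omega> u \<and>
       minimizer s t p q Ksp Ktq a \<Omega> u \<and>
       0 < R \<and> R \<le> 1 \<and> ball x0 (4 * R) \<subseteq> \<Omega> \<and>
       (AE x in lebesgue. x \<in> ball x0 (4 * R) \<longrightarrow> 0 \<le> u x) \<and>
       data_norm s p (ball x0 (4 * R)) u = ennreal M \<longrightarrow>
       essinf_on (ball x0 R) u
         + ereal (h_inv s t p q a x0 (4 * R)
             (enn2real (Tail s p (neg_part u) x0 (4 * R)
                        + Tail_a t q a (neg_part u) x0 (4 * R))))
       \<ge> ereal (\<gamma> * min (average (ball x0 (2 * R)) (\<lambda>x. u x powr (p - 1)) powr (1 / (p - 1)))
                        (average (ball x0 (2 * R)) (\<lambda>x. u x powr (q - 1)) powr (1 / (q - 1)))))"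
proof -
  note ex = assms(2-12)
  have q: "1 < q" using assms by simp
  \<comment> \<open>A mean above \<open>M / g0\<close> is handled by the Gagliardo bound; in the case \<open>s * p \<le> n\<close> any \<open>g0\<close> will do.\<close>
  obtain g0 where g0: "0 < g0" "g0 < 1"
    "real DIM(real ^ 'n) < s * p \<longrightarrow> (\<forall>(w :: real ^ 'n \<Rightarrow> real) x0 R M m.
      w \<in> borel_measurable borel \<longrightarrow> 0 < R \<longrightarrow> R \<le> 1 \<longrightarrow> (\<forall>x\<in>ball x0 (4 * R). 0 \<le> w x) \<longrightarrow>
      (\<integral>\<^sup>+x\<in>ball x0 (4 * R). (\<integral>\<^sup>+y\<in>ball x0 (4 * R). ennreal (\<bar>w x - w y\<bar> powr p * riesz (s * p) x y) \<partial>lborel) \<partial>lborel)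
        \<le> ennreal (M powr p) \<longrightarrow>
      0 < m \<longrightarrow> 0 \<le> M \<longrightarrow> M \<le> g0 * m \<longrightarrow> power_mean_ge w x0 (2 * R) (p - 1) m \<longrightarrow>
      emeasure lborel (sublevel w x0 R (g0 * m / 2)) = 0)"
  proof (cases "real DIM(real ^ 'n) < s * p")
    case True
    from lower_bound_of_gagliardo[OF assms(5) True] show ?thesis
      by (elim exE conjE) (rule that, assumption, assumption, simp)
  next
    case False
    then show ?thesis by (intro that[of "1 / 2"]) auto
  qed
  define M' where "M' = M / g0"
  have M': "0 \<le> M'" "M \<le> M'" using g0(1,2) assms(13) mult_right_le_one_le[of M g0]
    by (auto simp: M'_def field_simps mult_left_le)
  from lower_bound_of_level_bound[OF ex M'(1), where 'a = "real ^ 'n"]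
  obtain g1 where g1: "0 < g1" "g1 < 1" "\<forall>(\<Omega> :: (real ^ 'n) set) Ksp Ktq a w x0 R m.
     nonneg_minimizer s t p q \<Lambda> \<alpha> A \<Omega> Ksp Ktq a w x0 R \<longrightarrow> 0 < m \<longrightarrow> m \<le> M' \<longrightarrow>
     power_mean_ge w x0 (2 * R) (p - 1) m \<longrightarrow> power_mean_ge w x0 (2 * R) (q - 1) m \<longrightarrow>
     Tail s p (neg_part w) x0 (4 * R) + Tail_a t q a (neg_part w) x0 (4 * R)
       \<le> ennreal (h_fun s t p q a x0 (4 * R) (g1 * m)) \<longrightarrow>
     emeasure lborel (sublevel w x0 R (g1 * m)) = 0"
    by (elim exE conjE)
  define \<gamma> where "\<gamma> = min g1 (g0 / 2)"
  have \<gamma>: "0 < \<gamma>" "\<gamma> < 1" "\<gamma> \<le> g1" "\<gamma> \<le> g0 / 2" using g0 g1 by (auto simp: \<gamma>_def)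
  show ?thesis
  proof (intro exI[of _ \<gamma>] conjI allI impI \<gamma>(1,2), elim conjE)
    fix \<Omega> :: "(real ^ 'n) set" and Ksp Ktq a u x0 R
    assume \<Omega>: "open \<Omega>" "bounded \<Omega>" and K: "kernel_cond \<Lambda> (s * p) Ksp" "kernel_cond \<Lambda> (t * q) Ktq"
      and a: "coeff_cond a" "holder_coeff \<alpha> A a"
      and u: "u \<in> admissible s t p q a \<Omega> \<inter> tail_space s p \<inter> weighted_tail_space t q a \<Omega>"
      and min: "minimizer s t p q Ksp Ktq a \<Omega> u"
      and R: "0 < R" "R \<le> 1" "ball x0 (4 * R) \<subseteq> \<Omega>"
      and nn: "AE x in lebesgue. x \<in> ball x0 (4 * R) \<longrightarrow> 0 \<le> u x"
      and data: "data_norm s p (ball x0 (4 * R)) u = ennreal M"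
    let ?B2 = "ball x0 (2 * R)" and ?B4 = "ball x0 (4 * R)"
    let ?T = "Tail s p (neg_part u) x0 (4 * R) + Tail_a t q a (neg_part u) x0 (4 * R)"
    let ?h = "h_fun s t p q a x0 (4 * R)" and ?hi = "h_inv s t p q a x0 (4 * R) (enn2real ?T)"
    define m where "m = min (average ?B2 (\<lambda>x. u x powr (p - 1)) powr (1 / (p - 1)))
                        (average ?B2 (\<lambda>x. u x powr (q - 1)) powr (1 / (q - 1)))"
    have u_meas: "u \<in> borel_measurable lebesgue" using u by (auto simp: admissible_def)
    obtain w where w: "w \<in> borel_measurable borel" and uw: "AE x in lebesgue. u x = w x"
      and wnn: "\<And>x. x \<in> ?B4 \<Longrightarrow> 0 \<le> w x"
      using borel_version_nonneg_on[OF u_meas _ nn] by auto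
    have w_leb: "w \<in> borel_measurable lebesgue" using w by (intro measurable_completion) simp
    have nm: "nonneg_minimizer s t p q \<Lambda> \<alpha> A \<Omega> Ksp Ktq a w x0 R"
      using ex \<Omega> K a w minimizer_cong_AE[OF uw w_leb min] R wnn by unfold_locales auto
    interpret nonneg_minimizer s t p q \<Lambda> \<alpha> A \<Omega> Ksp Ktq a w x0 R by (rule nm)
    have a0: "0 \<le> a_inf a x0 (4 * R)" using a_low_nonneg by (simp add: a_low_def)
    have T_eq: "?T = Tail s p (neg_part w) x0 (4 * R) + Tail_a t q a (neg_part w) x0 (4 * R)"
      by (simp add: Tail_cong_AE[OF uw] Tail_a_cong_AE[OF uw])
    have T_fin: "?T < \<infinity>"
    proof -
      have "(\<integral>\<^sup>+ x. ennreal (\<bar>w x\<bar> powr (p - 1) / (1 + norm x) powr (real DIM(real ^ 'n) + s * p)) \<partial>lebesgue)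
         = (\<integral>\<^sup>+ x. ennreal (\<bar>u x\<bar> powr (p - 1) / (1 + norm x) powr (real DIM(real ^ 'n) + s * p)) \<partial>lebesgue)"
        by (intro nn_integral_cong_AE, use uw in eventually_elim) simp
      also have "\<dots> < \<infinity>" using u by (simp add: tail_space_def)
      finally have "Tail s p (neg_part w) x0 (4 * R) < \<infinity>"
        using ex R by (intro Tail_finite w) auto
      moreover have "(SUP x\<in>\<Omega>. \<integral>\<^sup>+ y. ennreal (a x y * (\<bar>w y\<bar> powr (q - 1) / (1 + norm y) powr (real DIM(real ^ 'n) + t * q))) \<partial>lebesgue)
        = (SUP x\<in>\<Omega>. \<integral>\<^sup>+ y. ennreal (a x y * (\<bar>u y\<bar> powr (q - 1) / (1 + norm y) powr (real DIM(real ^ 'n) + t * q))) \<partial>lebesgue)"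
        by (intro SUP_cong refl nn_integral_cong_AE, use uw in eventually_elim) simp
      then have "(SUP x\<in>\<Omega>. \<integral>\<^sup>+ y. ennreal (a x y * (\<bar>w y\<bar> powr (q - 1) / (1 + norm y) powr (real DIM(real ^ 'n) + t * q))) \<partial>lebesgue) < \<infinity>"
        using u by (simp add: weighted_tail_space_def)
      then have "Tail_a t q a (neg_part w) x0 (4 * R) < \<infinity>"
        using ex R q by (intro Tail_a_finite[where \<Omega> = \<Omega>] w a) auto
      ultimately show ?thesis unfolding T_eq by simp
    qed
    have hi0: "0 \<le> ?hi" using assms q R a0 by (intro h_inv_nonneg) auto
    have hhi: "?h ?hi = enn2real ?T" using assms q R a0 by (intro h_fun_h_inv) auto
    have inf0: "ereal 0 \<le> essinf_on (ball x0 R) u"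
    proof (rule essinf_on_ge[OF u_meas])
      show "AE x in lebesgue. x \<in> ball x0 R \<longrightarrow> 0 \<le> u x"
        using nn by eventually_elim (use R(1) in auto)
    qed simp
    have m0: "0 \<le> m" by (simp add: m_def)
    have "ereal (\<gamma> * m) \<le> essinf_on (ball x0 R) u + ereal ?hi"
    proof (cases "\<gamma> * m \<le> ?hi")
      case True
      then have "ereal 0 + ereal (\<gamma> * m) \<le> essinf_on (ball x0 R) u + ereal ?hi"
        by (intro add_mono inf0) simp
      then show ?thesis by simp
    next
      case False
      then have "0 < \<gamma> * m" using hi0 by linarith
      then have m: "0 < m" using \<gamma>(1) by (simp add: zero_less_mult_iff)
      have means: "power_mean_ge w x0 (2 * R) (p - 1) m" "power_mean_ge w x0 (2 * R) (q - 1) m"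
        using assms q R m by (auto intro!: power_mean_ge_of_average[OF uw] simp: m_def)
      have null: "emeasure lborel (sublevel w x0 R (\<gamma> * m)) = 0" if "emeasure lborel (sublevel w x0 R c) = 0" "\<gamma> * m \<le> c" for c
      proof -
        have "emeasure lborel (sublevel w x0 R (\<gamma> * m)) \<le> emeasure lborel (sublevel w x0 R c)"
          using that(2) w by (intro emeasure_mono) (auto simp: sublevel_def)
        then show ?thesis using that(1) by simp
      qed
      have case1: "emeasure lborel (sublevel w x0 R (\<gamma> * m)) = 0" if mM: "m \<le> M'"
      proof (rule null)
        have "?T = ennreal (enn2real ?T)" using T_fin by simp
        also have "\<dots> = ennreal (?h ?hi)" by (simp only: hhi)
        also have "\<dots> \<le> ennreal (?h (g1 * m))"
        proof (intro ennreal_leI h_fun_mono assms q a0 hi0)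
          have "\<gamma> * m \<le> g1 * m" using \<gamma>(3) m by (intro mult_right_mono) auto
          then show "?hi \<le> g1 * m" using False by linarith
        qed
        finally have "?T \<le> ennreal (?h (g1 * m))" .
        then show "emeasure lborel (sublevel w x0 R (g1 * m)) = 0"
          using g1(3) nm m mM means unfolding T_eq by blast
        show "\<gamma> * m \<le> g1 * m" using \<gamma>(3) m by (intro mult_right_mono) auto
      qed
      have "emeasure lborel (sublevel w x0 R (\<gamma> * m)) = 0"
      proof (cases "s * p \<le> real DIM(real ^ 'n)")
        case True
        then have "Linf_norm ?B4 u = ennreal M" using data by (simp add: data_norm_def)
        then have "AE x in lebesgue_on ?B4. ennreal \<bar>u x\<bar> \<le> ennreal M"
          using esssup_AE[of "\<lambda>x. ennreal \<bar>u x\<bar>" "lebesgue_on ?B4"] by (simp add: Linf_norm_def)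
        then have "AE x in lebesgue. x \<in> ?B4 \<longrightarrow> ennreal \<bar>u x\<bar> \<le> ennreal M"
          by (subst (asm) AE_restrict_space_iff) auto
        then have "AE x in lebesgue. x \<in> ?B2 \<longrightarrow> \<bar>w x\<bar> \<le> M"
          using uw by eventually_elim (use R(1) assms(13) in auto)
        then have "m \<le> M"
          using assms R m wnn by (intro power_mean_ge_le_bound[OF _ _ _ _ means(1)]) auto
        then show ?thesis using case1 M' by simp
      next
        case False
        then have "gagliardo_seminorm s p ?B4 u = ennreal M" using data by (simp add: data_norm_def)
        then have E: "(\<integral>\<^sup>+x\<in>?B4. (\<integral>\<^sup>+y\<in>?B4. ennreal (\<bar>w x - w y\<bar> powr p * riesz (s * p) x y) \<partial>lborel) \<partial>lborel) \<le> ennreal (M powr p)"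
          using assms by (intro gagliardo_bound[OF uw w]) auto
        show ?thesis
        proof (cases "M \<le> g0 * m")
          case True
          have "\<forall>x\<in>?B4. 0 \<le> w x" using wnn by blast
          then have "emeasure lborel (sublevel w x0 R (g0 * m / 2)) = 0"
            using g0(3)[rule_format, of w R x0 M m] False w R E m assms(13) True means(1) by simp
          then show ?thesis using \<gamma>(4) m mult_right_mono[OF \<gamma>(4), of m] by (intro null[of "g0 * m / 2"]) auto
        next
          case False
          then have "m \<le> M'" using g0(1) by (simp add: M'_def field_simps)
          then show ?thesis by (rule case1)
        qed
      qed
      then have "AE x in lebesgue. x \<in> ball x0 R \<longrightarrow> \<gamma> * m \<le> w x"
        by (rule emeasure_sublevel_zero_AE[OF w])
      then have "AE x in lebesgue. x \<in> ball x0 R \<longrightarrow> \<gamma> * m \<le> u x"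
        using uw by eventually_elim auto
      then have "ereal (\<gamma> * m) \<le> essinf_on (ball x0 R) u"
        by (intro essinf_on_ge u_meas) auto
      then have "ereal (\<gamma> * m) + ereal 0 \<le> essinf_on (ball x0 R) u + ereal ?hi"
        using hi0 by (intro add_mono) auto
      then show ?thesis by simp
    qed
    then show "ereal (\<gamma> * min (average (ball x0 (2 * R)) (\<lambda>x. u x powr (p - 1)) powr (1 / (p - 1)))
                        (average (ball x0 (2 * R)) (\<lambda>x. u x powr (q - 1)) powr (1 / (q - 1))))
      \<le> essinf_on (ball x0 R) u
         + ereal (h_inv s t p q a x0 (4 * R)
             (enn2real (Tail s p (neg_part u) x0 (4 * R)
                        + Tail_a t q a (neg_part u) x0 (4 * R))))"
      unfolding m_def .
  qed
qed

end
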